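(* There exists $n_0\in\mathbb{N}$ such that for every integer $n\ge n_0$, $$\mathrm{ex}(n,K_3,\widehat{P_5})=\left\lfloor \frac{n^2}{8}\right\rfloor .$$
   Context: All graphs are finite and simple. $K_3$ is the triangle and $P_5$ is the path on five vertices. For a graph $F$, the suspension $\widehat{F}$ is the graph obtained from $F$ by adding one new vertex and joining it to every vertex of $F$; so $\widehat{P_5}$ has six vertices. A graph $G$ is $F$-free if it does not contain $F$ as a (not necessarily induced) subgraph. For graphs $H$ and $G$, $N(H,G)$ denotes the number of copies (not necessarily induced subgraphs isomorphic to $H$) of $H$ in $G$; in particular $N(K_3,G)$ is the number of triangles of $G$. The generalized Turán number is $$\mathrm{ex}(n,H,F)=\max\{N(H,G): G \text{ is an } F\text{-free graph with } |V(G)|=n\}.$$ *)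

theory Defs
  imports Complex_Main
begin

text \<open>Edges are two-element sets of vertices.\<close>

record 'a graph =
  verts :: "'a set"
  edges :: "'a set set"

definition simple_graph :: "'a graph \<Rightarrow> bool" where
  "simple_graph G \<longleftrightarrow> finite (verts G) \<and> (\<forall>e \<in> edges G. e \<subseteq> verts G \<and> card e = 2)"

definition subgraph :: "'a graph \<Rightarrow> 'a graph \<Rightarrow> bool" where
  "subgraph H G \<longleftrightarrow> simple_graph H \<and> simple_graph G \<and> verts H \<subseteq> verts G \<and> edges H \<subseteq> edges G"

definition isomorphic :: "'a graph \<Rightarrow> 'b graph \<Rightarrow> bool" where
  "isomorphic G H \<longleftrightarrow>
     (\<exists>f. bij_betw f (verts G) (verts H) \<and>
          (\<forall>u \<in> verts G. \<forall>v \<in> verts G. {u, v} \<in> edges G \<longleftrightarrow> {f u, f v} \<in> edges H))"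

text \<open>A copy of \<open>H\<close> in \<open>G\<close> is a subgraph of \<open>G\<close>, not a labelled embedding:
  automorphisms of \<open>H\<close> do not contribute separate copies.\<close>

definition copies :: "'a graph \<Rightarrow> 'b graph \<Rightarrow> 'b graph set" where
  "copies H G = {H'. subgraph H' G \<and> isomorphic H H'}"

definition num_copies :: "'a graph \<Rightarrow> 'b graph \<Rightarrow> nat" where
  "num_copies H G = card (copies H G)"

definition free_of :: "'a graph \<Rightarrow> 'b graph \<Rightarrow> bool" where
  "free_of F G \<longleftrightarrow> \<not> (\<exists>F'. subgraph F' G \<and> isomorphic F F')"

text \<open>The host graphs range over all finite simple graphs with vertices in \<open>nat\<close>;
  every finite graph is isomorphic to one of these.\<close>

definition copy_counts :: "nat \<Rightarrow> 'a graph \<Rightarrow> 'b graph \<Rightarrow> nat set" where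
  "copy_counts n H F =
     {num_copies H G | G :: nat graph. simple_graph G \<and> card (verts G) = n \<and> free_of F G}"

definition gen_turan :: "nat \<Rightarrow> 'a graph \<Rightarrow> 'b graph \<Rightarrow> nat" where
  "gen_turan n H F = Max (copy_counts n H F)"

definition complete_graph :: "nat \<Rightarrow> nat graph" where
  "complete_graph k = \<lparr>verts = {..<k}, edges = {{i, j} | i j. i < k \<and> j < k \<and> i \<noteq> j}\<rparr>"

definition path_graph :: "nat \<Rightarrow> nat graph" where
  "path_graph k = \<lparr>verts = {..<k}, edges = {{i, Suc i} | i. Suc i < k}\<rparr>"

text \<open>The new vertex of the suspension is \<open>None\<close>.\<close>

definition suspension :: "'a graph \<Rightarrow> 'a option graph" where
  "suspension F =
     \<lparr>verts = insert None (Some ` verts F),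
      edges = ((`) Some) ` edges F \<union> {{None, Some v} | v. v \<in> verts F}\<rparr>"

text \<open>The set under \<open>Max\<close> in \<^term>\<open>gen_turan n H F\<close> is always finite, and it is nonempty as soon
  as \<open>F\<close> has an edge, so the maximum is then genuinely attained.\<close>

lemma finite_copy_counts: "finite (copy_counts n H F)"
proof (rule finite_subset)
  show "copy_counts n H F \<subseteq> {.. 2 ^ n * 2 ^ 2 ^ n}"
  proof
    fix m assume "m \<in> copy_counts n H F"
    then obtain G :: "nat graph" where G: "m = num_copies H G" "simple_graph G" "card (verts G) = n"
      by (auto simp: copy_counts_def)
    let ?P = "Pow (verts G) \<times> Pow (Pow (verts G))"
    have fin: "finite (verts G)" using G by (simp add: simple_graph_def)
    have "copies H G \<subseteq> (\<lambda>(V, E). \<lparr>verts = V, edges = E\<rparr>) ` ?P"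
    proof
      fix K assume "K \<in> copies H G"
      then have "(verts K, edges K) \<in> ?P"
        by (auto simp: copies_def subgraph_def simple_graph_def)
      then show "K \<in> (\<lambda>(V, E). \<lparr>verts = V, edges = E\<rparr>) ` ?P"
        by (intro image_eqI[where x = "(verts K, edges K)"]) auto
    qed
    then have "card (copies H G) \<le> card ?P"
      using fin by (intro surj_card_le) auto
    also have "\<dots> = 2 ^ n * 2 ^ 2 ^ n"
      using fin G by (simp add: card_cartesian_product card_Pow)
    finally show "m \<in> {.. 2 ^ n * 2 ^ 2 ^ n}" using G by (simp add: num_copies_def)
  qed
qed simp

lemma copy_counts_nonempty:
  assumes "simple_graph F" "edges F \<noteq> {}"
  shows "copy_counts n H F \<noteq> {}"
proof -
  let ?G = "\<lparr>verts = {..<n}, edges = {}\<rparr> :: nat graph"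
  obtain u v where uv: "{u, v} \<in> edges F" "u \<in> verts F" "v \<in> verts F"
    using assms by (fastforce simp: simple_graph_def card_2_iff)
  then have "free_of F ?G"
    by (auto simp: free_of_def subgraph_def isomorphic_def)
  then have "num_copies H ?G \<in> copy_counts n H F"
    unfolding copy_counts_def by (force simp: simple_graph_def)
  then show ?thesis by auto
qed

lemma simple_graph_complete: "simple_graph (complete_graph k)"
  by (auto simp: simple_graph_def complete_graph_def)

lemma simple_graph_path: "simple_graph (path_graph k)"
  by (auto simp: simple_graph_def path_graph_def)

lemma simple_graph_suspension: "simple_graph F \<Longrightarrow> simple_graph (suspension F)"
  by (auto simp: simple_graph_def suspension_def card_image)

end

theory Submission
  imports Defs
begin

text \<open>Every neighbourhood of a fan-free graph is \<open>P\<^sub>5\<close>-free. Call an edge heavy if it lies in at least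
  \<open>10 ^ 15\<close> triangles. Apart from \<open>O(n\<^sup>2 / 10 ^ 15)\<close> exceptions, a triangle is either good (a heavy
  spine and two edges that lie in no other triangle) or light (no heavy edge). The two non-spine
  edges \<open>xy\<close> of a good triangle satisfy \<open>d(x) + d(y) \<le> n + 1\<close>, and a light triangle has degree sum at
  most \<open>n + O(1)\<close>. Weighting these inequalities and comparing them with
  \<open>d(x) (n - d(x)) \<le> n\<^sup>2 / 4\<close> at every vertex gives at most \<open>n\<^sup>2 / 8 + o(n\<^sup>2)\<close> triangles, and shows
  that almost all of them are good if there are at least \<open>n\<^sup>2 / 8\<close>. The comparison needs a
  neighbourhood to carry at most as many triangles as it has vertices; this fails only inside copies
  of \<open>K\<^sub>5\<close> and of \<open>K\<^sub>5\<close> minus an edge, whose vertices have few other neighbours and are weighted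
  separately.

  The non-spine edges of the good triangles form a triangle-free graph with almost \<open>n\<^sup>2 / 4\<close> edges,
  hence an almost complete bipartite graph, and all edges of one of its parts form a matching.
  Enlarge the two parts by all vertices that fit. The triangles between them number at most
  \<open>(n - s)\<^sup>2 / 8\<close> for the \<open>s\<close> remaining vertices, each of which accounts for fewer than \<open>n / 4\<close> further
  triangles.\<close>

section \<open>Graphs without a path on five vertices\<close>


text \<open>The obstacle is the exact constant in a link. A P5-free graph on p vertices may have
  3p/2 edges (disjoint copies of K4), while the comparison allows only p. Any excess forces a vertex
  with three non-leaf neighbours, hence a diamond in the link, hence a copy of K5 or K5 minus an
  edge in the graph. Distinct copies share no edge and absorb every triangle on their edges, so they
  can be accounted for one at a time.

  Triangles are counted as ordered triples, six for each, so the goal reads 3/4 n^2. The weights let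
  every kind of triangle earn about 4 n: a good one by counting its page twice, a light one through
  its degree sum, one inside a dense set through the weights \<open>U\<close>. The vertex sum is at
  most n^3/2, which leaves n^2/8, and a small slack in \<open>pointwise_ineq\<close> turns near
  equality into structure.

  The exact bound rests on a strict gain: n^2/8 drops by about n/4 per vertex removed, more than a
  leftover vertex is charged. The constants only keep the losses small; stability takes a square
  root, which leads from 10^-10 to 10^-4.\<close>

definition p5_free :: "('a \<Rightarrow> 'a \<Rightarrow> bool) \<Rightarrow> bool" where
  "p5_free H \<longleftrightarrow> (\<forall>a b c d e. distinct [a, b, c, d, e] \<longrightarrow> \<not> (H a b \<and> H b c \<and> H c d \<and> H d e))"

lemma p5_freeD:
  assumes "p5_free H" "H a b" "H b c" "H c d" "H d e" "distinct [a, b, c, d, e]"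
  shows False
  using assms unfolding p5_free_def by blast

lemma obtain_three:
  assumes "card S \<ge> 3"
  obtains a b c where "a \<in> S" "b \<in> S" "c \<in> S" "distinct [a, b, c]"
proof -
  obtain T where "T \<subseteq> S" "card T = 3" using assms by (meson obtain_subset_with_card_n)
  then show ?thesis using that unfolding card_3_iff by auto
qed

locale p5_free_graph =
  fixes H :: "'a \<Rightarrow> 'a \<Rightarrow> bool" and W :: "'a set"
  assumes fin: "finite W" and inW: "H x y \<Longrightarrow> x \<in> W" and sym: "H x y \<Longrightarrow> H y x"
    and irr: "\<not> H x x" and p5: "p5_free H"
begin

definition deg :: "'a \<Rightarrow> nat" where "deg y = card {z. H y z}"

lemma fin_nbr [simp]: "finite {z. H y z}"
  by (rule finite_subset[OF _ fin]) (use inW sym in blast)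

lemma fin_nbr' [simp]: "finite {z. H y z \<and> P z}"
  by (rule finite_subset[OF _ fin_nbr[of y]]) auto

definition nonleaf :: "'a \<Rightarrow> 'a set" where "nonleaf y = {a. H y a \<and> (\<exists>a'. a' \<noteq> y \<and> H a a')}"

text \<open>Two such neighbours p, q with further neighbours p', q' would give the path p' p y q q',
  so p' and q' coincide or one of them is q or p. One further vertex common to all three gives the
  path \<open>a y b a' c\<close>. What remains is one of the three being adjacent to the other
  two.\<close>

lemma diamond:
  assumes "card (nonleaf y) \<ge> 3"
  shows "\<exists>a b c. distinct [a, b, c] \<and> H y a \<and> H y b \<and> H y c \<and> H a b \<and> H a c"
proof -
  obtain a b c where "a \<in> nonleaf y" "b \<in> nonleaf y" "c \<in> nonleaf y" and dst: "distinct [a, b, c]"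
    using obtain_three[OF assms] by blast
  then obtain a' b' c' where
    a: "H y a" "H a a'" "a' \<noteq> y" and b: "H y b" "H b b'" "b' \<noteq> y" and c: "H y c" "H c c'" "c' \<noteq> y"
    by (auto simp: nonleaf_def)
  have ne: "a' \<noteq> a" "b' \<noteq> b" "c' \<noteq> c" "a \<noteq> y" "b \<noteq> y" "c \<noteq> y" using a b c irr by auto
  have two: "q' = p' \<or> q' = p \<or> p' = q"
    if "H y p" "H p p'" "p' \<noteq> y" "H y q" "H q q'" "q' \<noteq> y" "p \<noteq> q" for p p' q q'
  proof (rule ccontr)
    assume "\<not> ?thesis"
    then have "distinct [p', p, y, q, q']" using that irr by auto
    then show False using p5_freeD[OF p5, of p' p y q q'] that sym by blast
  qed
  have ab: "b' = a' \<or> b' = a \<or> a' = b" using two a b dst by auto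
  have ac: "c' = a' \<or> c' = a \<or> a' = c" using two a c dst by auto
  have "\<not> (a' \<notin> {b, c} \<and> b' = a' \<and> c' = a')"
    using p5_freeD[OF p5, of a y b a' c] a b c ne dst sym[OF a(1)] sym[OF c(2)] by auto
  \<comment> \<open>Here r p p' q y is the forbidden path: when p and q share the outer vertex p',
    no third neighbour r of y hangs on p.\<close>
  have cyc: False if "H p p'" "H q p'" "H r p" "H y q" "p' \<noteq> y" "distinct [p, q, r]" "H y p" "H y r" "p' \<noteq> r" for p q r p'
  proof -
    have "distinct [r, p, p', q, y]" using that irr by auto
    then show False using p5_freeD[OF p5, of r p p' q y] that sym by blast
  qed
  have "(H a b \<and> H a c) \<or> (H b a \<and> H b c) \<or> (H c a \<and> H c b)"
  proof (cases "a' = b")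
    case True
    then have "c' = b \<or> c' = a" using ac dst by auto
    then show ?thesis using True a c sym by blast
  next
    case False
    show ?thesis
    proof (cases "a' = c")
      case True
      then have "b' = c \<or> b' = a" using ab dst by auto
      then show ?thesis using True a b sym by blast
    next
      case False
      have b: "b' = a' \<or> b' = a" and c: "c' = a' \<or> c' = a" using ab ac False \<open>a' \<noteq> b\<close> by auto
      have "\<not> (b' = a' \<and> c' = a)"
        using cyc[of a a' b c] a \<open>H b b'\<close> \<open>H c c'\<close> dst \<open>H y b\<close> \<open>H y c\<close> False by auto
      moreover have "\<not> (c' = a' \<and> b' = a)"
        using cyc[of a a' c b] a \<open>H b b'\<close> \<open>H c c'\<close> dst \<open>H y b\<close> \<open>H y c\<close> \<open>a' \<noteq> b\<close> by auto
      ultimately have "b' = a" "c' = a"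
        using b c \<open>\<not> (a' \<notin> {b, c} \<and> b' = a' \<and> c' = a')\<close> False \<open>a' \<noteq> b\<close> by auto
      then show ?thesis using \<open>H b b'\<close> \<open>H c c'\<close> sym by blast
    qed
  qed
  then show ?thesis
  proof (elim disjE)
    assume "H a b \<and> H a c" then show ?thesis using dst a b c by blast
  next
    assume "H b a \<and> H b c" then show ?thesis using dst a b c
      by (intro exI[of _ b] exI[of _ a] exI[of _ c]) auto
  next
    assume "H c a \<and> H c b" then show ?thesis using dst a b c
      by (intro exI[of _ c] exI[of _ a] exI[of _ b]) auto
  qed
qed

text \<open>A fourth neighbour d of y prolongs the diamond to the path
  \<open>d y b a c\<close>.\<close>

lemma nonleaf_le_2:
  assumes "deg y \<ge> 4"
  shows "card (nonleaf y) \<le> 2"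
proof (rule ccontr)
  assume "\<not> ?thesis"
  then obtain a b c where abc: "distinct [a, b, c]" "H y a" "H y b" "H y c" "H a b" "H a c"
    using diamond[of y] by auto
  have "\<not> {z. H y z} \<subseteq> {a, b, c}"
  proof
    assume "{z. H y z} \<subseteq> {a, b, c}"
    then have "deg y \<le> card {a, b, c}" unfolding deg_def by (intro card_mono) auto
    also have "\<dots> \<le> 3" by (simp add: card_insert_if)
    finally show False using assms by simp
  qed
  then obtain d where "H y d" "d \<notin> {a, b, c}" by auto
  then have "distinct [d, y, b, a, c]" using abc irr by auto
  then show False using p5_freeD[OF p5, of d y b a c] \<open>H y d\<close> abc sym by blast
qed

definition leaves :: "'a \<Rightarrow> 'a set" where "leaves y = {a. H y a \<and> deg a = 1}"

lemma fin_leaves [simp]: "finite (leaves y)"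
  unfolding leaves_def by simp

lemma nbr_split: "deg y = card (leaves y) + card (nonleaf y)"
proof -
  have *: "deg a = 1 \<longleftrightarrow> \<not> (\<exists>a'. a' \<noteq> y \<and> H a a')" if "H y a" for a
  proof
    assume "deg a = 1"
    then obtain c where "{z. H a z} = {c}" unfolding deg_def by (auto simp: card_1_singleton_iff)
    moreover have "H a y" using that sym by blast
    ultimately show "\<not> (\<exists>a'. a' \<noteq> y \<and> H a a')" by (metis mem_Collect_eq singletonD)
  next
    assume "\<not> (\<exists>a'. a' \<noteq> y \<and> H a a')"
    then have "{z. H a z} = {y}" using sym[OF that] by blast
    then show "deg a = 1" unfolding deg_def by simp
  qed
  have "{z. H y z} = leaves y \<union> nonleaf y" "leaves y \<inter> nonleaf y = {}"
    unfolding leaves_def nonleaf_def using * by auto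
  moreover have "finite (leaves y)" "finite (nonleaf y)" unfolding leaves_def nonleaf_def by auto
  ultimately show ?thesis unfolding deg_def by (simp add: card_Un_disjoint)
qed

definition supp :: "'a set" where "supp = {y. \<exists>z. H y z}"

lemma supp_sub: "supp \<subseteq> W" unfolding supp_def using inW by blast

lemma fin_supp [simp]: "finite supp" using supp_sub fin finite_subset by blast

lemma deg_eq_sum: "card {(y, z). H y z} = (\<Sum>y\<in>supp. deg y)"
proof -
  have "{(y, z). H y z} = Sigma supp (\<lambda>y. {z. H y z})" unfolding supp_def by auto
  then show ?thesis unfolding deg_def by simp
qed

lemma sum_leaves: "(\<Sum>y\<in>supp. card (leaves y)) = card {a\<in>supp. deg a = 1}"
proof -
  have "(\<Sum>y\<in>supp. card (leaves y)) = card (Sigma supp leaves)"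
    by (simp add: leaves_def)
  also have "\<dots> = card {a\<in>supp. deg a = 1}"
  proof (rule bij_betw_same_card[of snd], unfold bij_betw_def, intro conjI)
    show "inj_on snd (Sigma supp leaves)"
    proof (rule inj_onI, clarsimp simp: leaves_def)
      fix y y' a assume "H y a" "H y' a" "deg a = Suc 0"
      then obtain c where "{z. H a z} = {c}" unfolding deg_def using card_1_singletonE by auto
      then show "y = y'" using sym[OF \<open>H y a\<close>] sym[OF \<open>H y' a\<close>] by (metis mem_Collect_eq singletonD)
    qed
    show "snd ` Sigma supp leaves = {a\<in>supp. deg a = 1}"
      
    proof (intro equalityI subsetI)
      fix a assume "a \<in> snd ` Sigma supp leaves"
      then obtain y where "H y a" "deg a = 1" unfolding leaves_def by auto
      then show "a \<in> {a\<in>supp. deg a = 1}" using sym unfolding supp_def by blast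
    next
      fix a assume "a \<in> {a\<in>supp. deg a = 1}"
      then obtain z where "H a z" "deg a = 1" unfolding supp_def by auto
      then have "(z, a) \<in> Sigma supp leaves" using sym[OF \<open>H a z\<close>] unfolding supp_def leaves_def by blast
      then show "a \<in> snd ` Sigma supp leaves" by force
    qed
  qed
  finally show ?thesis .
qed

text \<open>Either the degree is at most 3 or all but two neighbours are leaves, and each leaf is
  counted once overall. This crude bound admits K4 components and serves where the constant has room
  to spare.\<close>

lemma sum_deg_le_4: "card {(y, z). H y z} \<le> 4 * card supp"
proof -
  have "deg y \<le> 3 + card (leaves y)" for y
    using nonleaf_le_2[of y] nbr_split[of y] by linarith
  then have "(\<Sum>y\<in>supp. deg y) \<le> (\<Sum>y\<in>supp. 3 + card (leaves y))" by (intro sum_mono)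
  also have "\<dots> = 3 * card supp + card {a\<in>supp. deg a = 1}" by (simp add: sum.distrib sum_leaves)
  also have "card {a\<in>supp. deg a = 1} \<le> card supp" by (intro card_mono) auto
  finally show ?thesis unfolding deg_eq_sum by simp
qed

text \<open>The ordered edges of the components isomorphic to K2. In the link of a page they come
  from its good triangles.\<close>

definition iso :: "('a \<times> 'a) set" where "iso = {(y, z). H y z \<and> deg y = 1 \<and> deg z = 1}"

text \<open>Every leaf hands its surplus to its unique neighbour; a vertex of degree at least three has
  at most two neighbours that are not leaves.\<close>

lemma sum_deg_le_2:
  assumes "\<And>y a b c. distinct [a, b, c] \<Longrightarrow> H y a \<Longrightarrow> H y b \<Longrightarrow> H y c \<Longrightarrow> H a b \<Longrightarrow> H a c \<Longrightarrow> False"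
  shows "card {(y, z). H y z} + card iso \<le> 2 * card supp"
proof -
  have nl: "card (nonleaf y) \<le> 2" for y
  proof (rule ccontr)
    assume "\<not> ?thesis"
    then have "card (nonleaf y) \<ge> 3" by simp
    from diamond[OF this] show False using assms by blast
  qed
  define I where "I y = (if deg y = 1 \<and> leaves y \<noteq> {} then 1 else 0 :: nat)" for y
  define L where "L y = (if deg y = 1 then 1 else 0 :: nat)" for y
  have "iso = Sigma supp (\<lambda>y. if deg y = 1 then leaves y else {})"
    unfolding iso_def leaves_def supp_def by (auto split: if_splits)
  then have "card iso = (\<Sum>y\<in>supp. if deg y = 1 then card (leaves y) else 0)"
    by (auto simp: leaves_def if_distrib cong: if_cong)
  also have "\<dots> = (\<Sum>y\<in>supp. I y)"
  proof (rule sum.cong[OF refl])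
    fix y assume "y \<in> supp"
    have "leaves y = {} \<longleftrightarrow> card (leaves y) = 0" by simp
    then show "(if deg y = 1 then card (leaves y) else 0) = I y"
      using nbr_split[of y] unfolding I_def by (simp del: card_0_eq)
  qed
  finally have iso: "card iso = (\<Sum>y\<in>supp. I y)" .
  \<comment> \<open>An end of an isolated edge attains equality, 1 + 1 + 1 = 2 + 1; this is where
    the extra \<open>card iso\<close> comes from. In the sum over y the \<open>L\<close> terms
    cancel the leaves.\<close>
  have "deg y + I y + L y \<le> 2 + card (leaves y)" for y
  proof -
    have "leaves y = {} \<longleftrightarrow> card (leaves y) = 0" by simp
    then show ?thesis
      using nbr_split[of y] nl[of y] unfolding I_def L_def by (simp del: card_0_eq)
  qed
  then have "(\<Sum>y\<in>supp. deg y + I y + L y) \<le> (\<Sum>y\<in>supp. 2 + card (leaves y))" by (intro sum_mono)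
  moreover have "(\<Sum>y\<in>supp. L y) = card {a\<in>supp. deg a = 1}"
    unfolding L_def by (simp add: sum.If_cases Int_def)
  moreover have "(\<Sum>y\<in>supp. 2 + card (leaves y)) = 2 * card supp + card {a\<in>supp. deg a = 1}"
    by (simp only: sum.distrib sum_leaves) simp
  ultimately show ?thesis unfolding deg_eq_sum iso by (simp only: sum.distrib)
qed

end

section \<open>Fan-free graphs\<close>

locale fan_free =
  fixes V :: "'a set" and E :: "'a \<Rightarrow> 'a \<Rightarrow> bool"
  assumes finV: "finite V" and EV: "E x y \<Longrightarrow> x \<in> V" and symE: "E x y \<Longrightarrow> E y x"
    and irrE: "\<not> E x x"
    and no_fan: "\<lbrakk>E x a; E x b; E x c; E x d; E x e; E a b; E b c; E c d; E d e;
      distinct [a, b, c, d, e]\<rbrakk> \<Longrightarrow> False"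
begin

abbreviation n :: nat where "n \<equiv> card V"

definition N :: "'a \<Rightarrow> 'a set" where "N x = {y. E x y}"

abbreviation d :: "'a \<Rightarrow> nat" where "d x \<equiv> card (N x)"

definition cod :: "'a \<Rightarrow> 'a \<Rightarrow> nat" where "cod x y = card (N x \<inter> N y)"

text \<open>Ordered triples: every triangle counts six times, so n^2/8 triangles become 3/4 n^2
  elements.\<close>

definition T :: "('a \<times> 'a \<times> 'a) set" where "T = {(x, y, z). E x y \<and> E y z \<and> E x z}"

lemma E_comm: "E x y \<longleftrightarrow> E y x"
  using symE by blast

lemma in_N [simp]: "y \<in> N x \<longleftrightarrow> E x y"
  by (simp add: N_def)

lemma N_sub: "N x \<subseteq> V"
  using EV symE unfolding N_def by blast

lemma fin_N [simp]: "finite (N x)"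
  using N_sub finV finite_subset by metis

lemma d_le: "d x \<le> n"
  by (rule card_mono[OF finV N_sub])

lemma cod_comm: "cod x y = cod y x"
  by (simp add: cod_def Int_commute)

lemma T_sub: "T \<subseteq> V \<times> V \<times> V"
  unfolding T_def using EV symE by blast

lemma fin_T [simp]: "finite T"
  using T_sub finV finite_subset by (metis finite_cartesian_product)

text \<open>Three common neighbours a, b, c would give the path \<open>a u b w c\<close> in the
  neighbourhood of x.\<close>

lemma triple_codegree_le_2:
  assumes "E x u" "E x w" "u \<noteq> w"
  shows "card (N x \<inter> N u \<inter> N w) \<le> 2"
proof (rule ccontr)
  assume "\<not> ?thesis"
  then have "card (N x \<inter> N u \<inter> N w) \<ge> 3" by simp
  then obtain a b c where "a \<in> N x \<inter> N u \<inter> N w" "b \<in> N x \<inter> N u \<inter> N w" "c \<in> N x \<inter> N u \<inter> N w"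
    "distinct [a, b, c]" by (rule obtain_three)
  then have *: "E x a" "E x b" "E x c" "E a u" "E u b" "E b w" "E w c" "distinct [a, u, b, w, c]"
    using irrE assms(3) symE by auto
  show False using no_fan[of x a u b w c] * assms by blast
qed

text \<open>The path is \<open>u' u w v v'\<close>. The lemma is applied to two matching edges hit
  by a common neighbour w.\<close>

lemma no_double_pendant:
  assumes "E x w" "E x u" "E x u'" "E x v" "E x v'" "E u u'" "E v v'" "E w u" "E w v"
    "distinct [u, u', v, v', w]"
  shows False
  using no_fan[of x u' u w v v'] assms symE by auto

text \<open>\<open>H\<close> may be any symmetric part of the link of x, so that the degree bounds
  also apply after some triangles have been removed.\<close>

lemma p5_free_nbhd:
  assumes "\<And>y z. H y z \<Longrightarrow> E x y \<and> E x z \<and> E y z" "\<And>y z. H y z \<Longrightarrow> H z y"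
  shows "p5_free_graph H (N x)"
proof
  show "p5_free H" unfolding p5_free_def
    by (intro allI impI notI) (meson assms(1) no_fan)
  show "\<not> H y y" for y using assms(1) irrE by blast
  show "y \<in> N x" if "H y z" for y z using assms(1)[OF that] by simp
qed (use assms(2) in auto)

lemma card_link_le:
  assumes "finite C"
  shows "card {(y, z). y \<in> C \<and> z \<in> C \<and> E x y \<and> E x z \<and> E y z} \<le> 4 * card C"
proof -
  define H where "H y z \<longleftrightarrow> y \<in> C \<and> z \<in> C \<and> E x y \<and> E x z \<and> E y z" for y z
  interpret H: p5_free_graph H "N x"
    by (rule p5_free_nbhd) (use symE in \<open>auto simp: H_def\<close>)
  have "card {(y, z). H y z} \<le> 4 * card H.supp" by (rule H.sum_deg_le_4)
  also have "card H.supp \<le> card C"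
    by (rule card_mono[OF assms]) (auto simp: H.supp_def H_def)
  finally show ?thesis unfolding H_def by simp
qed

text \<open>A bipartite graph contains no triangle, hence no diamond, so \<open>sum_deg_le_2\<close>
  applies; its bound is halved because each edge is listed in one direction here.\<close>

lemma card_bip_link_le:
  assumes "finite I" "finite J" "I \<inter> J = {}"
  shows "card {(y, z). y \<in> J \<and> z \<in> I \<and> E x y \<and> E x z \<and> E y z} \<le> card I + card J"
proof -
  define R where "R = {(y, z). y \<in> J \<and> z \<in> I \<and> E x y \<and> E x z \<and> E y z}"
  define H where "H y z \<longleftrightarrow> (y, z) \<in> R \<or> (z, y) \<in> R" for y z
  interpret H: p5_free_graph H "N x"
    by (rule p5_free_nbhd) (use symE in \<open>auto simp: H_def R_def\<close>)
  have "card {(y, z). H y z} + card H.iso \<le> 2 * card H.supp"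
    by (rule H.sum_deg_le_2) (use assms(3) in \<open>auto simp: H_def R_def\<close>)
  moreover have "card H.supp \<le> card (I \<union> J)"
    by (rule card_mono) (use assms in \<open>auto simp: H.supp_def H_def R_def\<close>)
  moreover have "card (I \<union> J) = card I + card J" using assms by (simp add: card_Un_disjoint)
  moreover have "card {(y, z). H y z} = 2 * card R"
  proof -
    have "{(y, z). H y z} = R \<union> prod.swap ` R" by (auto simp: H_def)
    moreover have "R \<inter> prod.swap ` R = {}" using assms(3) by (auto simp: R_def)
    moreover have "finite R" by (rule finite_subset[of _ "J \<times> I"]) (use assms in \<open>auto simp: R_def\<close>)
    moreover have "card (prod.swap ` R) = card R" by (rule card_image) simp
    ultimately show ?thesis by (simp add: card_Un_disjoint)
  qed
  ultimately show ?thesis unfolding R_def by simp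
qed

lemma card_T_at: "card {(y, z). (x, y, z) \<in> T} \<le> 4 * d x"
proof -
  have "{(y, z). (x, y, z) \<in> T} = {(y, z). y \<in> N x \<and> z \<in> N x \<and> E x y \<and> E x z \<and> E y z}"
    by (auto simp: T_def)
  then show ?thesis using card_link_le[of "N x" x] by simp
qed

section \<open>Sums over ordered triangles\<close>

lemma sum_by_first:
  assumes "S \<subseteq> T"
  shows "(\<Sum>(x, y, z)\<in>S. f x :: real) = (\<Sum>x\<in>V. real (card {(y, z). (x, y, z) \<in> S}) * f x)"
proof -
  have fin: "finite {(y, z). (x, y, z) \<in> S}" for x
    by (rule finite_subset[of _ "V \<times> V"]) (use assms T_sub finV in auto)
  have "S = Sigma V (\<lambda>x. {(y, z). (x, y, z) \<in> S})" using assms T_sub by auto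
  then have "(\<Sum>(x, y, z)\<in>S. f x) = (\<Sum>(x, p)\<in>Sigma V (\<lambda>x. {(y, z). (x, y, z) \<in> S}). f x)"
    by (auto simp: case_prod_unfold)
  also have "\<dots> = (\<Sum>x\<in>V. \<Sum>p\<in>{(y, z). (x, y, z) \<in> S}. f x)"
    using finV fin by (subst sum.Sigma) auto
  finally show ?thesis by simp
qed

lemma card_by_first:
  assumes "S \<subseteq> T"
  shows "real (card S) = (\<Sum>x\<in>V. real (card {(y, z). (x, y, z) \<in> S}))"
  using sum_by_first[OF assms, of "\<lambda>_. 1"] by (simp add: case_prod_unfold)

text \<open>The factor is 3 and not 6 because only the vertex moved to the front is forgotten; the
  other two keep their order.\<close>

lemma card_T_perm_cover:
  fixes Q S :: "('a \<times> 'a \<times> 'a) set"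
  assumes "finite Q" "\<And>x y z. (x, y, z) \<in> S \<Longrightarrow> (x, y, z) \<in> Q \<or> (y, x, z) \<in> Q \<or> (z, x, y) \<in> Q"
  shows "card S \<le> 3 * card Q"
proof -
  define r where "r = (\<lambda>(x :: 'a, y :: 'a, z :: 'a). (y, x, z))"
  define s where "s = (\<lambda>(x :: 'a, y :: 'a, z :: 'a). (y, z, x))"
  have "S \<subseteq> Q \<union> r ` Q \<union> s ` Q"
  proof
    fix p assume "p \<in> S"
    obtain x y z where p: "p = (x, y, z)" by (cases p)
    have "(x, y, z) = r (y, x, z)" "(x, y, z) = s (z, x, y)" by (simp_all add: r_def s_def)
    then show "p \<in> Q \<union> r ` Q \<union> s ` Q" using assms(2)[of x y z] \<open>p \<in> S\<close> unfolding p by blast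
  qed
  then have "card S \<le> card (Q \<union> r ` Q \<union> s ` Q)" using assms(1) by (intro card_mono) auto
  also have "\<dots> \<le> card Q + card (r ` Q) + card (s ` Q)"
    by (intro order_trans[OF card_Un_le] add_mono order_refl)
  finally show ?thesis
    using card_image_le[OF assms(1), of r] card_image_le[OF assms(1), of s] by linarith
qed

lemma card_T_le: "real (card T) \<le> 4 * real n ^ 2"
proof -
  have "real (card T) = (\<Sum>x\<in>V. real (card {(y, z). (x, y, z) \<in> T}))" by (rule card_by_first) simp
  also have "\<dots> \<le> (\<Sum>x\<in>V. 4 * real n)"
  proof (rule sum_mono)
    fix x show "real (card {(y, z). (x, y, z) \<in> T}) \<le> 4 * real n"
      using card_T_at[of x] d_le[of x] by linarith
  qed
  finally show ?thesis by (simp add: power2_eq_square)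
qed

end

section \<open>Copies of \<open>K\<^sub>5\<close> minus an edge\<close>

context fan_free
begin

text \<open>A triangle with two further vertices joined to all of it: K5 if a and b are adjacent,
  otherwise K5 minus an edge. It is also the suspension of the diamond found in
  \<open>diamond\<close>.\<close>

definition near_K5 :: "'a \<Rightarrow> 'a \<Rightarrow> 'a \<Rightarrow> 'a \<Rightarrow> 'a \<Rightarrow> bool" where
  "near_K5 u v w a b \<longleftrightarrow> distinct [u, v, w, a, b] \<and> E u v \<and> E u w \<and> E v w \<and>
     E u a \<and> E v a \<and> E w a \<and> E u b \<and> E v b \<and> E w b"

definition dense :: "'a set set" where
  "dense = {{u, v, w, a, b} |u v w a b. near_K5 u v w a b}"

definition dense_tri :: "('a \<times> 'a \<times> 'a) set" where
  "dense_tri = {(x, y, z). (x, y, z) \<in> T \<and> (\<exists>S\<in>dense. x \<in> S \<and> y \<in> S \<and> z \<in> S)}"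

lemma near_K5_perm:
  assumes "near_K5 u v w a b"
  shows "near_K5 v w u a b" "near_K5 v u w a b" "near_K5 u v w b a"
  using assms unfolding near_K5_def by (simp_all add: E_comm) blast+

text \<open>A new common neighbour z of u and v would start the path \<open>z v a w b\<close> in the
  neighbourhood of u. The next two lemmas do the same for the edges \<open>u a\<close> and
  \<open>a b\<close>, with the paths \<open>z a v b w\<close> and \<open>z b u v w\<close>.\<close>

lemma near_K5_core:
  assumes "near_K5 u v w a b" "E u z" "E v z"
  shows "z \<in> {w, a, b}"
proof (rule ccontr)
  assume "z \<notin> {w, a, b}"
  then have "distinct [z, v, a, w, b]" using assms irrE unfolding near_K5_def by auto
  then show False using no_fan[of u z v a w b] assms symE unfolding near_K5_def by blast
qed

lemma near_K5_side:
  assumes "near_K5 u v w a b" "E u z" "E a z"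
  shows "z \<in> {v, w, b}"
proof (rule ccontr)
  assume "z \<notin> {v, w, b}"
  then have "distinct [z, a, v, b, w]" using assms irrE unfolding near_K5_def by auto
  then show False using no_fan[of u z a v b w] assms symE unfolding near_K5_def by blast
qed

lemma near_K5_last:
  assumes "near_K5 u v w a b" "E a b" "E a z" "E b z"
  shows "z \<in> {u, v, w}"
proof (rule ccontr)
  assume "z \<notin> {u, v, w}"
  then have "distinct [z, b, u, v, w]" using assms irrE unfolding near_K5_def by auto
  then show False using no_fan[of a z b u v w] assms symE unfolding near_K5_def by blast
qed

text \<open>Up to the symmetries of \<open>near_K5\<close> an edge inside S is of one of three
  kinds: within the triangle u v w, from it to a or b, or \<open>a b\<close>. Each kind has its own
  lemma above.\<close>

lemma dense_closed:
  assumes "S \<in> dense" "x \<in> S" "y \<in> S" "E x y" "E x z" "E y z"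
  shows "z \<in> S"
proof -
  obtain u v w a b where S: "S = {u, v, w, a, b}" and k: "near_K5 u v w a b"
    using assms(1) unfolding dense_def by blast
  note p = k near_K5_perm[OF k]
  note q = near_K5_perm(1)[OF p(2)] near_K5_perm(3)[OF p(2)]
  note q2 = near_K5_perm(3)[OF q(1)]
  have core: "E u z \<and> E v z \<longrightarrow> z \<in> S" "E v z \<and> E w z \<longrightarrow> z \<in> S" "E w z \<and> E u z \<longrightarrow> z \<in> S"
    using near_K5_core[OF p(1), of z] near_K5_core[OF p(2), of z] near_K5_core[OF q(1), of z] S by auto
  have side: "E u z \<and> E a z \<longrightarrow> z \<in> S" "E v z \<and> E a z \<longrightarrow> z \<in> S" "E w z \<and> E a z \<longrightarrow> z \<in> S"
    "E u z \<and> E b z \<longrightarrow> z \<in> S" "E v z \<and> E b z \<longrightarrow> z \<in> S" "E w z \<and> E b z \<longrightarrow> z \<in> S"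
    using near_K5_side[OF p(1), of z] near_K5_side[OF p(2), of z] near_K5_side[OF q(1), of z]
      near_K5_side[OF p(4), of z] near_K5_side[OF q(2), of z] near_K5_side[OF q2, of z] S by auto
  have last: "E a b \<and> E a z \<and> E b z \<longrightarrow> z \<in> S" using near_K5_last[OF p(1), of z] S by auto
  have irr: "\<not> E u u" "\<not> E v v" "\<not> E w w" "\<not> E a a" "\<not> E b b" by (simp_all add: irrE)
  have ba: "E b a \<longrightarrow> E a b" using symE by blast
  have "x = u \<or> x = v \<or> x = w \<or> x = a \<or> x = b" "y = u \<or> y = v \<or> y = w \<or> y = a \<or> y = b"
    using assms S by auto
  then show ?thesis
    using assms(4-6) by (elim disjE) (hypsubst, use core side last irr ba in blast)+
qed

text \<open>Closure spreads: from one common edge, \<open>dense_closed\<close> pulls in the third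
  vertices of triangles of S, and repeating this reaches all of S.\<close>

lemma dense_unique:
  assumes "S \<in> dense" "S' \<in> dense" "x \<in> S" "y \<in> S" "x \<in> S'" "y \<in> S'" "E x y"
  shows "S = S'"
proof -
  have "S \<subseteq> S'" if h: "S \<in> dense" "S' \<in> dense" "x \<in> S" "y \<in> S" "x \<in> S'" "y \<in> S'" for S S'
  proof -
    obtain u v w a b where S: "S = {u, v, w, a, b}" and k: "near_K5 u v w a b"
      using h(1) unfolding dense_def by blast
    have c: "\<And>p q r. p \<in> S' \<Longrightarrow> q \<in> S' \<Longrightarrow> E p q \<Longrightarrow> E p r \<Longrightarrow> E q r \<Longrightarrow> r \<in> S'"
      using dense_closed[OF h(2)] by blast
    have e: "E u v" "E v u" "E u w" "E w u" "E v w" "E w v" "E u a" "E a u" "E v a" "E a v" "E w a"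
      "E a w" "E u b" "E b u" "E v b" "E b v" "E w b" "E b w"
      using k unfolding near_K5_def by (simp_all add: E_comm)
    have 1: "u \<in> S' \<and> v \<in> S' \<longrightarrow> S \<subseteq> S'" unfolding S using c[of u v w] c[of u v a] c[of u v b] e by blast
    have 2: "v \<in> S' \<and> w \<in> S' \<longrightarrow> S \<subseteq> S'" unfolding S using c[of v w u] c[of v w a] c[of v w b] e by blast
    have 3: "w \<in> S' \<and> u \<in> S' \<longrightarrow> S \<subseteq> S'" unfolding S using c[of w u v] c[of w u a] c[of w u b] e by blast
    have 4: "a \<in> S' \<and> u \<in> S' \<longrightarrow> S \<subseteq> S'" "b \<in> S' \<and> u \<in> S' \<longrightarrow> S \<subseteq> S'"
      using c[of u a v] c[of u b v] 1 e by blast+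
    have 5: "a \<in> S' \<and> v \<in> S' \<longrightarrow> S \<subseteq> S'" "b \<in> S' \<and> v \<in> S' \<longrightarrow> S \<subseteq> S'"
      using c[of v a u] c[of v b u] 1 e by blast+
    have 6: "a \<in> S' \<and> w \<in> S' \<longrightarrow> S \<subseteq> S'" "b \<in> S' \<and> w \<in> S' \<longrightarrow> S \<subseteq> S'"
      using c[of w a u] c[of w b u] 3 e by blast+
    have 7: "E a b \<and> a \<in> S' \<and> b \<in> S' \<longrightarrow> S \<subseteq> S'"
      using c[of a b u] 4 e by blast
    have irr: "\<not> E u u" "\<not> E v v" "\<not> E w w" "\<not> E a a" "\<not> E b b" by (simp_all add: irrE)
    have ba: "E b a \<longrightarrow> E a b" using symE by blast
    show "S \<subseteq> S'"
    proof (rule ccontr)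
      assume not: "\<not> S \<subseteq> S'"
      have "\<not> (u \<in> S' \<and> v \<in> S')" "\<not> (v \<in> S' \<and> w \<in> S')" "\<not> (w \<in> S' \<and> u \<in> S')"
        "\<not> (a \<in> S' \<and> u \<in> S')" "\<not> (b \<in> S' \<and> u \<in> S')" "\<not> (a \<in> S' \<and> v \<in> S')"
        "\<not> (b \<in> S' \<and> v \<in> S')" "\<not> (a \<in> S' \<and> w \<in> S')" "\<not> (b \<in> S' \<and> w \<in> S')"
        "\<not> (E a b \<and> a \<in> S' \<and> b \<in> S')"
        using 1 2 3 4 5 6 7 not by satx+
      note facts = this irr ba
      have "x = u \<or> x = v \<or> x = w \<or> x = a \<or> x = b" "y = u \<or> y = v \<or> y = w \<or> y = a \<or> y = b"
        using h S by simp_all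
      then show False
        using h(5,6) assms(7) facts by (elim disjE) simp_all
    qed
  qed
  then show ?thesis using assms by blast
qed

text \<open>A vertex outside a dense set has neighbours of total weight at most 4 in it
  (\<open>sum_U_outside\<close>).\<close>

definition U :: "'a set \<Rightarrow> 'a \<Rightarrow> nat" where "U S x = (if card (N x \<inter> S) = 4 then 4 else 2)"

lemma dense_nbrs:
  assumes k: "near_K5 u v w a b" and S: "S = {u, v, w, a, b}"
  shows "N u \<inter> S = {v, w, a, b}" "N v \<inter> S = {u, w, a, b}" "N w \<inter> S = {u, v, a, b}"
    "N a \<inter> S = {u, v, w} \<union> (if E a b then {b} else {})"
    "N b \<inter> S = {u, v, w} \<union> (if E a b then {a} else {})"
  using k irrE unfolding S near_K5_def by (auto simp: E_comm)

lemma dense_U: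
  assumes k: "near_K5 u v w a b" and S: "S = {u, v, w, a, b}"
  shows "U S u = 4" "U S v = 4" "U S w = 4" "U S a = (if E a b then 4 else 2)"
    "U S b = (if E a b then 4 else 2)"
  using k unfolding U_def dense_nbrs[OF k S] near_K5_def by (auto simp: card_insert_if)

lemma dense_sub: "S \<in> dense \<Longrightarrow> S \<subseteq> V"
  unfolding dense_def near_K5_def using EV symE by blast

lemma fin_dense [simp]: "finite dense"
  by (rule finite_subset[of _ "Pow V"]) (use dense_sub finV in auto)

lemma fin_dense_mem: "S \<in> dense \<Longrightarrow> finite S"
  using dense_sub finV finite_subset by blast

lemma card_dense: "S \<in> dense \<Longrightarrow> card S = 5"
  unfolding dense_def near_K5_def by auto

lemma U_le_deg:
  assumes "S \<in> dense" "x \<in> S"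
  shows "U S x \<le> card (N x \<inter> S)"
proof -
  obtain u v w a b where S: "S = {u, v, w, a, b}" and k: "near_K5 u v w a b"
    using assms(1) unfolding dense_def by blast
  have "x = u \<or> x = v \<or> x = w \<or> x = a \<or> x = b" using assms(2) S by auto
  then show ?thesis using k[unfolded near_K5_def] unfolding U_def
    by (elim disjE) (simp_all add: dense_nbrs[OF k S] card_insert_if)
qed

lemma sum_U_outside:
  assumes "S \<in> dense" "z \<notin> S"
  shows "(\<Sum>x\<in>S \<inter> N z. U S x) \<le> 4"
proof -
  obtain u v w a b where S: "S = {u, v, w, a, b}" and k: "near_K5 u v w a b"
    using assms(1) unfolding dense_def by blast
  note e = k[unfolded near_K5_def]
  \<comment> \<open>Two adjacent neighbours of z in S would draw z into S by
    \<open>dense_closed\<close>. An independent subset of S has at most one vertex, of weight at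
    most 4, or is the nonadjacent pair a, b of weight 2 + 2.\<close>
  have ind: "\<not> E x y" if "x \<in> S \<inter> N z" "y \<in> S \<inter> N z" for x y
    using dense_closed[OF assms(1), of x y z] that assms(2) by (auto simp: E_comm)
  show ?thesis
  proof (cases "\<exists>c. S \<inter> N z \<subseteq> {c}")
    case True
    then obtain c where "S \<inter> N z \<subseteq> {c}" by auto
    then have "(\<Sum>x\<in>S \<inter> N z. U S x) \<le> (\<Sum>x\<in>{c}. U S x)" by (intro sum_mono2) auto
    then show ?thesis by (simp add: U_def split: if_splits)
  next
    case False
    then have "S \<inter> N z \<noteq> {}" by auto
    have "x \<in> {a, b}" if "x \<in> S \<inter> N z" for x
    proof (rule ccontr)
      assume "x \<notin> {a, b}"
      then have "x \<in> {u, v, w}" using that S by auto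
      then have "E x y" if "y \<in> S" "y \<noteq> x" for y
        using that e unfolding S by (auto simp: E_comm)
      then have "S \<inter> N z \<subseteq> {x}" using ind[OF that] by blast
      then show False using False by blast
    qed
    then have ab: "S \<inter> N z = {a, b}" using False by blast
    then have "\<not> E a b" using ind by blast
    then show ?thesis unfolding ab using e by (simp add: dense_U[OF k S])
  qed
qed

text \<open>Double counting of the weighted edges between S and all vertices z. The 100 covers the
  five z inside S, each of which sees weight at most 5 * 4.\<close>

lemma sum_U_deg:
  assumes "S \<in> dense"
  shows "(\<Sum>x\<in>S. U S x * d x) \<le> 4 * n + 100"
proof -
  have fS: "finite S" using fin_dense_mem assms by auto
  have "(\<Sum>x\<in>S. U S x * d x) = (\<Sum>x\<in>S. \<Sum>z\<in>V. if E x z then U S x else 0)"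
  proof (rule sum.cong[OF refl])
    fix x
    have "(\<Sum>z\<in>V. if E x z then U S x else 0) = (\<Sum>z\<in>V \<inter> N x. U S x)"
      using sum.inter_restrict[OF finV, of "\<lambda>_. U S x" "N x"] by simp
    then show "U S x * d x = (\<Sum>z\<in>V. if E x z then U S x else 0)"
      using N_sub[of x] by (simp add: Int_absorb1)
  qed
  also have "\<dots> = (\<Sum>z\<in>V. \<Sum>x\<in>S. if E x z then U S x else 0)" by (rule sum.swap)
  also have "\<dots> = (\<Sum>z\<in>V. \<Sum>x\<in>S \<inter> N z. U S x)"
  proof (rule sum.cong[OF refl])
    fix z
    have "(\<Sum>x\<in>S. if E x z then U S x else 0) = (\<Sum>x\<in>S. if x \<in> N z then U S x else 0)"
      using E_comm[of z] by simp
    then show "(\<Sum>x\<in>S. if E x z then U S x else 0) = (\<Sum>x\<in>S \<inter> N z. U S x)"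
      using sum.inter_restrict[OF fS, of "U S" "N z"] by simp
  qed
  also have "\<dots> \<le> (\<Sum>z\<in>V. 4 + (if z \<in> S then 20 else 0))"
  proof (rule sum_mono)
    fix z
    show "(\<Sum>x\<in>S \<inter> N z. U S x) \<le> 4 + (if z \<in> S then 20 else 0)"
    proof (cases "z \<in> S")
      case True
      have "(\<Sum>x\<in>S \<inter> N z. U S x) \<le> (\<Sum>x\<in>S. U S x)" using fS by (intro sum_mono2) auto
      also have "\<dots> \<le> (\<Sum>x\<in>S. 4)" by (intro sum_mono) (simp add: U_def)
      finally show ?thesis using card_dense[OF assms] True by simp
    qed (use sum_U_outside[OF assms] in auto)
  qed
  also have "\<dots> = 4 * n + 20 * card (V \<inter> S)"
    using sum.inter_restrict[OF finV, of "\<lambda>_. 20 :: nat" S] by (simp add: sum.distrib)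
  also have "V \<inter> S = S" using dense_sub[OF assms] by auto
  finally show ?thesis using card_dense[OF assms] by simp
qed

definition tri_in :: "'a set \<Rightarrow> ('a \<times> 'a \<times> 'a) set" where
  "tri_in S = {(x, y, z). (x, y, z) \<in> T \<and> x \<in> S \<and> y \<in> S \<and> z \<in> S}"

text \<open>K5 has 60 ordered triangles and weight 20, which gives equality in the first bound; K5
  minus an edge has 42 and weight 16. The subtracted 4 will be matched by the 4 n of
  \<open>sum_U_deg\<close>.\<close>

lemma card_tri_in_dense:
  assumes "S \<in> dense"
  shows "real (card (tri_in S)) \<le> 6 * (7/10 * real (\<Sum>x\<in>S. U S x) - 4)" "16 \<le> (\<Sum>x\<in>S. U S x)"
    "card (tri_in S) \<le> 60"
proof -
  obtain u v w a b where S: "S = {u, v, w, a, b}" and k: "near_K5 u v w a b"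
    using assms(1) unfolding dense_def by blast
  note e = k[unfolded near_K5_def]
  have fS: "finite S" unfolding S by simp
  have "tri_in S = Sigma S (\<lambda>x. Sigma (N x \<inter> S) (\<lambda>y. (N x \<inter> S) \<inter> (N y \<inter> S)))"
    unfolding tri_in_def T_def by auto
  then have t: "card (tri_in S) = (\<Sum>x\<in>S. \<Sum>y\<in>N x \<inter> S. card ((N x \<inter> S) \<inter> (N y \<inter> S)))"
    using fS by (simp add: card_SigmaI)
  have ne: "u \<noteq> v" "u \<noteq> w" "u \<noteq> a" "u \<noteq> b" "v \<noteq> w" "v \<noteq> a" "v \<noteq> b" "w \<noteq> a" "w \<noteq> b" "a \<noteq> b"
    using e by auto
  have s: "sum f S = f u + f v + f w + f a + f b" for f :: "'a \<Rightarrow> nat"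
    unfolding S using ne by (simp add: add.assoc)
  note nb = dense_nbrs[OF k S]
  have U: "(\<Sum>x\<in>S. U S x) = (if E a b then 20 else 16)"
    unfolding s dense_U[OF k S] by simp
  have "card (tri_in S) \<le> (if E a b then 60 else 42)"
  proof (cases "E a b")
    case True
    have "tri_in S \<subseteq> Sigma S (\<lambda>x. Sigma (S - {x}) (\<lambda>y. S - {x, y}))"
      unfolding tri_in_def T_def using irrE by auto
    then have "card (tri_in S) \<le> card (Sigma S (\<lambda>x. Sigma (S - {x}) (\<lambda>y. S - {x, y})))"
      using fS by (intro card_mono) auto
    also have "\<dots> = (\<Sum>x\<in>S. \<Sum>y\<in>S - {x}. card (S - {x, y}))"
      using fS by (simp add: card_SigmaI)
    also have "\<dots> = (\<Sum>x\<in>S. \<Sum>y\<in>S - {x}. 3)"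
      using fS card_dense[OF assms] by (intro sum.cong refl) (auto simp: card_Diff_subset)
    also have "\<dots> = 60" using fS card_dense[OF assms] by simp
    finally show ?thesis using True by simp
  next
    case False
    define c where "c x y = card ((N x \<inter> S) \<inter> (N y \<inter> S))" for x y
    have cc: "c x y = c y x" for x y unfolding c_def by (simp add: Int_commute)
    have "{v, w, a, b} \<inter> {u, w, a, b} = {w, a, b}" "{v, w, a, b} \<inter> {u, v, a, b} = {v, a, b}"
      "{u, w, a, b} \<inter> {u, v, a, b} = {u, a, b}" "{v, w, a, b} \<inter> {u, v, w} = {v, w}"
      "{u, w, a, b} \<inter> {u, v, w} = {u, w}" "{u, v, a, b} \<inter> {u, v, w} = {u, v}"
      using ne by auto
    then have 1: "c u v = 3" "c u w = 3" "c v w = 3" "c u a = 2" "c u b = 2" "c v a = 2" "c v b = 2"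
      "c w a = 2" "c w b = 2"
      unfolding c_def nb using False ne by simp_all
    then have 2: "c v u = 3" "c w u = 3" "c w v = 3" "c a u = 2" "c b u = 2" "c a v = 2" "c b v = 2"
      "c a w = 2" "c b w = 2" by (simp_all add: cc)
    have "card (tri_in S) = 42"
      unfolding t s c_def[symmetric] nb using False ne 1 2 by simp
    then show ?thesis using False by simp
  qed
  then show "real (card (tri_in S)) \<le> 6 * (7/10 * real (\<Sum>x\<in>S. U S x) - 4)" "16 \<le> (\<Sum>x\<in>S. U S x)"
    "card (tri_in S) \<le> 60"
    unfolding U by (simp_all split: if_splits)
qed

end

section \<open>Good, light and bad triangles\<close>

text \<open>Here \<open>m\<close> is the number of vertices, \<open>D\<close> a degree, \<open>k\<close> the part of it that is weighted by dense
  sets, and \<open>q\<close>, \<open>l\<close> count ordered pairs. The last two summands give the slack that bounds the number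
  of light triangles. The coefficient \<open>7/10\<close> is nearly forced: a \<open>K\<^sub>5\<close> needs at least \<open>7/10\<close>, and the
  inequality fails from \<open>1 / sqrt 2\<close> on.\<close>

lemma pointwise_ineq:
  fixes D k l q m :: real
  assumes "0 \<le> k" "k \<le> D" "D \<le> m" "0 \<le> l" "l \<le> q" "q \<le> 2 * (D - k)"
  shows "q * (m - D) + 4 * k * (7/10 * m - D) + l * (m/3 - D) / 20 + m * (l + k) / 400 \<le> m\<^sup>2 / 2"
proof -
  have "0 \<le> D" "0 \<le> m" using assms by auto
  have "q * (m - D) \<le> 2 * (D - k) * (m - D)" using assms by (intro mult_right_mono) auto
  moreover have "2 * (D - k) * (m - D) + 4 * k * (7/10 * m - D) + l * (m/3 - D) / 20 + m * (l + k) / 400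
     = m\<^sup>2 / 2 - (2 * (m/2 - D)\<^sup>2 - k * (8/10 * m - 2 * D + m/400)) + l * ((m/3 - D) / 20 + m/400)"
    by (simp add: field_simps power2_eq_square)
  \<comment> \<open>The expression is linear in k, so the extremes k = 0 and k = D decide.\<close>
  moreover have base: "k * (8/10 * m - 2 * D + m/400) \<le> max 0 (D * (8/10 * m - 2 * D + m/400))"
  proof (cases "0 \<le> 8/10 * m - 2 * D + m/400")
    case True
    then have "k * (8/10 * m - 2 * D + m/400) \<le> D * (8/10 * m - 2 * D + m/400)"
      using assms by (intro mult_right_mono) auto
    then show ?thesis by simp
  next
    case False
    then have "k * (8/10 * m - 2 * D + m/400) \<le> 0" using assms by (simp add: mult_nonneg_nonpos)
    then show ?thesis by simp
  qed
  \<comment> \<open>Completing the square for k = D. The spare m^2/100 is what the coefficient 7/10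
    leaves, and it pays for the slack summands.\<close>
  have sq: "D * (8/10 * m - 2 * D + m/400) = 2 * (m/2 - D)\<^sup>2 - (4 * (D - 35/100 * m)\<^sup>2 + m\<^sup>2/100 - D * m / 400)"
    by (simp add: field_simps power2_eq_square)
  have Dm: "D * m \<le> m\<^sup>2" using \<open>D \<le> m\<close> \<open>0 \<le> m\<close> by (simp add: power2_eq_square mult_right_mono)
  have "k * (8/10 * m - 2 * D + m/400) + l * ((m/3 - D) / 20 + m/400) \<le> 2 * (m/2 - D)\<^sup>2"
  \<comment> \<open>Beyond 4/10 m the coefficient of l is negative. Below it the term in l is at
    most 5/1000 m^2, which fits both into the spare m^2/100 (k = D) and into 2 (m/2 - D)^2, which is
    at least m^2/50 (k = 0).\<close>
  proof (cases "D \<le> 4/10 * m")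
    case True
    have t1: "D * (m/3 - D) \<le> m\<^sup>2 / 36"
    proof -
      have "m\<^sup>2 / 36 - D * (m/3 - D) = (m/6 - D)\<^sup>2" by (simp add: field_simps power2_eq_square)
      then show ?thesis using zero_le_power2[of "m/6 - D"] by linarith
    qed
    have DM: "D * m \<le> 4/10 * m\<^sup>2"
      using mult_right_mono[OF True \<open>0 \<le> m\<close>] by (simp add: power2_eq_square)
    have "l * ((m/3 - D) / 20 + m/400) \<le> max 0 (2 * D * ((m/3 - D) / 20 + m/400))"
    proof (cases "0 \<le> (m/3 - D) / 20 + m/400")
      case True
      then have "l * ((m/3 - D) / 20 + m/400) \<le> 2 * D * ((m/3 - D) / 20 + m/400)"
        using assms by (intro mult_right_mono) auto
      then show ?thesis by simp
    next
      case False
      then have "l * ((m/3 - D) / 20 + m/400) \<le> 0" using assms by (simp add: mult_nonneg_nonpos)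
      then show ?thesis by simp
    qed
    also have "2 * D * ((m/3 - D) / 20 + m/400) = D * (m/3 - D) / 10 + D * m / 200"
      by (simp add: field_simps)
    also have "max 0 (D * (m/3 - D) / 10 + D * m / 200) \<le> m\<^sup>2 * (5/1000)"
      using t1 DM zero_le_power2[of m] by (intro max.boundedI) linarith+
    finally have "l * ((m/3 - D) / 20 + m/400) \<le> m\<^sup>2 * (5/1000)" .
    moreover have "k * (8/10 * m - 2 * D + m/400) \<le> 2 * (m/2 - D)\<^sup>2 - m\<^sup>2 * (5/1000)"
    proof -
      have "m\<^sup>2 / 100 \<le> (m/2 - D)\<^sup>2"
        using power_mono[of "m/10" "m/2 - D" 2] True \<open>0 \<le> m\<close> by (simp add: power_divide)
      moreover have "D * (8/10 * m - 2 * D + m/400) \<le> 2 * (m/2 - D)\<^sup>2 - m\<^sup>2 * (5/1000)"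
        unfolding sq using DM zero_le_power2[of "D - 35/100 * m"] zero_le_power2[of m] by linarith
      ultimately show ?thesis using base zero_le_power2[of m] by linarith
    qed
    ultimately show ?thesis by linarith
  next
    case False
    have "(m/3 - D) / 20 + m/400 \<le> 0" using False \<open>0 \<le> m\<close> by (simp add: field_simps)
    then have "l * ((m/3 - D) / 20 + m/400) \<le> 0"
      using assms(4) by (rule mult_nonneg_nonpos[rotated])
    moreover have "D * (8/10 * m - 2 * D + m/400) \<le> 2 * (m/2 - D)\<^sup>2"
      unfolding sq using Dm zero_le_power2[of "D - 35/100 * m"] zero_le_power2[of m] by linarith
    ultimately show ?thesis using base zero_le_power2[of "m/2 - D"] by linarith
  qed
  ultimately show ?thesis by linarith
qed

lemma card_three_le:
  assumes "finite A" "finite B" "finite C"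
  shows "card A + card B + card C \<le> card (A \<union> B \<union> C) + card (A \<inter> B) + card (A \<inter> C) + card (B \<inter> C)"
proof -
  have "card A + card B = card (A \<union> B) + card (A \<inter> B)" using assms by (intro card_Un_Int) auto
  moreover have "card (A \<union> B) + card C = card (A \<union> B \<union> C) + card ((A \<union> B) \<inter> C)"
    using assms by (intro card_Un_Int) auto
  moreover have "card ((A \<union> B) \<inter> C) \<le> card (A \<inter> C) + card (B \<inter> C)"
    using card_Un_le[of "A \<inter> C" "B \<inter> C"] by (simp add: Int_Un_distrib2)
  ultimately show ?thesis by linarith
qed

section \<open>Classes of triangles and the bound on links\<close>

context fan_free
begin

definition heavy :: "nat \<Rightarrow> ('a \<times> 'a) set" where "heavy K = {(y, z). E y z \<and> K \<le> cod y z}"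

text \<open>The first vertex of a good triple is the page opposite to the heavy spine.\<close>

definition good :: "nat \<Rightarrow> ('a \<times> 'a \<times> 'a) set" where
  "good K = {(x, y, z). (x, y, z) \<in> T - dense_tri \<and> (y, z) \<in> heavy K \<and> cod x y = 1 \<and> cod x z = 1}"

definition light :: "nat \<Rightarrow> ('a \<times> 'a \<times> 'a) set" where
  "light K = {(x, y, z). (x, y, z) \<in> T - dense_tri \<and> cod x y < K \<and> cod x z < K \<and> cod y z < K}"

definition bad :: "nat \<Rightarrow> ('a \<times> 'a \<times> 'a) set" where
  "bad K = {(x, y, z). (x, y, z) \<in> T \<and> (y, z) \<in> heavy K \<and> \<not> (cod x y = 1 \<and> cod x z = 1)}"

lemma T_perm: "(x, y, z) \<in> T \<longleftrightarrow> (x, z, y) \<in> T" "(x, y, z) \<in> T \<longleftrightarrow> (y, x, z) \<in> T"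
  unfolding T_def by (auto intro: symE)

lemma dense_tri_perm:
  "(x, y, z) \<in> dense_tri \<longleftrightarrow> (x, z, y) \<in> dense_tri" "(x, y, z) \<in> dense_tri \<longleftrightarrow> (y, x, z) \<in> dense_tri"
  unfolding dense_tri_def using T_perm by auto

lemma fin_heavy [simp]: "finite (heavy K)"
  by (rule finite_subset[of _ "V \<times> V"]) (auto simp: heavy_def finV intro: EV EV[OF symE])

lemma sub_T: "good K \<subseteq> T" "light K \<subseteq> T" "bad K \<subseteq> T" "dense_tri \<subseteq> T"
  unfolding good_def light_def bad_def dense_tri_def by auto

lemma fin_sub_T [simp]: "finite (good K)" "finite (light K)" "finite (bad K)" "finite dense_tri"
  by (rule finite_subset[OF _ fin_T], rule sub_T)+

lemma card_heavy: "K * card (heavy K) \<le> card T"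
proof -
  have "K * card (heavy K) = (\<Sum>p\<in>heavy K. K)" by simp
  also have "\<dots> \<le> (\<Sum>p\<in>heavy K. card (N (fst p) \<inter> N (snd p)))"
    by (rule sum_mono) (auto simp: heavy_def cod_def)
  also have "\<dots> = card (Sigma (heavy K) (\<lambda>p. N (fst p) \<inter> N (snd p)))" by simp
  also have "\<dots> \<le> card T"
  proof (rule card_inj_on_le[of "\<lambda>((y, z), x). (x, y, z)"])
    show "inj_on (\<lambda>((y, z), x). (x, y, z)) (Sigma (heavy K) (\<lambda>p. N (fst p) \<inter> N (snd p)))"
      by (auto simp: inj_on_def)
    show "(\<lambda>((y, z), x). (x, y, z)) ` Sigma (heavy K) (\<lambda>p. N (fst p) \<inter> N (snd p)) \<subseteq> T"
      by (auto simp: heavy_def T_def E_comm)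
  qed simp
  finally show ?thesis .
qed

text \<open>In the link of y the vertex z has degree \<open>cod y z\<close>, at least 4, hence at
  most two non-leaf neighbours. A common neighbour x of y and z with \<open>cod x y\<close> other
  than 1 is such a non-leaf.\<close>

lemma bad_at:
  assumes "E y z" "4 \<le> cod y z"
  shows "card {x. E y x \<and> E z x \<and> cod x y \<noteq> 1} \<le> 2"
proof -
  define H where "H p q \<longleftrightarrow> E y p \<and> E y q \<and> E p q" for p q
  interpret H: p5_free_graph H "N y"
    by (rule p5_free_nbhd) (auto simp: H_def E_comm)
  have "{q. H z q} = N y \<inter> N z" using assms by (auto simp: H_def)
  then have "H.deg z = cod y z" unfolding H.deg_def cod_def by simp
  then have "card (H.nonleaf z) \<le> 2" using assms by (intro H.nonleaf_le_2) simp
  moreover have "{x. E y x \<and> E z x \<and> cod x y \<noteq> 1} \<subseteq> H.nonleaf z"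
  proof clarsimp
    fix x assume x: "E y x" "E z x" "cod x y \<noteq> Suc 0"
    have "N x \<inter> N y \<noteq> {z}" using x(3) by (auto simp: cod_def)
    moreover have "z \<in> N x \<inter> N y" using x assms symE by auto
    ultimately obtain a where "a \<in> N x \<inter> N y" "a \<noteq> z" by blast
    then have "H z x \<and> a \<noteq> z \<and> H x a" using x assms by (simp add: H_def)
    then show "x \<in> H.nonleaf z" unfolding H.nonleaf_def by blast
  qed
  moreover have "finite (H.nonleaf z)" unfolding H.nonleaf_def by simp
  ultimately show ?thesis by (meson card_mono le_trans)
qed

lemma card_bad:
  assumes "4 \<le> K"
  shows "card (bad K) \<le> 4 * card (heavy K)"
proof -
  define B where "B p = {x. E (fst p) x \<and> E (snd p) x \<and> cod x (fst p) \<noteq> 1} \<union>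
    {x. E (snd p) x \<and> E (fst p) x \<and> cod x (snd p) \<noteq> 1}" for p
  have finB: "finite (B p)" for p
    by (rule finite_subset[OF _ fin_N[of "fst p"]]) (auto simp: B_def)
  have "card (bad K) \<le> card (Sigma (heavy K) B)"
  proof (rule card_inj_on_le[of "\<lambda>(x, y, z). ((y, z), x)"])
    show "inj_on (\<lambda>(x, y, z). ((y, z), x)) (bad K)" by (auto simp: inj_on_def)
    show "(\<lambda>(x, y, z). ((y, z), x)) ` bad K \<subseteq> Sigma (heavy K) B"
      by (auto simp: bad_def T_def B_def E_comm)
    show "finite (Sigma (heavy K) B)" using finB by auto
  qed
  also have "\<dots> = (\<Sum>p\<in>heavy K. card (B p))" using finB by simp
  also have "\<dots> \<le> (\<Sum>p\<in>heavy K. 4)"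
  proof (rule sum_mono)
    fix p assume "p \<in> heavy K"
    then have e: "E (fst p) (snd p)" "4 \<le> cod (fst p) (snd p)" using assms by (auto simp: heavy_def)
    have "card (B p) \<le> card {x. E (fst p) x \<and> E (snd p) x \<and> cod x (fst p) \<noteq> 1} +
        card {x. E (snd p) x \<and> E (fst p) x \<and> cod x (snd p) \<noteq> 1}"
      unfolding B_def by (rule card_Un_le)
    also have "\<dots> \<le> 2 + 2"
      using e cod_comm[of "fst p"] by (intro add_mono bad_at symE[OF e(1)]) auto
    finally show "card (B p) \<le> 4" by simp
  qed
  finally show ?thesis by simp
qed

definition kap :: "'a \<Rightarrow> nat" where "kap x = (\<Sum>S\<in>{S\<in>dense. x \<in> S}. U S x)"

text \<open>A diamond in the link of x together with x is a \<open>near_K5\<close>, so with the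
  dense triangles removed \<open>sum_deg_le_2\<close> applies, and the good pairs at x are isolated
  edges. The neighbours of x inside dense sets carry no remaining link edge by
  \<open>dense_closed\<close>, and different dense sets take up different ones by
  \<open>dense_unique\<close>; so \<open>kap x\<close> can be subtracted from the support.\<close>

lemma link_bound:
  "card {(y, z). (x, y, z) \<in> T - dense_tri} + card {(y, z). (x, y, z) \<in> good K} + 2 * kap x \<le> 2 * d x"
proof -
  define H where "H y z \<longleftrightarrow> (x, y, z) \<in> T - dense_tri" for y z
  have HE: "H y z \<Longrightarrow> E x y \<and> E x z \<and> E y z" for y z unfolding H_def T_def by auto
  interpret H: p5_free_graph H "N x"
    by (rule p5_free_nbhd) (use HE T_perm dense_tri_perm in \<open>auto simp: H_def\<close>)
  have "card {(y, z). H y z} + card H.iso \<le> 2 * card H.supp"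
  proof (rule H.sum_deg_le_2)
    fix y a b c assume a: "distinct [a, b, c]" "H y a" "H y b" "H y c" "H a b" "H a c"
    have "near_K5 x y a b c"
      using HE[OF a(2)] HE[OF a(3)] HE[OF a(4)] HE[OF a(5)] HE[OF a(6)] a(1)
      unfolding near_K5_def by (auto simp: irrE)
    then have "{x, y, a, b, c} \<in> dense"
      unfolding dense_def mem_Collect_eq by (intro exI conjI) (rule refl)
    then have "(x, y, a) \<in> dense_tri"
      using a(2) unfolding dense_tri_def H_def by (auto intro!: bexI[of _ "{x, y, a, b, c}"])
    then show False using a(2) unfolding H_def by simp
  qed
  moreover have "card {(y, z). (x, y, z) \<in> good K} \<le> card H.iso"
  proof (rule card_mono)
    show "finite H.iso"
      by (rule finite_subset[of _ "N x \<times> N x"]) (use HE in \<open>auto simp: H.iso_def\<close>)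
    have one: "H.deg p = 1" if "H p q" "cod x p = 1" for p q
    proof -
      have "q \<in> N x \<inter> N p" using HE[OF that(1)] by simp
      moreover have "card (N x \<inter> N p) = 1" using that(2) by (simp add: cod_def)
      ultimately have "N x \<inter> N p = {q}" by (metis card_1_singletonE singletonD)
      moreover have "{r. H p r} \<subseteq> N x \<inter> N p" using HE by auto
      ultimately have "{r. H p r} = {q}" using that(1) by auto
      then show ?thesis unfolding H.deg_def by simp
    qed
    show "{(y, z). (x, y, z) \<in> good K} \<subseteq> H.iso"
    proof clarify
      fix y z assume g: "(x, y, z) \<in> good K"
      then have "H y z" "cod x y = 1" "cod x z = 1" unfolding good_def H_def by auto
      then show "(y, z) \<in> H.iso"
        using one[of y z] one[of z y] H.sym[of y z] by (simp add: H.iso_def)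
    qed
  qed
  moreover have "card H.supp + kap x \<le> d x"
  proof -
    let ?D = "{S\<in>dense. x \<in> S}"
    let ?A = "\<Union>S\<in>?D. N x \<inter> S"
    have "kap x \<le> (\<Sum>S\<in>?D. card (N x \<inter> S))"
      unfolding kap_def by (intro sum_mono U_le_deg) auto
    also have "\<dots> = card ?A"
    proof (rule card_UN_disjoint[symmetric])
      show "\<forall>S\<in>?D. \<forall>S'\<in>?D. S \<noteq> S' \<longrightarrow> N x \<inter> S \<inter> (N x \<inter> S') = {}"
      proof (intro ballI impI)
        fix S S' assume "S \<in> ?D" "S' \<in> ?D" "S \<noteq> S'"
        then show "N x \<inter> S \<inter> (N x \<inter> S') = {}"
          using dense_unique[of S S' x] by auto
      qed
    qed auto
    finally have "card H.supp + kap x \<le> card H.supp + card ?A" by simp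
    also have "\<dots> = card (H.supp \<union> ?A)"
    proof (rule card_Un_disjoint[symmetric])
      show "finite ?A" by auto
      show "H.supp \<inter> ?A = {}"
      proof (rule ccontr)
        assume "H.supp \<inter> ?A \<noteq> {}"
        then obtain y z S where y: "H y z" "S \<in> dense" "x \<in> S" "y \<in> S" "E x y"
          unfolding H.supp_def by auto
        then have "z \<in> S" using dense_closed[of S x y z] HE[OF y(1)] by blast
        then have "(x, y, z) \<in> dense_tri" using y unfolding H_def dense_tri_def by blast
        then show False using y(1) unfolding H_def by blast
      qed
    qed simp
    also have "\<dots> \<le> d x"
      using H.supp_sub by (intro card_mono) auto
    finally show ?thesis .
  qed
  ultimately show ?thesis unfolding H_def by linarith
qed

end

section \<open>Counting with degrees\<close>

context fan_free
begin

lemma good_pair: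
  assumes "(x, y, z) \<in> good K"
  shows "d x + d y \<le> n + 1"
proof -
  have "d x + d y = card (N x \<union> N y) + cod x y" unfolding cod_def by (rule card_Un_Int) auto
  moreover have "card (N x \<union> N y) \<le> n" using N_sub finV by (intro card_mono) auto
  ultimately show ?thesis using assms by (simp add: good_def)
qed

lemma light_triple:
  assumes "(x, y, z) \<in> light K"
  shows "d x + d y + d z \<le> n + 3 * K"
proof -
  have "d x + d y + d z \<le> card (N x \<union> N y \<union> N z) + cod x y + cod x z + cod y z"
    unfolding cod_def by (rule card_three_le) auto
  moreover have "card (N x \<union> N y \<union> N z) \<le> n" using N_sub finV by (intro card_mono) auto
  ultimately show ?thesis using assms by (simp add: light_def)
qed

lemma light_perm:
  "(x, y, z) \<in> light K \<longleftrightarrow> (y, x, z) \<in> light K" "(x, y, z) \<in> light K \<longleftrightarrow> (x, z, y) \<in> light K"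
  unfolding light_def using T_perm dense_tri_perm cod_comm by auto

lemma sum_light_perm:
  fixes f :: "'a \<Rightarrow> real"
  shows "(\<Sum>(x, y, z)\<in>light K. f y) = (\<Sum>(x, y, z)\<in>light K. f x)"
    "(\<Sum>(x, y, z)\<in>light K. f z) = (\<Sum>(x, y, z)\<in>light K. f x)"
proof -
  show "(\<Sum>(x, y, z)\<in>light K. f y) = (\<Sum>(x, y, z)\<in>light K. f x)"
    by (rule sum.reindex_bij_witness[of _ "\<lambda>(x, y, z). (y, x, z)" "\<lambda>(x, y, z). (y, x, z)"])
      (auto simp: light_perm(1))
  show "(\<Sum>(x, y, z)\<in>light K. f z) = (\<Sum>(x, y, z)\<in>light K. f x)"
  proof (rule sum.reindex_bij_witness[of _ "\<lambda>(x, y, z). (z, y, x)" "\<lambda>(x, y, z). (z, y, x)"])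
    have "(z, y, x) \<in> light K" if "(x, y, z) \<in> light K" for x y z
      using that light_perm by metis
    then show "\<And>a. a \<in> light K \<Longrightarrow> (case a of (x, y, z) \<Rightarrow> (z, y, x)) \<in> light K" by auto
    then show "\<And>a. a \<in> light K \<Longrightarrow> (case a of (x, y, z) \<Rightarrow> (z, y, x)) \<in> light K" .
  qed auto
qed

text \<open>\<open>light_triple\<close> averaged over the three positions. The case c = 1 yields the
  main term. For c = 1/3 the leading term vanishes: light triples have mean degree at most n/3 + K,
  so the summand with m/3 - D in \<open>pointwise_ineq\<close> has almost nonnegative total.\<close>

lemma sum_light:
  fixes c :: real
  shows "(3 * c - 1) * (real (card (light K)) * real n) - 3 * real K * real (card (light K))
    \<le> 3 * (\<Sum>(x, y, z)\<in>light K. c * real n - real (d x))"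
proof -
  let ?f = "\<lambda>x. c * real n - real (d x)"
  have "(3 * c - 1) * (real (card (light K)) * real n) - 3 * real K * real (card (light K))
    = (\<Sum>(x, y, z)\<in>light K. (3 * c - 1) * real n - 3 * real K)"
    by (simp add: case_prod_unfold algebra_simps)
  also have "\<dots> \<le> (\<Sum>(x, y, z)\<in>light K. ?f x + ?f y + ?f z)"
  proof (rule sum_mono, clarify)
    fix x y z assume "(x, y, z) \<in> light K"
    then have "real (d x + d y + d z) \<le> real (n + 3 * K)"
      using light_triple of_nat_le_iff by blast
    then show "(3 * c - 1) * real n - 3 * real K \<le> ?f x + ?f y + ?f z"
      by (simp add: algebra_simps)
  qed
  also have "\<dots> = (\<Sum>(x, y, z)\<in>light K. ?f x) + (\<Sum>(x, y, z)\<in>light K. ?f y) + (\<Sum>(x, y, z)\<in>light K. ?f z)"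
    by (simp only: case_prod_unfold sum.distrib)
  also have "\<dots> = 3 * (\<Sum>(x, y, z)\<in>light K. ?f x)"
    unfolding sum_light_perm by simp
  finally show ?thesis .
qed

definition sum_kap :: real where "sum_kap = (\<Sum>x\<in>V. real (kap x))"

lemma sum_kap_swap:
  "(\<Sum>x\<in>V. real (kap x) * f x) = (\<Sum>S\<in>dense. \<Sum>x\<in>S. real (U S x) * f x)"
proof -
  have "(\<Sum>x\<in>V. real (kap x) * f x) = (\<Sum>x\<in>V. \<Sum>S\<in>{S\<in>dense. x \<in> S}. real (U S x) * f x)"
    by (simp add: kap_def sum_distrib_right)
  also have "\<dots> = (\<Sum>S\<in>dense. \<Sum>x\<in>{x\<in>V. x \<in> S}. real (U S x) * f x)"
    by (rule sum.swap_restrict) (auto simp: finV)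
  also have "\<dots> = (\<Sum>S\<in>dense. \<Sum>x\<in>S. real (U S x) * f x)"
  proof (rule sum.cong[OF refl])
    fix S assume "S \<in> dense"
    then have "{x\<in>V. x \<in> S} = S" using dense_sub by auto
    then show "(\<Sum>x\<in>{x\<in>V. x \<in> S}. real (U S x) * f x) = (\<Sum>x\<in>S. real (U S x) * f x)" by simp
  qed
  finally show ?thesis .
qed

lemma card_dense_le: "16 * real (card dense) \<le> sum_kap"
proof -
  have "16 * real (card dense) = (\<Sum>S\<in>dense. 16)" by simp
  also have "\<dots> \<le> (\<Sum>S\<in>dense. real (\<Sum>x\<in>S. U S x))"
    by (intro sum_mono) (use card_tri_in_dense(2) in \<open>fastforce simp del: of_nat_sum\<close>)
  also have "\<dots> = sum_kap" unfolding sum_kap_def using sum_kap_swap[of "\<lambda>_. 1"] by simp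
  finally show ?thesis .
qed

text \<open>The 4 n of \<open>sum_U_deg\<close> becomes the 4 subtracted in
  \<open>card_tri_in_dense\<close>; 400 is four times the 100 there.\<close>

lemma sum_dense:
  "2/3 * real n * (\<Sum>S\<in>dense. real (card (tri_in S))) - 400 * real (card dense)
    \<le> (\<Sum>x\<in>V. 4 * real (kap x) * (7/10 * real n - real (d x)))"
proof -
  have "2/3 * real n * (\<Sum>S\<in>dense. real (card (tri_in S))) - 400 * real (card dense)
    = (\<Sum>S\<in>dense. 2/3 * real n * real (card (tri_in S)) - 400)"
    by (simp add: sum_distrib_left sum_subtractf)
  also have "\<dots> \<le> (\<Sum>S\<in>dense. 4 * (\<Sum>x\<in>S. real (U S x) * (7/10 * real n - real (d x))))"
  proof (rule sum_mono)
    fix S assume S: "S \<in> dense"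
    have "2/3 * real n * real (card (tri_in S)) \<le> 2/3 * real n * (6 * (7/10 * real (\<Sum>x\<in>S. U S x) - 4))"
      by (rule mult_left_mono[OF card_tri_in_dense(1)[OF S]]) simp
    moreover have "real (\<Sum>x\<in>S. U S x * d x) \<le> real (4 * n + 100)"
      using sum_U_deg[OF S] of_nat_le_iff by blast
    moreover have "(\<Sum>x\<in>S. real (U S x) * (7/10 * real n - real (d x)))
      = 7/10 * real n * real (\<Sum>x\<in>S. U S x) - real (\<Sum>x\<in>S. U S x * d x)"
      by (simp add: right_diff_distrib sum_subtractf sum_distrib_left mult_ac)
    ultimately show "2/3 * real n * real (card (tri_in S)) - 400
      \<le> 4 * (\<Sum>x\<in>S. real (U S x) * (7/10 * real n - real (d x)))"
      by (simp add: algebra_simps del: of_nat_sum)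
  qed
  also have "\<dots> = 4 * (\<Sum>x\<in>V. real (kap x) * (7/10 * real n - real (d x)))"
    by (simp add: sum_kap_swap sum_distrib_left)
  finally show ?thesis by (simp add: sum_distrib_left mult.assoc)
qed

text \<open>With f = n - d, a good triple (x, y, z) supplies f x as itself, f y from each of its
  rearrangements (y, x, z) and (y, z, x), and f x once more from the separate sum over
  \<open>good\<close>. By \<open>good_pair\<close> this is 2 (f x + f y), at least 2 n - 2. This is
  why \<open>link_bound\<close> counts good pairs twice.\<close>

lemma sum_sparse:
  assumes "2 \<le> K"
  shows "real (card (good K)) * (2 * real n - 2) + (\<Sum>(x, y, z)\<in>light K. real n - real (d x))
    \<le> (\<Sum>(x, y, z)\<in>T - dense_tri. real n - real (d x)) + (\<Sum>(x, y, z)\<in>good K. real n - real (d x))"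
proof -
  let ?f = "\<lambda>x. real n - real (d x)"
  define r1 where "r1 = (\<lambda>(x :: 'a, y :: 'a, z :: 'a). (y, x, z))"
  define r2 where "r2 = (\<lambda>(x :: 'a, y :: 'a, z :: 'a). (y, z, x))"
  have f0: "0 \<le> ?f x" for x using d_le[of x] by simp
  have inj: "inj_on r1 (good K)" "inj_on r2 (good K)" by (auto simp: inj_on_def r1_def r2_def)
  have s1: "sum (\<lambda>(x, y, z). ?f x) (r1 ` good K) = (\<Sum>(x, y, z)\<in>good K. ?f y)"
    unfolding sum.reindex[OF inj(1)] by (auto simp: r1_def case_prod_unfold)
  have s2: "sum (\<lambda>(x, y, z). ?f x) (r2 ` good K) = (\<Sum>(x, y, z)\<in>good K. ?f y)"
    unfolding sum.reindex[OF inj(2)] by (auto simp: r2_def case_prod_unfold)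
  have g: "(x, y, z) \<in> good K \<Longrightarrow> (x, y, z) \<in> T - dense_tri \<and> (y, x, z) \<in> T - dense_tri \<and>
      (y, z, x) \<in> T - dense_tri \<and> cod x y = 1 \<and> cod y x = 1 \<and> cod x z = 1 \<and> cod z x = 1 \<and>
      K \<le> cod y z \<and> K \<le> cod z y" for x y z
    using T_perm[of x y z] dense_tri_perm[of x y z] T_perm(1)[of y x z] dense_tri_perm(1)[of y x z]
      cod_comm[of x y] cod_comm[of x z] cod_comm[of y z]
    unfolding good_def heavy_def by auto
  have l: "(x, y, z) \<in> light K \<Longrightarrow> (x, y, z) \<in> T - dense_tri \<and> cod x y < K \<and> cod x z < K \<and> cod y z < K"
    for x y z unfolding light_def by auto
  have sub: "light K \<union> good K \<union> r1 ` good K \<union> r2 ` good K \<subseteq> T - dense_tri"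
    using g l by (auto simp: r1_def r2_def)
  have p: "p \<in> good K \<Longrightarrow> K \<le> cod (fst (snd p)) (snd (snd p))"
      "p \<in> good K \<Longrightarrow> cod (fst p) (fst (snd p)) = 1 \<and> cod (fst p) (snd (snd p)) = 1"
      "p \<in> light K \<Longrightarrow> cod (fst p) (fst (snd p)) < K \<and> cod (fst p) (snd (snd p)) < K \<and>
        cod (fst (snd p)) (snd (snd p)) < K"
      "p \<in> r1 ` good K \<Longrightarrow> K \<le> cod (fst p) (snd (snd p))"
      "p \<in> r1 ` good K \<Longrightarrow> cod (fst p) (fst (snd p)) = 1 \<and> cod (fst (snd p)) (snd (snd p)) = 1"
      "p \<in> r2 ` good K \<Longrightarrow> K \<le> cod (fst p) (fst (snd p))" for p
    unfolding r1_def r2_def by (cases p, auto dest!: g l)+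
  have disj: "light K \<inter> good K = {}" "(light K \<union> good K) \<inter> r1 ` good K = {}"
    "(light K \<union> good K \<union> r1 ` good K) \<inter> r2 ` good K = {}"
  proof -
    have False if "q \<in> light K" "q \<in> good K" for q using p(1)[OF that(2)] p(3)[OF that(1)] by linarith
    then show "light K \<inter> good K = {}" by blast
    have False if "q \<in> light K" "q \<in> r1 ` good K" for q
      using p(4)[OF that(2)] p(3)[OF that(1)] by linarith
    moreover have False if "q \<in> good K" "q \<in> r1 ` good K" for q
      using p(1)[OF that(1)] p(5)[OF that(2)] assms by linarith
    ultimately show "(light K \<union> good K) \<inter> r1 ` good K = {}" by blast
    have False if "q \<in> light K" "q \<in> r2 ` good K" for q
      using p(6)[OF that(2)] p(3)[OF that(1)] by linarith
    moreover have False if "q \<in> good K" "q \<in> r2 ` good K" for q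
      using p(2)[OF that(1)] p(6)[OF that(2)] assms by linarith
    moreover have False if "q \<in> r1 ` good K" "q \<in> r2 ` good K" for q
      using p(5)[OF that(1)] p(6)[OF that(2)] assms by linarith
    ultimately show "(light K \<union> good K \<union> r1 ` good K) \<inter> r2 ` good K = {}" by blast
  qed
  have "real (card (good K)) * (2 * real n - 2) = (\<Sum>(x, y, z)\<in>good K. 2 * real n - 2)"
    by (simp add: case_prod_unfold)
  also have "\<dots> \<le> (\<Sum>(x, y, z)\<in>good K. ?f x + ?f y + ?f y + ?f x)"
  proof (rule sum_mono, clarify)
    fix x y z assume "(x, y, z) \<in> good K"
    then have "real (d x + d y) \<le> real (n + 1)" using good_pair of_nat_le_iff by blast
    then show "2 * real n - 2 \<le> ?f x + ?f y + ?f y + ?f x" by simp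
  qed
  also have "\<dots> = (\<Sum>(x, y, z)\<in>good K. ?f x) + sum (\<lambda>(x, y, z). ?f x) (r1 ` good K)
      + sum (\<lambda>(x, y, z). ?f x) (r2 ` good K) + (\<Sum>(x, y, z)\<in>good K. ?f x)"
    unfolding s1 s2 by (simp only: case_prod_unfold sum.distrib)
  finally have 1: "real (card (good K)) * (2 * real n - 2) \<le> (\<Sum>(x, y, z)\<in>good K. ?f x)
      + sum (\<lambda>(x, y, z). ?f x) (r1 ` good K)
      + sum (\<lambda>(x, y, z). ?f x) (r2 ` good K) + (\<Sum>(x, y, z)\<in>good K. ?f x)" .
  have "(\<Sum>(x, y, z)\<in>light K. ?f x) + (\<Sum>(x, y, z)\<in>good K. ?f x)
      + sum (\<lambda>(x, y, z). ?f x) (r1 ` good K) + sum (\<lambda>(x, y, z). ?f x) (r2 ` good K)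
    = sum (\<lambda>(x, y, z). ?f x) (light K \<union> good K \<union> r1 ` good K \<union> r2 ` good K)"
    using disj by (simp add: sum.union_disjoint)
  also have "\<dots> \<le> (\<Sum>(x, y, z)\<in>T - dense_tri. ?f x)"
    using sub f0 by (intro sum_mono2) auto
  finally show ?thesis using 1 by linarith
qed

text \<open>A good triangle has two good orderings, worth 2 n each; a light or dense one has six,
  worth 2/3 n each. So each kind contributes about 4 n per triangle against n^3/2. The summand with
  divisor 400 is the surplus that bounds light and dense triangles.\<close>

lemma main_ineq:
  assumes "2 \<le> K"
  shows "real (card (good K)) * (2 * real n - 2) + 2/3 * real n * real (card (light K))
     + 2/3 * real n * (\<Sum>S\<in>dense. real (card (tri_in S)))
     + real n * (real (card (light K)) + sum_kap) / 400
   \<le> real n ^ 3 / 2 + 2 * real K * real (card (light K)) + 400 * real (card dense)"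
proof -
  let ?o = "\<lambda>x. real (card {(y, z). (x, y, z) \<in> T - dense_tri})"
  let ?g = "\<lambda>x. real (card {(y, z). (x, y, z) \<in> good K})"
  let ?l = "\<lambda>x. real (card {(y, z). (x, y, z) \<in> light K})"
  let ?k = "\<lambda>x. real (kap x)"
  let ?d = "\<lambda>x. real (d x)"
  have "(\<Sum>x\<in>V. (?o x + ?g x) * (real n - ?d x) + 4 * ?k x * (7/10 * real n - ?d x)
      + ?l x * (real n / 3 - ?d x) / 20 + real n * (?l x + ?k x) / 400) \<le> (\<Sum>x\<in>V. (real n)\<^sup>2 / 2)"
  \<comment> \<open>Used with D = \<open>d x\<close>, k = \<open>kap x\<close>, q the pairs outside
    dense triangles plus the good pairs, and l the light pairs at x.\<close>
  proof (rule sum_mono, rule pointwise_ineq)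
    fix x
    have "real (card {(y, z). (x, y, z) \<in> T - dense_tri} + card {(y, z). (x, y, z) \<in> good K} + 2 * kap x)
      \<le> real (2 * d x)" using link_bound of_nat_le_iff by blast
    then show 1: "?o x + ?g x \<le> 2 * (?d x - ?k x)" by simp
    then show "?k x \<le> ?d x" by (smt (verit) of_nat_0_le_iff)
    show "?d x \<le> real n" using d_le by simp
    have "finite {(y, z). (x, y, z) \<in> T}"
      by (rule finite_subset[of _ "N x \<times> N x"]) (auto simp: T_def)
    then have "card {(y, z). (x, y, z) \<in> light K} \<le> card {(y, z). (x, y, z) \<in> T - dense_tri}"
      by (intro card_mono) (auto simp: light_def elim!: rev_finite_subset)
    then show "?l x \<le> ?o x + ?g x" by simp
  qed auto
  also have "(\<Sum>x\<in>V. (real n)\<^sup>2 / 2) = real n ^ 3 / 2"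
    by (simp add: power2_eq_square power3_eq_cube)
  also have "(\<Sum>x\<in>V. (?o x + ?g x) * (real n - ?d x) + 4 * ?k x * (7/10 * real n - ?d x)
      + ?l x * (real n / 3 - ?d x) / 20 + real n * (?l x + ?k x) / 400)
    = (\<Sum>x\<in>V. ?o x * (real n - ?d x)) + (\<Sum>x\<in>V. ?g x * (real n - ?d x))
     + (\<Sum>x\<in>V. 4 * ?k x * (7/10 * real n - ?d x))
     + (\<Sum>x\<in>V. ?l x * (1/3 * real n - ?d x)) / 20 + real n * ((\<Sum>x\<in>V. ?l x) + (\<Sum>x\<in>V. ?k x)) / 400"
    by (simp add: sum.distrib distrib_right flip: sum_divide_distrib sum_distrib_left)
  also have "(\<Sum>x\<in>V. ?o x * (real n - ?d x)) = (\<Sum>(x, y, z)\<in>T - dense_tri. real n - ?d x)"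
    by (rule sum_by_first[symmetric]) auto
  also have "(\<Sum>x\<in>V. ?g x * (real n - ?d x)) = (\<Sum>(x, y, z)\<in>good K. real n - ?d x)"
    by (rule sum_by_first[symmetric, OF sub_T(1)])
  also have "(\<Sum>x\<in>V. ?l x * (1/3 * real n - ?d x)) = (\<Sum>(x, y, z)\<in>light K. 1/3 * real n - ?d x)"
    by (rule sum_by_first[symmetric, OF sub_T(2)])
  also have "(\<Sum>x\<in>V. ?l x) = real (card (light K))"
    by (rule card_by_first[symmetric, OF sub_T(2)])
  also have "(\<Sum>x\<in>V. ?k x) = sum_kap" unfolding sum_kap_def ..
  finally have main: "(\<Sum>(x, y, z)\<in>T - dense_tri. real n - ?d x) + (\<Sum>(x, y, z)\<in>good K. real n - ?d x)
     + (\<Sum>x\<in>V. 4 * ?k x * (7/10 * real n - ?d x)) + (\<Sum>(x, y, z)\<in>light K. 1/3 * real n - ?d x) / 20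
     + real n * (real (card (light K)) + sum_kap) / 400 \<le> real n ^ 3 / 2" .
  define L where "L = real (card (light K)) * real n"
  define KL where "KL = real K * real (card (light K))"
  have KL: "0 \<le> KL" unfolding KL_def by simp
  have "2 * L - 3 * KL \<le> 3 * (\<Sum>(x, y, z)\<in>light K. real n - ?d x)"
    using sum_light[of 1 K] unfolding L_def KL_def by (simp add: mult.assoc)
  moreover have "- 3 * KL \<le> 3 * (\<Sum>(x, y, z)\<in>light K. 1/3 * real n - ?d x)"
    using sum_light[of "1/3" K] unfolding L_def KL_def by (simp add: mult.assoc)
  ultimately have "real (card (good K)) * (2 * real n - 2) + 2/3 * L
     + 2/3 * real n * (\<Sum>S\<in>dense. real (card (tri_in S)))
     + real n * (real (card (light K)) + sum_kap) / 400
   \<le> real n ^ 3 / 2 + 2 * KL + 400 * real (card dense)"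
    using main sum_sparse[OF assms] sum_dense KL by linarith
  then show ?thesis unfolding L_def KL_def by (simp add: mult_ac)
qed

end

section \<open>Almost all triangles are good\<close>

context fan_free
begin

text \<open>A triangle that is neither dense nor light has a heavy edge; putting the opposite vertex
  first makes it good or bad.\<close>

lemma card_T_cover:
  "card T \<le> card dense_tri + card (light K) + 3 * (card (good K) + card (bad K))"
proof -
  let ?Q = "good K \<union> bad K"
  have heavyQ: "(x, y, z) \<in> ?Q" if "(x, y, z) \<in> T - dense_tri" "K \<le> cod y z" for x y z
    using that unfolding good_def bad_def heavy_def T_def by auto
  have 1: "card (T - dense_tri - light K) \<le> 3 * card ?Q"
  proof (rule card_T_perm_cover)
    show "finite ?Q" by simp
    fix x y z assume t: "(x, y, z) \<in> T - dense_tri - light K"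
    then consider "K \<le> cod y z" | "K \<le> cod x z" | "K \<le> cod x y"
      unfolding light_def by (cases "cod x y < K"; cases "cod x z < K"; cases "cod y z < K") auto
    then show "(x, y, z) \<in> ?Q \<or> (y, x, z) \<in> ?Q \<or> (z, x, y) \<in> ?Q"
    proof cases
      case 1
      then show ?thesis using t heavyQ by blast
    next
      case 2
      then show ?thesis
        using t heavyQ[of y x z] T_perm(2)[of x y z] dense_tri_perm(2)[of x y z] by blast
    next
      case 3
      then show ?thesis
        using t heavyQ[of z x y] T_perm(1)[of x y z] dense_tri_perm(1)[of x y z] T_perm(2)[of x z y]
          dense_tri_perm(2)[of x z y] by blast
    qed
  qed
  have "card T \<le> card (dense_tri \<union> light K \<union> (T - dense_tri - light K))"
    by (intro card_mono) auto
  also have "\<dots> \<le> card dense_tri + card (light K) + card (T - dense_tri - light K)"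
    by (intro order_trans[OF card_Un_le] add_mono order_refl)
  also note 1
  also have "card ?Q \<le> card (good K) + card (bad K)" by (rule card_Un_le)
  finally show ?thesis by simp
qed

lemma fin_tri_in [simp]: "finite (tri_in S)"
  by (rule finite_subset[OF _ fin_T]) (auto simp: tri_in_def)

lemma card_dense_tri: "real (card dense_tri) \<le> (\<Sum>S\<in>dense. real (card (tri_in S)))"
proof -
  have "card dense_tri \<le> card (\<Union>S\<in>dense. tri_in S)"
    by (rule card_mono) (simp, auto simp: dense_tri_def tri_in_def)
  also have "\<dots> \<le> (\<Sum>S\<in>dense. card (tri_in S))" by (rule card_UN_le) simp
  finally show ?thesis by (metis of_nat_le_iff of_nat_sum)
qed

lemma sum_kap_le: "sum_kap \<le> real n ^ 2"
proof -
  have "kap x \<le> n" for x using link_bound[of x 0] d_le[of x] by linarith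
  then have "sum_kap \<le> (\<Sum>x\<in>V. real n)" unfolding sum_kap_def by (intro sum_mono) simp
  then show ?thesis by (simp add: power2_eq_square)
qed

text \<open>With K = 10^15 the bad triples number at most 16 n^2 / K. The error terms of order K n^2
  are below n^3 / K up to a constant because n is at least K^2, the origin of 10^30.\<close>

lemma many_good:
  assumes "real n \<ge> 10 ^ 30" "real (card T) \<ge> 3/4 * real n ^ 2"
  shows "(1/4 - 1/10^10) * real n ^ 2 \<le> real (card (good (10 ^ 15)))"
proof -
  define K :: nat where "K = 10 ^ 15"
  have K: "real K = 10 ^ 15" "2 \<le> K" "4 \<le> K" by (simp_all add: K_def)
  define m where "m = real n"
  define h where "h = real (card (good K))"
  define l where "l = real (card (light K))"
  define D where "D = real (card dense)"
  define P where "P = (\<Sum>S\<in>dense. real (card (tri_in S)))"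
  define b where "b = real (card (bad K))"
  define t where "t = real (card T)"
  have m: "10 ^ 30 \<le> m" using assms by (simp add: m_def)
  have nn: "0 \<le> h" "0 \<le> l" "0 \<le> D" "0 \<le> P" "0 \<le> b"
    by (auto simp: h_def l_def D_def P_def b_def intro: sum_nonneg)
  have t1: "t \<le> P + l + 3 * (h + b)"
    using of_nat_mono[OF card_T_cover[of K], where 'a = real] card_dense_tri
    unfolding t_def P_def l_def h_def b_def by simp
  have t2: "3/4 * m\<^sup>2 \<le> t" using assms by (simp add: m_def t_def)
  have t3: "t \<le> 4 * m\<^sup>2" using card_T_le by (simp add: m_def t_def)
  have hl: "h \<le> t" "l \<le> t" unfolding h_def l_def t_def using sub_T by (simp_all add: card_mono)
  have Dk: "16 * D \<le> sum_kap" "sum_kap \<le> m\<^sup>2"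
    using card_dense_le sum_kap_le by (simp_all add: D_def m_def)
  have P60: "P \<le> 60 * D"
  proof -
    have "P \<le> (\<Sum>S\<in>dense. 60)" unfolding P_def
    proof (rule sum_mono)
      fix S assume "S \<in> dense"
      then show "real (card (tri_in S)) \<le> 60" using card_tri_in_dense(3)[of S] by linarith
    qed
    then show ?thesis by (simp add: D_def)
  qed
  have b1: "b \<le> 16 / 10 ^ 15 * m\<^sup>2"
  proof -
    have "real K * b \<le> 4 * real (K * card (heavy K))"
      using mult_left_mono[of b "4 * real (card (heavy K))" "real K"] card_bad[OF K(3)]
      by (simp add: b_def)
    also have "\<dots> \<le> 4 * t" 
      using of_nat_mono[OF card_heavy[of K], where 'a = real] unfolding t_def by linarith
    finally have "real K * b \<le> 16 * m\<^sup>2" using t3 by linarith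
    then show ?thesis unfolding K by simp
  qed
  have main: "h * (2 * m - 2) + 2/3 * m * l + 2/3 * m * P + m * (l + sum_kap) / 400
     \<le> m ^ 3 / 2 + 2 * real K * l + 400 * D"
    using main_ineq[OF K(2)] unfolding h_def m_def l_def D_def P_def .
  \<comment> \<open>The lower bound on t, split by \<open>t1\<close>, has the same leading terms as
    the left side of \<open>main\<close>. They cancel and leave the surplus bounded by error
    terms.\<close>
  have "m ^ 3 / 2 \<le> 2/3 * m * t"
    using mult_left_mono[OF t2, of "2/3 * m"] m by (simp add: power3_eq_cube power2_eq_square)
  also have "\<dots> \<le> 2/3 * m * (P + l + 3 * (h + b))"
    using t1 m by (intro mult_left_mono) auto
  also have "\<dots> = 2/3 * m * P + 2/3 * m * l + 2 * (m * h) + 2 * (m * b)"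
    by (simp add: algebra_simps)
  finally have "m * (l + sum_kap) / 400 \<le> 2 * (m * b) + 2 * h + 2 * real K * l + 400 * D"
    using main by (simp add: right_diff_distrib mult.commute[of h])
  also have "\<dots> \<le> m * (50 / 10 ^ 15 * m\<^sup>2)"
  proof -
    define M where "M = m * m\<^sup>2"
    have "m * b \<le> 16 / 10 ^ 15 * M"
      using mult_left_mono[OF b1, of m] m by (simp add: M_def mult_ac)
    moreover have "2 * h + 2 * real K * l + 400 * D \<le> 9 * 10 ^ 15 * m\<^sup>2"
    proof -
      have "2 * real K * l = 2000000000000000 * l" "9 * 10 ^ 15 * m\<^sup>2 = 9000000000000000 * m\<^sup>2"
        by (simp_all add: K)
      then show ?thesis using hl t3 Dk zero_le_power2[of m] by linarith
    qed
    moreover have "10 ^ 30 * m\<^sup>2 \<le> M" unfolding M_def using m by (intro mult_right_mono) auto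
    moreover have "0 \<le> M" unfolding M_def using m by simp
    ultimately have "2 * (m * b) + 2 * h + 2 * real K * l + 400 * D \<le> 50 / 10 ^ 15 * M"
      by (simp add: field_simps)
    then show ?thesis by (simp add: M_def mult_ac)
  qed
  finally have "m * (l + sum_kap) \<le> m * (20000 / 10 ^ 15 * m\<^sup>2)" by simp
  then have "l + sum_kap \<le> 20000 / 10 ^ 15 * m\<^sup>2"
    using m by (subst (asm) mult_le_cancel_left_pos) auto
  moreover have "3 * h \<ge> 3/4 * m\<^sup>2 - 60 * D - l - 3 * b" using t1 t2 P60 by (simp add: field_simps)
  moreover have "0 \<le> m\<^sup>2" by simp
  ultimately have "(1/4 - 1/10^10) * m\<^sup>2 \<le> h"
    using b1 Dk nn by (simp add: field_simps)
  then show ?thesis by (simp add: h_def m_def K_def)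
qed

end

section \<open>Stability\<close>

text \<open>The neighbourhoods of the ends of an edge are disjoint and independent; an edge of large
  degree sum makes them nearly cover V, so almost all edges run between them. Few pairs are then
  missing, and discarding the vertices that miss too many costs at most 5/10^6 of V on each
  side.\<close>

lemma triangle_free_stability:
  fixes F :: "'a \<Rightarrow> 'a \<Rightarrow> bool" and V :: "'a set"
  assumes fin: "finite V" and FV: "\<And>x y. F x y \<Longrightarrow> x \<in> V" and sym: "\<And>x y. F x y \<Longrightarrow> F y x"
    and tf: "\<And>x y z. F x y \<Longrightarrow> F y z \<Longrightarrow> F x z \<Longrightarrow> False"
    and many: "(1/2 - 2/10^10) * real (card V) ^ 2 \<le> real (card {(x, y). F x y})"
    and pos: "0 < card V"
  obtains A B where "A \<subseteq> V" "B \<subseteq> V" "A \<inter> B = {}"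
    "(1/2 - 1/10^4) * real (card V) \<le> real (card A)" "(1/2 - 1/10^4) * real (card V) \<le> real (card B)"
    "\<And>a. a \<in> A \<Longrightarrow> real (card {b\<in>B. \<not> F a b}) \<le> 1/10^4 * real (card V)"
    "\<And>b. b \<in> B \<Longrightarrow> real (card {a\<in>A. \<not> F b a}) \<le> 1/10^4 * real (card V)"
proof -
  define f where "f x = real (card {y. F x y})" for x
  define m where "m = real (card V)"
  define e where "e = real (card {(x, y). F x y})"
  have FV2: "F x y \<Longrightarrow> y \<in> V" for x y using FV sym by blast
  have m0: "0 < m" using pos by (simp add: m_def)
  have e1: "(1/2 - 2/10^10) * m\<^sup>2 \<le> e" using many by (simp add: e_def m_def)
  have finF: "finite {y. F x y}" for x by (rule finite_subset[OF _ fin]) (use FV2 in blast)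
  have S: "{(x, y). F x y} = Sigma V (\<lambda>x. {y. F x y})" using FV by auto
  have e0: "0 < e"
  proof -
    have "0 < (1/2 - 2/10^10) * m\<^sup>2" using m0 by simp
    then show ?thesis using e1 by linarith
  qed
  have sum_f: "(\<Sum>x\<in>V. f x) = e"
    unfolding e_def S f_def using fin finF by simp
  have sum_1: "(\<Sum>(x, y)\<in>{(x, y). F x y}. f x) = (\<Sum>x\<in>V. (f x)\<^sup>2)"
  proof -
    have "(\<Sum>(x, y)\<in>{(x, y). F x y}. f x) = (\<Sum>x\<in>V. \<Sum>y\<in>{y. F x y}. f x)"
      unfolding S using fin finF by (subst sum.Sigma) auto
    then show ?thesis by (simp add: f_def power2_eq_square)
  qed
  have sum_2: "(\<Sum>(x, y)\<in>{(x, y). F x y}. f y) = (\<Sum>(x, y)\<in>{(x, y). F x y}. f x)"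
    by (rule sum.reindex_bij_witness[of _ "\<lambda>(x, y). (y, x)" "\<lambda>(x, y). (y, x)"]) (use sym in auto)
  have sq: "e\<^sup>2 / m \<le> (\<Sum>x\<in>V. (f x)\<^sup>2)"
  proof -
    have "0 \<le> (\<Sum>x\<in>V. (f x - e/m)\<^sup>2)" by (intro sum_nonneg) simp
    also have "\<dots> = (\<Sum>x\<in>V. (f x)\<^sup>2 - 2 * (e/m) * f x + (e/m)\<^sup>2)"
      by (intro sum.cong refl) (simp add: power2_diff)
    also have "\<dots> = (\<Sum>x\<in>V. (f x)\<^sup>2) - 2 * (e/m) * (\<Sum>x\<in>V. f x) + m * (e/m)\<^sup>2"
      unfolding sum.distrib sum_subtractf sum_distrib_left[symmetric] by (simp add: m_def)
    also have "(\<Sum>x\<in>V. f x) = e" by (rule sum_f)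
    also have "(\<Sum>x\<in>V. (f x)\<^sup>2) - 2 * (e/m) * e + m * (e/m)\<^sup>2 = (\<Sum>x\<in>V. (f x)\<^sup>2) - e\<^sup>2 / m"
      using m0 by (simp add: field_simps power2_eq_square)
    finally show ?thesis by simp
  qed
  \<comment> \<open>The average of f x + f y over ordered edges is 2/e times the sum of the squared
    degrees, which is at least 2 e / m by Cauchy-Schwarz (\<open>sq\<close>).\<close>
  have "\<exists>x y. F x y \<and> 2 * e / m \<le> f x + f y"
  proof (rule ccontr)
    assume "\<not> ?thesis"
    then have lt: "F x y \<Longrightarrow> f x + f y < 2 * e / m" for x y by force
    have "{(x, y). F x y} \<noteq> {}" using e0 unfolding e_def by (metis card.empty less_irrefl of_nat_0)
    moreover have "finite {(x, y). F x y}" unfolding S using fin finF by auto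
    ultimately have "(\<Sum>(x, y)\<in>{(x, y). F x y}. f x + f y) < (\<Sum>(x, y)\<in>{(x, y). F x y}. 2 * e / m)"
      by (intro sum_strict_mono) (use lt in auto)
    also have "\<dots> = e * (2 * e / m)" by (simp add: e_def case_prod_unfold)
    finally have "(\<Sum>(x, y)\<in>{(x, y). F x y}. f x) + (\<Sum>(x, y)\<in>{(x, y). F x y}. f y) < e * (2 * e / m)"
      by (simp only: case_prod_unfold sum.distrib)
    moreover have "e * (2 * e / m) = 2 * (e\<^sup>2 / m)" by (simp add: power2_eq_square)
    ultimately show False using sq unfolding sum_2 sum_1 by linarith
  qed
  then obtain x y where xy: "F x y" "2 * e / m \<le> f x + f y" by blast
  define A where "A = {u. F y u}"
  define B where "B = {u. F x u}"
  define a where "a = real (card A)"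
  define b where "b = real (card B)"
  have sub: "A \<subseteq> V" "B \<subseteq> V" unfolding A_def B_def using FV2 by auto
  then have finAB: "finite A" "finite B" using fin finite_subset by auto
  have disj: "A \<inter> B = {}" unfolding A_def B_def using tf[OF xy(1)] by blast
  have ab: "(1 - 4/10^10) * m \<le> a + b"
  proof -
    have "2 * ((1/2 - 2/10^10) * m\<^sup>2) / m \<le> 2 * e / m"
      using e1 m0 by (intro divide_right_mono mult_left_mono) auto
    moreover have "2 * ((1/2 - 2/10^10) * m\<^sup>2) / m = (1 - 4/10^10) * m"
      using m0 by (simp add: field_simps power2_eq_square)
    ultimately show ?thesis using xy(2) by (simp add: a_def b_def A_def B_def f_def)
  qed
  define R where "R = V - (A \<union> B)"
  have cR: "real (card R) = m - a - b" and ab2: "a + b \<le> m"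
  proof -
    have "card (A \<union> B) = card A + card B" using finAB disj by (simp add: card_Un_disjoint)
    moreover have "card R = card V - card (A \<union> B)" "card (A \<union> B) \<le> card V"
      unfolding R_def using sub finAB fin by (auto intro!: card_Diff_subset card_mono)
    ultimately show "real (card R) = m - a - b" "a + b \<le> m"
      unfolding m_def a_def b_def by (simp_all add: of_nat_diff)
  qed
  define X where "X = {(u, v). u \<in> A \<and> v \<in> B \<and> F u v}"
  define M where "M = {(u, v). u \<in> A \<and> v \<in> B \<and> \<not> F u v}"
  have finX: "finite X" "finite M"
    using finAB by (auto simp: X_def M_def intro: finite_subset[of _ "A \<times> B"])
  have noA: "\<not> F u v" if "u \<in> A" "v \<in> A" for u v using tf[of y u v] that unfolding A_def by blast
  have noB: "\<not> F u v" if "u \<in> B" "v \<in> B" for u v using tf[of x u v] that unfolding B_def by blast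
  have "{(x, y). F x y} \<subseteq> X \<union> prod.swap ` X \<union> (R \<times> V \<union> V \<times> R)"
  proof
    fix p assume "p \<in> {(x, y). F x y}"
    then obtain u v where p: "p = (u, v)" and uv: "F u v" by auto
    show "p \<in> X \<union> prod.swap ` X \<union> (R \<times> V \<union> V \<times> R)"
    proof (cases "u \<in> R \<or> v \<in> R")
      case True
      then show ?thesis using p FV[OF uv] FV2[OF uv] by auto
    next
      case False
      then have "u \<in> A \<union> B" "v \<in> A \<union> B" using FV[OF uv] FV2[OF uv] unfolding R_def by blast+
      then have "(u, v) \<in> X \<or> (v, u) \<in> X"
        using noA noB uv sym[OF uv] unfolding X_def by blast
      then show ?thesis unfolding p by (auto intro: rev_image_eqI)
    qed
  qed
  then have "card {(x, y). F x y} \<le> card (X \<union> prod.swap ` X \<union> (R \<times> V \<union> V \<times> R))"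
    using finX fin by (intro card_mono) (auto simp: R_def)
  also have "\<dots> \<le> card X + card (prod.swap ` X) + (card (R \<times> V) + card (V \<times> R))"
    by (intro order_trans[OF card_Un_le] add_mono order_refl)
  also have "\<dots> \<le> 2 * card X + 2 * card R * card V"
    using card_image_le[OF finX(1), of prod.swap] by (simp add: card_cartesian_product)
  finally have "e \<le> real (2 * card X + 2 * card R * card V)"
    unfolding e_def using of_nat_le_iff by blast
  then have "e \<le> 2 * real (card X) + 2 * (m - a - b) * m" by (simp add: cR m_def)
  moreover have "2 * (m - a - b) * m \<le> 2 * (4/10^10 * m) * m"
    using ab m0 by (intro mult_right_mono mult_left_mono) (auto simp: algebra_simps)
  ultimately have cX: "(1/4 - 5/10^10) * m\<^sup>2 \<le> real (card X)"
    using e1 by (simp add: power2_eq_square field_simps)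
  have XM: "real (card X) + real (card M) = a * b"
  proof -
    have "card X + card M = card (X \<union> M)"
      by (rule card_Un_disjoint[symmetric]) (use finX in \<open>auto simp: X_def M_def\<close>)
    also have "X \<union> M = A \<times> B" by (auto simp: X_def M_def)
    finally show ?thesis by (simp add: card_cartesian_product a_def b_def flip: of_nat_add of_nat_mult)
  qed
  have abm: "(a + b)\<^sup>2 \<le> m\<^sup>2" using ab2 by (intro power_mono) (auto simp: a_def b_def)
  have amgm: "4 * (a * b) = (a + b)\<^sup>2 - (a - b)\<^sup>2" by (simp add: power2_eq_square algebra_simps)
  have q: "a * b \<le> m\<^sup>2 / 4" "(1/4 - 5/10^10) * m\<^sup>2 \<le> a * b"
    using cX XM abm amgm zero_le_power2[of "a - b"] by linarith+
  have cM: "real (card M) \<le> 5/10^10 * m\<^sup>2"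
    using cX XM q by (simp add: left_diff_distrib)
  \<comment> \<open>Near equality in 4 a b <= m^2 bounds the imbalance: 20/10^10 is at most
    (5/10^5)^2, the square root that costs half of the exponent.\<close>
  have "(a - b)\<^sup>2 \<le> m\<^sup>2 - 4 * ((1/4 - 5/10^10) * m\<^sup>2)" using q(2) abm amgm by linarith
  also have "\<dots> \<le> (5/10^5 * m)\<^sup>2" by (simp add: field_simps power_mult_distrib)
  finally have "(a - b)\<^sup>2 \<le> (5/10^5 * m)\<^sup>2" .
  then have "\<bar>a - b\<bar> \<le> \<bar>5/10^5 * m\<bar>" by (simp only: abs_le_square_iff)
  moreover have "\<bar>5/10^5 * m\<bar> = m / 20000" using m0 by simp
  ultimately have "a - b \<le> m / 20000" "b - a \<le> m / 20000" by linarith+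
  then have size: "(1/2 - 5/10^5) * m \<le> a" "(1/2 - 5/10^5) * m \<le> b"
    using ab m0 by (simp_all add: field_simps)
  define A' where "A' = {u\<in>A. real (card {v\<in>B. \<not> F u v}) \<le> 1/10^4 * m}"
  define B' where "B' = {v\<in>B. real (card {u\<in>A. \<not> F v u}) \<le> 1/10^4 * m}"
  have few: "real (card {u\<in>C. \<not> g u \<le> 1/10^4 * m}) \<le> 5/10^6 * m"
    if "finite C" "(\<Sum>u\<in>C. g u) = real (card M)" "\<And>u. 0 \<le> g u" for C :: "'a set" and g :: "'a \<Rightarrow> real"
  proof -
    have "real (card {u\<in>C. \<not> g u \<le> 1/10^4 * m}) * (1/10^4 * m) = (\<Sum>u\<in>{u\<in>C. \<not> g u \<le> 1/10^4 * m}. 1/10^4 * m)"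
      by simp
    also have "\<dots> \<le> (\<Sum>u\<in>{u\<in>C. \<not> g u \<le> 1/10^4 * m}. g u)" by (intro sum_mono) auto
    also have "\<dots> \<le> (\<Sum>u\<in>C. g u)" using that by (intro sum_mono2) auto
    also have "\<dots> \<le> (5/10^6 * m) * (1/10^4 * m)"
      using cM that(2) by (simp add: power2_eq_square)
    finally show ?thesis using m0 by (subst (asm) mult_le_cancel_right_pos) auto
  qed
  have M1: "(\<Sum>u\<in>A. real (card {v\<in>B. \<not> F u v})) = real (card M)"
  proof -
    have "M = Sigma A (\<lambda>u. {v\<in>B. \<not> F u v})" by (auto simp: M_def)
    then show ?thesis using finAB by simp
  qed
  have M2: "(\<Sum>v\<in>B. real (card {u\<in>A. \<not> F v u})) = real (card M)"
  proof -
    have "prod.swap ` M = Sigma B (\<lambda>v. {u\<in>A. \<not> F v u})"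
      using sym by (auto simp: M_def image_iff)
    moreover have "card (prod.swap ` M) = card M" by (rule card_image) simp
    ultimately have "(\<Sum>v\<in>B. card {u\<in>A. \<not> F v u}) = card M" using finAB by simp
    then show ?thesis unfolding of_nat_sum[symmetric] by simp
  qed
  have split: "a = real (card A') + real (card {u\<in>A. \<not> real (card {v\<in>B. \<not> F u v}) \<le> 1/10^4 * m})"
    "b = real (card B') + real (card {u\<in>B. \<not> real (card {v\<in>A. \<not> F u v}) \<le> 1/10^4 * m})"
    unfolding a_def b_def A'_def B'_def of_nat_add[symmetric] of_nat_eq_iff
    by (subst card_Un_disjoint[symmetric]; use finAB in \<open>auto intro!: arg_cong[of _ _ card]\<close>)+
  have sz: "(1/2 - 1/10^4) * m \<le> real (card A')" "(1/2 - 1/10^4) * m \<le> real (card B')"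
    using split few[OF finAB(1) M1] few[OF finAB(2) M2] size m0 by (simp_all add: field_simps)
  show ?thesis
  proof (rule that[of A' B'])
    show "A' \<subseteq> V" "B' \<subseteq> V" "A' \<inter> B' = {}" using sub disj by (auto simp: A'_def B'_def)
    show "real (card {b\<in>B'. \<not> F a b}) \<le> 1/10^4 * real (card V)" if "a \<in> A'" for a
    proof -
      have "card {b\<in>B'. \<not> F a b} \<le> card {b\<in>B. \<not> F a b}"
        using finAB by (intro card_mono) (auto simp: B'_def)
      then show ?thesis using that unfolding A'_def m_def by auto
    qed
    show "real (card {a\<in>A'. \<not> F b a}) \<le> 1/10^4 * real (card V)" if "b \<in> B'" for b
    proof -
      have "card {a\<in>A'. \<not> F b a} \<le> card {a\<in>A. \<not> F b a}"
        using finAB by (intro card_mono) (auto simp: A'_def)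
      then show ?thesis using that unfolding B'_def m_def by auto
    qed
  qed (use sz in \<open>simp_all add: m_def\<close>)
qed

section \<open>The graph of page edges\<close>

context fan_free
begin

definition page_edge :: "nat \<Rightarrow> 'a \<Rightarrow> 'a \<Rightarrow> bool" where
  "page_edge K x y \<longleftrightarrow> (\<exists>z. (x, y, z) \<in> good K \<or> (y, x, z) \<in> good K)"

lemma page_edge:
  assumes "page_edge K x y"
  shows "E x y" "cod x y = 1" "page_edge K y x"
  using assms cod_comm[of x y] symE unfolding page_edge_def good_def T_def by auto

text \<open>The codegree 1 identifies z with the third vertex of the good triangle. Since page edges
  have codegree 1, they cannot form a triangle for K at least 2.\<close>

lemma page_edge_third:
  assumes "page_edge K x y" "E x z" "E y z"
  shows "K \<le> cod y z \<or> K \<le> cod x z"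
proof -
  obtain w where w: "(x, y, w) \<in> good K \<or> (y, x, w) \<in> good K" using assms by (auto simp: page_edge_def)
  have "card (N x \<inter> N y) = 1" using page_edge(2)[OF assms(1)] by (simp add: cod_def)
  moreover have "w \<in> N x \<inter> N y" "z \<in> N x \<inter> N y"
    using w assms symE unfolding good_def T_def by auto
  ultimately have "w = z" by (metis card_1_singletonE singletonD)
  then show ?thesis using w unfolding good_def heavy_def by auto
qed

text \<open>The third vertex is determined by codegree 1. The two orientations do not overlap:
  otherwise x and y would both be pages over the same third vertex, and an edge would be heavy with
  codegree 1.\<close>

lemma card_page_edge:
  assumes "2 \<le> K"
  shows "2 * card (good K) \<le> card {(x, y). page_edge K x y}"
proof -
  let ?f = "\<lambda>(x, y, z). (x, y)" and ?g = "\<lambda>(x, y, z). (y, x)"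
  have uniq: "z = w" if "(x, y, z) \<in> good K" "(x, y, w) \<in> good K" for x y z w
  proof -
    have "card (N x \<inter> N y) = 1" "z \<in> N x \<inter> N y" "w \<in> N x \<inter> N y"
      using that unfolding good_def T_def cod_def by auto
    then show ?thesis by (metis card_1_singletonE singletonD)
  qed
  have inj: "inj_on ?f (good K)" "inj_on ?g (good K)" using uniq by (auto simp: inj_on_def)
  have "?f ` good K \<inter> ?g ` good K = {}"
  proof (rule ccontr)
    assume "\<not> ?thesis"
    then obtain x y z w where xy: "(x, y, z) \<in> good K" "(y, x, w) \<in> good K" by auto
    then have "page_edge K y x" unfolding page_edge_def by blast
    have "card (N x \<inter> N y) = 1" "z \<in> N x \<inter> N y" "w \<in> N x \<inter> N y"
      using xy unfolding good_def T_def cod_def by (auto simp: E_comm)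
    then have "w = z" by (metis card_1_singletonE singletonD)
    then show False using xy assms unfolding good_def heavy_def by auto
  qed
  then have "card (?f ` good K \<union> ?g ` good K) = 2 * card (good K)"
    using card_image[OF inj(1)] card_image[OF inj(2)] by (simp add: card_Un_disjoint)
  moreover have "card (?f ` good K \<union> ?g ` good K) \<le> card {(x, y). page_edge K x y}"
  proof (rule card_mono)
    show "finite {(x, y). page_edge K x y}"
      by (rule finite_subset[of _ "V \<times> V"])
        (auto simp: finV dest!: page_edge(1) intro: EV EV[OF symE])
    show "?f ` good K \<union> ?g ` good K \<subseteq> {(x, y). page_edge K x y}"
      by (auto simp: page_edge_def)
  qed
  ultimately show ?thesis by simp
qed

end

section \<open>Vertex sets that induce a matching\<close>

context fan_free
begin

text \<open>Neighbourhoods contain no \<open>K\<^bsub>2,3\<^esub>\<close>, so three vertices as below cannot miss little of a large set.\<close>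

lemma card_le_missing:
  assumes "E x u" "E x w" "u \<noteq> w" "finite S"
  shows "card S \<le> 2 + card (S - N x) + card (S - N u) + card (S - N w)"
proof -
  have "card S \<le> card ((N x \<inter> N u \<inter> N w) \<union> (S - N x) \<union> (S - N u) \<union> (S - N w))"
    using assms(4) by (intro card_mono) auto
  also have "\<dots> \<le> card (N x \<inter> N u \<inter> N w) + card (S - N x) + card (S - N u) + card (S - N w)"
    by (intro order_trans[OF card_Un_le] add_mono order_refl)
  finally show ?thesis using triple_codegree_le_2[OF assms(1-3)] by linarith
qed

text \<open>The graph induced on \<open>Q\<close> has maximum degree at most one: a matching and
  isolated vertices.\<close>

definition uniq :: "'a set \<Rightarrow> bool" where
  "uniq Q \<longleftrightarrow> (\<forall>u\<in>Q. \<forall>v\<in>Q. \<forall>w\<in>Q. E u v \<longrightarrow> E u w \<longrightarrow> v = w)"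

definition matched :: "'a set \<Rightarrow> 'a set" where "matched Q = {u\<in>Q. \<exists>v\<in>Q. E u v}"

definition mate :: "'a set \<Rightarrow> 'a \<Rightarrow> 'a" where "mate Q u = (SOME v. v \<in> Q \<and> E u v)"

lemma mate:
  assumes "uniq Q" "u \<in> matched Q"
  shows "mate Q u \<in> matched Q" "E u (mate Q u)" "mate Q (mate Q u) = u"
    "\<And>v. v \<in> Q \<Longrightarrow> E u v \<Longrightarrow> v = mate Q u"
proof -
  have 1: "mate Q u \<in> Q \<and> E u (mate Q u)"
    unfolding mate_def by (rule someI_ex) (use assms(2) in \<open>auto simp: matched_def\<close>)
  have u: "u \<in> Q" using assms(2) by (simp add: matched_def)
  then have 2: "mate Q u \<in> matched Q" using 1 symE unfolding matched_def by blast
  show "mate Q u \<in> matched Q" "E u (mate Q u)" using 1 2 by auto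
  have "mate Q (mate Q u) \<in> Q \<and> E (mate Q u) (mate Q (mate Q u))"
    unfolding mate_def[of Q "mate Q u"] by (rule someI_ex) (use 2 in \<open>auto simp: matched_def\<close>)
  then show "mate Q (mate Q u) = u" using assms(1) u 1 symE unfolding uniq_def by blast
  show "v = mate Q u" if "v \<in> Q" "E u v" for v
    using assms(1) u 1 that unfolding uniq_def by blast
qed

text \<open>By \<open>no_double_pendant\<close>, w cannot touch two different matching edges that
  lie inside the neighbourhood of x, so all such u belong to one matched pair.\<close>

lemma few_full_pairs:
  assumes Q: "uniq Q" "finite Q" and w: "E x w" "w \<notin> matched Q"
  shows "card {u\<in>matched Q. E x u \<and> E w u \<and> E x (mate Q u)} \<le> 2"
proof (rule ccontr)
  let ?S = "{u\<in>matched Q. E x u \<and> E w u \<and> E x (mate Q u)}"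
  assume "\<not> ?thesis"
  then have "3 \<le> card ?S" by simp
  then obtain a b c where abc: "a \<in> ?S" "b \<in> ?S" "c \<in> ?S" "distinct [a, b, c]" by (rule obtain_three)
  have key: "v = mate Q u" if u: "u \<in> ?S" and v: "v \<in> ?S" and "u \<noteq> v" for u v
  proof (rule ccontr)
    assume ne: "v \<noteq> mate Q u"
    have mu: "u \<in> matched Q" "v \<in> matched Q" using u v by auto
    note m = mate[OF Q(1) mu(1)] mate[OF Q(1) mu(2)]
    have "mate Q v \<noteq> u" using m ne by metis
    moreover have "mate Q v \<noteq> mate Q u" using m that(3) by metis
    moreover have "u \<noteq> mate Q u" "v \<noteq> mate Q v" using m irrE by metis+
    moreover have "w \<noteq> u" "w \<noteq> v" "w \<noteq> mate Q u" "w \<noteq> mate Q v" using mu m w(2) by metis+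
    ultimately have "distinct [u, mate Q u, v, mate Q v, w]" using that(3) ne by auto
    then show False using no_double_pendant[of x w u "mate Q u" v "mate Q v"] u v w(1) m by blast
  qed
  show False using key[OF abc(1,2)] key[OF abc(1,3)] abc(4) by auto
qed

text \<open>Adjacent x and w cannot both see most of the matched set: beyond one full pair, every
  neighbour u of w costs x either u or its mate.\<close>

lemma matched_missing:
  assumes Q: "uniq Q" "finite Q" and w: "E x w" "w \<notin> matched Q"
  shows "card (matched Q \<inter> N w) \<le> 2 + 2 * card (matched Q - N x)"
proof -
  let ?M = "matched Q"
  have fin: "finite ?M" using Q(2) by (auto simp: matched_def)
  let ?S = "{u\<in>?M. E x u \<and> E w u \<and> E x (mate Q u)}"
  have "?M \<inter> N w \<subseteq> ?S \<union> (?M - N x) \<union> mate Q ` (?M - N x)"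
  proof
    fix u assume u: "u \<in> ?M \<inter> N w"
    show "u \<in> ?S \<union> (?M - N x) \<union> mate Q ` (?M - N x)"
    proof (cases "E x u \<and> E x (mate Q u)")
      case False
      moreover have "u = mate Q (mate Q u)" "mate Q u \<in> ?M" using mate[OF Q(1)] u by auto
      ultimately show ?thesis using u by auto
    qed (use u in auto)
  qed
  then have "card (?M \<inter> N w) \<le> card (?S \<union> (?M - N x) \<union> mate Q ` (?M - N x))"
    using fin by (intro card_mono) auto
  also have "\<dots> \<le> card ?S + card (?M - N x) + card (mate Q ` (?M - N x))"
    by (intro order_trans[OF card_Un_le] add_mono order_refl)
  also have "card (mate Q ` (?M - N x)) \<le> card (?M - N x)" using fin by (intro card_image_le) auto
  finally show ?thesis using few_full_pairs[OF assms] by linarith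
qed

lemma card_pages_le:
  assumes Q: "uniq Q" "finite Q" "finite R"
  shows "card {(x, y, z). (x, y, z) \<in> T \<and> x \<in> R \<and> y \<in> Q \<and> z \<in> Q} \<le> card (matched Q) * card R"
proof -
  have "card {(x, y, z). (x, y, z) \<in> T \<and> x \<in> R \<and> y \<in> Q \<and> z \<in> Q} \<le> card (matched Q \<times> R)"
  proof (rule card_inj_on_le[of "\<lambda>(x, y, z). (y, x)"])
    have "z = z'" if "E y z" "E y z'" "y \<in> Q" "z \<in> Q" "z' \<in> Q" for y z z'
      using Q(1) that unfolding uniq_def by blast
    then show "inj_on (\<lambda>(x, y, z). (y, x)) {(x, y, z). (x, y, z) \<in> T \<and> x \<in> R \<and> y \<in> Q \<and> z \<in> Q}"
      by (auto simp: inj_on_def T_def)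
    show "(\<lambda>(x, y, z). (y, x)) ` {(x, y, z). (x, y, z) \<in> T \<and> x \<in> R \<and> y \<in> Q \<and> z \<in> Q} \<subseteq> matched Q \<times> R"
      by (auto simp: matched_def T_def)
    show "finite (matched Q \<times> R)" using Q by (auto simp: matched_def)
  qed
  then show ?thesis by (simp add: card_cartesian_product)
qed

lemma uniq_no_triangle:
  assumes "uniq Q" "(x, y, z) \<in> T" "x \<in> Q" "y \<in> Q" "z \<in> Q"
  shows False
proof -
  have "E x y" "E x z" "E y z" using assms(2) by (auto simp: T_def)
  then have "y = z" using assms unfolding uniq_def by blast
  then show False using \<open>E y z\<close> irrE by blast
qed

end

section \<open>Almost complete bipartite graphs with a matched part\<close>

text \<open>\<open>A\<close> will be the matched vertices of one part given by stability, so its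
  lower bound is weaker than that of \<open>B\<close>; the upper bound is complementary to
  \<open>sizeB\<close>.\<close>

locale matched_bipartite = fan_free +
  fixes A B :: "'a set"
  assumes AV: "A \<subseteq> V" and BV: "B \<subseteq> V" and disj: "A \<inter> B = {}"
    and big: "10 ^ 6 \<le> real n"
    and sizeA: "498/1000 * real n \<le> real (card A)" "real (card A) \<le> 5001/10^4 * real n"
    and sizeB: "4999/10^4 * real n \<le> real (card B)"
    and missA: "\<And>a. a \<in> A \<Longrightarrow> real (card (B - N a)) \<le> real n / 10^4"
    and missB: "\<And>b. b \<in> B \<Longrightarrow> real (card (A - N b)) \<le> real n / 10^4"
    and uniqA: "uniq A" and matchedA: "matched A = A"
begin

abbreviation m :: real where "m \<equiv> real n"

text \<open>Three sets that each miss at most a tenth of \<open>B\<close> still share most of it,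
  which contradicts \<open>card_le_missing\<close>; hence the threshold 9/10. Vertices of
  \<open>Af\<close> without a mate end up in \<open>X\<close>.\<close>

definition Af :: "'a set" where "Af = {v\<in>V. 9/10 * real (card B) \<le> real (card (B \<inter> N v))}"
definition As :: "'a set" where "As = matched Af"
definition Bs :: "'a set" where "Bs = {v\<in>V. 9/10 * real (card A) \<le> real (card (A \<inter> N v))}"
definition X :: "'a set" where "X = V - As - Bs"

lemma finAB: "finite A" "finite B"
  using AV BV finV finite_subset by blast+

lemma sizeB': "real (card B) \<le> 502/1000 * m"
proof -
  have "card (A \<union> B) \<le> n" using AV BV finV by (intro card_mono) auto
  moreover have "card (A \<union> B) = card A + card B" using finAB disj by (simp add: card_Un_disjoint)
  ultimately have "real (card A) + real (card B) \<le> m" by (simp flip: of_nat_add)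
  then show ?thesis using sizeA by simp
qed

lemma card_split: "finite S \<Longrightarrow> real (card S) = real (card (S \<inter> N v)) + real (card (S - N v))"
  by (simp flip: of_nat_add add: card_Int_Diff)

lemma sub_V: "Af \<subseteq> V" "As \<subseteq> Af" "Bs \<subseteq> V" "X \<subseteq> V" "As \<subseteq> V"
  by (auto simp: Af_def As_def Bs_def X_def matched_def)

lemma fin_sets [simp]: "finite Af" "finite As" "finite Bs" "finite X"
  using sub_V finV finite_subset by blast+

lemma A_sub_Af: "A \<subseteq> Af"
proof
  fix a assume "a \<in> A"
  then have "9/10 * real (card B) \<le> real (card (B \<inter> N a))"
    using missA[of a] card_split[OF finAB(2), of a] sizeB big by (simp add: field_simps)
  then show "a \<in> Af" using \<open>a \<in> A\<close> AV by (auto simp: Af_def)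
qed

lemma B_sub_Bs: "B \<subseteq> Bs"
proof
  fix b assume "b \<in> B"
  then have "9/10 * real (card A) \<le> real (card (A \<inter> N b))"
    using missB[of b] card_split[OF finAB(1), of b] sizeA big by (simp add: field_simps)
  then show "b \<in> Bs" using \<open>b \<in> B\<close> BV by (auto simp: Bs_def)
qed

lemma Af_missing: "v \<in> Af \<Longrightarrow> real (card (B - N v)) \<le> 1/10 * real (card B)"
  using card_split[OF finAB(2), of v] by (auto simp: Af_def)

lemma Bs_missing: "v \<in> Bs \<Longrightarrow> real (card (A - N v)) \<le> 1/10 * real (card A)"
  using card_split[OF finAB(1), of v] by (auto simp: Bs_def)

lemma uniq_Af: "uniq Af"
  unfolding uniq_def
proof (intro ballI impI, rule ccontr)
  fix u v w assume h: "u \<in> Af" "v \<in> Af" "w \<in> Af" "E u v" "E u w" "v \<noteq> w"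
  have "card B \<le> 2 + card (B - N u) + card (B - N v) + card (B - N w)"
    by (rule card_le_missing) (use h finAB in auto)
  then have "real (card B) \<le> 2 + real (card (B - N u)) + real (card (B - N v)) + real (card (B - N w))"
    by linarith
  then show False
    using Af_missing[OF h(1)] Af_missing[OF h(2)] Af_missing[OF h(3)] sizeB big by simp
qed

lemma A_sub_As: "A \<subseteq> As"
  using A_sub_Af matchedA unfolding As_def matched_def by blast

lemma mate_As:
  assumes "a \<in> As"
  shows "mate Af a \<in> As" "E a (mate Af a)" "mate Af (mate Af a) = a"
    "\<And>v. v \<in> Af \<Longrightarrow> E a v \<Longrightarrow> v = mate Af a"
  using mate[OF uniq_Af assms[unfolded As_def]] unfolding As_def by auto

text \<open>v and two of its neighbours in \<open>A\<close> have at most two common neighbours,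
  while those two together miss little of \<open>B\<close>.\<close>

lemma two_nbrs:
  assumes "2 \<le> card (A \<inter> N v)"
  shows "real (card (B \<inter> N v)) \<le> 2 + 2 * (m / 10^4)"
proof -
  obtain S where "S \<subseteq> A \<inter> N v" "card S = 2" using assms by (meson obtain_subset_with_card_n)
  then obtain a b where ab: "a \<in> A" "E v a" "b \<in> A" "E v b" "a \<noteq> b" by (auto simp: card_2_iff)
  have "card (B \<inter> N v) \<le> 2 + card (B \<inter> N v - N v) + card (B \<inter> N v - N a) + card (B \<inter> N v - N b)"
    by (rule card_le_missing) (use ab finAB in auto)
  moreover have "card (B \<inter> N v - N a) \<le> card (B - N a)" "card (B \<inter> N v - N b) \<le> card (B - N b)"
    using finAB by (auto intro!: card_mono)
  moreover have "B \<inter> N v - N v = {}" by auto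
  ultimately have "card (B \<inter> N v) \<le> 2 + card (B - N a) + card (B - N b)" by simp
  then have "real (card (B \<inter> N v)) \<le> 2 + real (card (B - N a)) + real (card (B - N b))" by linarith
  then show ?thesis using missA[OF ab(1)] missA[OF ab(3)] by linarith
qed

lemma Af_Bs_disj: "Af \<inter> Bs = {}"
proof (rule ccontr)
  assume "Af \<inter> Bs \<noteq> {}"
  then obtain v where v: "v \<in> Af" "v \<in> Bs" by auto
  have "2 \<le> real (card (A \<inter> N v))" using v(2) sizeA big by (simp add: Bs_def)
  then have "real (card (B \<inter> N v)) \<le> 2 + 2 * (m / 10^4)" by (intro two_nbrs) linarith
  then show False using v(1) sizeB big by (simp add: Af_def)
qed

text \<open>By \<open>matched_missing\<close>, v meets the matching of \<open>A\<close> mostly where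
  b loses a vertex of a pair.\<close>

lemma nbr_of_Bs:
  assumes "b \<in> Bs" "E b v" "v \<notin> A"
  shows "real (card (A \<inter> N v)) \<le> 2 + 2/10 * real (card A)"
proof -
  have "card (A \<inter> N v) \<le> 2 + 2 * card (A - N b)"
    using matched_missing[OF uniqA finAB(1), of b v] assms by (simp add: matchedA)
  then have "real (card (A \<inter> N v)) \<le> 2 + 2 * real (card (A - N b))" by linarith
  then show ?thesis using Bs_missing[OF assms(1)] by linarith
qed

lemma Bs_indep:
  assumes "b \<in> Bs" "b' \<in> Bs"
  shows "\<not> E b b'"
proof
  assume "E b b'"
  moreover have "b' \<notin> A" using assms(2) A_sub_Af Af_Bs_disj by blast
  ultimately have "real (card (A \<inter> N b')) \<le> 2 + 2/10 * real (card A)" using nbr_of_Bs assms by blast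
  then show False using assms(2) sizeA big by (simp add: Bs_def)
qed

text \<open>a, its mate and v have at most two common neighbours, and the first two each miss at
  most a tenth of \<open>B\<close>.\<close>

lemma nbr_of_As:
  assumes "a \<in> As" "E a v" "v \<noteq> mate Af a"
  shows "real (card (B \<inter> N v)) \<le> 2 + 2/10 * real (card B)"
proof -
  have "card B \<le> 2 + card (B - N a) + card (B - N (mate Af a)) + card (B - N v)"
    by (rule card_le_missing) (use assms mate_As[OF assms(1)] finAB in auto)
  then have "real (card B) \<le> 2 + real (card (B - N a)) + real (card (B - N (mate Af a))) + real (card (B - N v))"
    by linarith
  moreover have "a \<in> Af" "mate Af a \<in> Af" using assms(1) mate_As(1) sub_V by blast+
  ultimately show ?thesis
    using Af_missing[of a] Af_missing[of "mate Af a"] card_split[OF finAB(2), of v] by linarith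
qed

definition \<rho> :: nat where "\<rho> = card (V - A - B)"

lemma rho: "real \<rho> \<le> 21/10^4 * m"
proof -
  have "V - A - B = V - (A \<union> B)" by auto
  then have "card (V - A - B) = n - card (A \<union> B)"
    using AV BV finAB by (simp add: card_Diff_subset)
  also have "card (A \<union> B) = card A + card B" using finAB disj by (simp add: card_Un_disjoint)
  finally have "real \<rho> \<le> m - real (card A) - real (card B) \<or> \<rho> = 0" unfolding \<rho>_def by linarith
  then show ?thesis using sizeA sizeB by (auto simp: field_simps)
qed

lemma rest_le:
  "card X \<le> \<rho>" "card (As - A) \<le> \<rho>" "card (Bs - B) \<le> \<rho>"
  unfolding \<rho>_def
  using A_sub_As B_sub_Bs Af_Bs_disj A_sub_Af sub_V finV by (auto intro!: card_mono simp: X_def)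

lemma As_nbrs: "card (As \<inter> N v) \<le> card (A \<inter> N v) + \<rho>"
proof -
  have "card (As \<inter> N v) \<le> card ((A \<inter> N v) \<union> (As - A))" using finAB by (intro card_mono) auto
  then show ?thesis using card_Un_le[of "A \<inter> N v" "As - A"] rest_le by linarith
qed

lemma Bs_nbrs: "card (Bs \<inter> N v) \<le> card (B \<inter> N v) + \<rho>"
proof -
  have "card (Bs \<inter> N v) \<le> card ((B \<inter> N v) \<union> (Bs - B))" using finAB by (intro card_mono) auto
  then show ?thesis using card_Un_le[of "B \<inter> N v" "Bs - B"] rest_le by linarith
qed

section \<open>Charging triangles to the leftover vertices\<close>

definition o1 :: "'a \<Rightarrow> nat" where "o1 x = card {(y, z). (x, y, z) \<in> T \<and> y \<notin> X \<and> z \<notin> X}"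
definition o2 :: "'a \<Rightarrow> nat" where "o2 x = card {(y, z). (x, y, z) \<in> T \<and> y \<in> X \<and> z \<notin> X}"

text \<open>A triangle with two vertices in \<open>X\<close> is charged to both of them; since no two vertices of
  \<open>X\<close> that are adjacent to almost all of \<open>B\<close> are adjacent, the two shares add up to at least one.\<close>

definition share :: "'a \<Rightarrow> real" where "share x = (if x \<in> Af then 475/1000 else 525/1000)"

lemma pairs_le:
  assumes "S \<subseteq> {(y, z). (x, y, z) \<in> T}"
  shows "finite S"
  by (rule finite_subset[of _ "N x \<times> N x"]) (use assms in \<open>auto simp: T_def\<close>)

lemma fin_pairs [simp]: "finite {(y, z). (x, y, z) \<in> T \<and> Q y z}"
  by (rule pairs_le[of _ x]) auto

lemma notX: "v \<in> V \<Longrightarrow> v \<notin> X \<Longrightarrow> v \<in> As \<or> v \<in> Bs"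
  by (auto simp: X_def)

lemma T_verts: "(x, y, z) \<in> T \<Longrightarrow> x \<in> V \<and> y \<in> V \<and> z \<in> V"
  using T_sub by blast

text \<open>Removing a vertex lowers 3/4 m^2 by about 3/2 m, so 146/100 m leaves a gain. Equal
  shares would fail: a vertex in \<open>Af\<close> may see all of \<open>B\<close> and be charged
  about 3/2 m. A vertex outside \<open>Af\<close> and \<open>Bs\<close> misses a tenth of either
  part and can bear the larger share 525/1000.\<close>

lemma charge_le:
  assumes x: "x \<in> X"
  shows "3 * real (o1 x) + 6 * share x * real (o2 x) + 4 * real (card X) \<le> 146/100 * m"
proof -
  have xn: "x \<notin> As" "x \<notin> Bs" "x \<in> V" "x \<notin> A" "x \<notin> B"
    using x A_sub_As B_sub_Bs by (auto simp: X_def)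
  have sA: "real (card (A \<inter> N x)) < 9/10 * real (card A)" using xn by (auto simp: Bs_def)
  have cX: "real (card X) \<le> 21/10^4 * m" using rho rest_le(1) by linarith
  have AsN: "real (card (As \<inter> N x)) \<le> real (card (A \<inter> N x)) + 21/10^4 * m"
    using rho As_nbrs[of x] by linarith
  have BsN: "real (card (Bs \<inter> N x)) \<le> real (card (B \<inter> N x)) + 21/10^4 * m"
    using rho Bs_nbrs[of x] by linarith
  consider (large_B) "2 + 2/10 * real (card B) < real (card (B \<inter> N x))"
    | (large_A) "real (card (B \<inter> N x)) \<le> 2 + 2/10 * real (card B)" "2 + 2/10 * real (card A) < real (card (A \<inter> N x))"
    | (small) "real (card (B \<inter> N x)) \<le> 2 + 2/10 * real (card B)" "real (card (A \<inter> N x)) \<le> 2 + 2/10 * real (card A)"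
    by linarith
  then show ?thesis
  proof cases
    case large_B
    \<comment> \<open>A neighbour in \<open>As\<close> would limit x to a fifth of \<open>B\<close>.
      As \<open>Bs\<close> is independent, x then lies in no triangle with the other two vertices
      outside \<open>X\<close>.\<close>
    have noP: "\<not> E x a" if "a \<in> As" for a
    proof
      assume "E x a"
      moreover have "x \<noteq> mate Af a" using mate_As(1)[OF that] xn by auto
      ultimately show False using nbr_of_As[of a x] that symE large_B by (meson not_less)
    qed
    have "o1 x = 0"
    proof -
      have "{(y, z). (x, y, z) \<in> T \<and> y \<notin> X \<and> z \<notin> X} = {}"
      proof -
        have False if "(x, y, z) \<in> T" "y \<notin> X" "z \<notin> X" for y z
        proof -
          have "E x y" "E x z" "E y z" using that by (auto simp: T_def)
          then have "y \<in> Bs" "z \<in> Bs" using notX T_verts[OF that(1)] that noP by blast+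
          then show False using Bs_indep \<open>E y z\<close> by blast
        qed
        then show ?thesis by blast
      qed
      then show ?thesis unfolding o1_def by (metis card.empty)
    qed
    moreover have "o2 x \<le> card (Bs \<inter> N x) + card X"
    proof -
      have "z \<in> Bs" if "(x, y, z) \<in> T" "z \<notin> X" for y z
        using notX T_verts[OF that(1)] that noP unfolding T_def by blast
      then have "{(y, z). (x, y, z) \<in> T \<and> y \<in> X \<and> z \<notin> X}
        \<subseteq> {(y, z). y \<in> X \<and> z \<in> Bs \<inter> N x \<and> E x y \<and> E x z \<and> E y z}"
        by (auto simp: T_def)
      then have "o2 x \<le> card {(y, z). y \<in> X \<and> z \<in> Bs \<inter> N x \<and> E x y \<and> E x z \<and> E y z}"
        unfolding o2_def by (intro card_mono pairs_le[of _ x]) (auto simp: T_def)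
      also have "\<dots> \<le> card (Bs \<inter> N x) + card X"
        by (rule card_bip_link_le) (auto simp: X_def finV)
      finally show ?thesis .
    qed
    then have o2: "real (o2 x) \<le> real (card (B \<inter> N x)) + 42/10^4 * m" using BsN cX by linarith
    show ?thesis
    proof (cases "x \<in> Af")
      case True
      have "card (B \<inter> N x) \<le> card B" using finAB by (intro card_mono) auto
      then have "real (o2 x) \<le> 5062/10^4 * m" using o2 sizeB' by simp
      then show ?thesis using \<open>o1 x = 0\<close> True cX by (simp add: share_def)
    next
      case False
      then have "real (card (B \<inter> N x)) < 9/10 * real (card B)" using xn by (auto simp: Af_def)
      then have "real (o2 x) \<le> 456/10^3 * m" using o2 sizeB' by simp
      then show ?thesis using \<open>o1 x = 0\<close> False cX by (simp add: share_def)
    qed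
  next
    case large_A
    have noI: "\<not> E x b" if "b \<in> Bs" for b
    proof
      assume "E x b"
      then have "E b x" by (rule symE)
      then show False using nbr_of_Bs[OF that _ xn(4)] large_A by (meson not_less)
    qed
    have xAf: "x \<notin> Af" using large_A(1) sizeB big by (simp add: Af_def)
    \<comment> \<open>Pairs seen entirely give the triangles in \<open>o1\<close>; each y in
      \<open>X\<close> meets at most two of their vertices. Pairs seen by halves enter
      \<open>o2\<close> only, through a bipartite link. So P and Z share one budget, the neighbours
      of x in \<open>As\<close>.\<close>
    define P where "P = {u\<in>As. E x u \<and> E x (mate Af u)}"
    define Z where "Z = {u\<in>As. E x u \<and> \<not> E x (mate Af u)}"
    have fPZ: "finite P" "finite Z" unfolding P_def Z_def by auto
    have "card P + card Z = card (As \<inter> N x)"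
    proof -
      have "P \<union> Z = As \<inter> N x" "P \<inter> Z = {}" unfolding P_def Z_def by auto
      then show ?thesis using fPZ by (metis card_Un_disjoint)
    qed
    then have PZ: "real (card P) + real (card Z) = real (card (As \<inter> N x))" by (simp flip: of_nat_add)
    have "o1 x \<le> card P"
      unfolding o1_def
    proof (rule card_inj_on_le[of fst])
      have zm: "y \<in> P \<and> z = mate Af y" if "(x, y, z) \<in> T" "y \<notin> X" "z \<notin> X" for y z
      proof -
        have e: "E x y" "E x z" "E y z" using that by (auto simp: T_def)
        then have yz: "y \<in> As" "z \<in> As" using notX T_verts[OF that(1)] that noI by blast+
        then have "z \<in> Af" using sub_V by blast
        then have "z = mate Af y" using mate_As(4)[OF yz(1)] e by blast
        then show ?thesis using yz e by (simp add: P_def)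
      qed
      show "inj_on fst {(y, z). (x, y, z) \<in> T \<and> y \<notin> X \<and> z \<notin> X}"
        using zm by (auto simp: inj_on_def)
      show "fst ` {(y, z). (x, y, z) \<in> T \<and> y \<notin> X \<and> z \<notin> X} \<subseteq> P" using zm by auto
    qed (rule fPZ)
    moreover have "o2 x \<le> 2 * card X + (card Z + card X)"
    proof -
      let ?S1 = "Sigma (X \<inter> N x) (\<lambda>y. {u\<in>As. E x u \<and> E y u \<and> E x (mate Af u)})"
      let ?S2 = "{(y, z). y \<in> X \<and> z \<in> Z \<and> E x y \<and> E x z \<and> E y z}"
      have "z \<in> As" if "(x, y, z) \<in> T" "z \<notin> X" for y z
        using notX T_verts[OF that(1)] that noI unfolding T_def by blast
      then have "{(y, z). (x, y, z) \<in> T \<and> y \<in> X \<and> z \<notin> X} \<subseteq> ?S1 \<union> ?S2"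
        by (auto simp: T_def Z_def)
      then have "o2 x \<le> card (?S1 \<union> ?S2)"
        unfolding o2_def by (intro card_mono pairs_le[of _ x]) (auto simp: T_def)
      also have "\<dots> \<le> card ?S1 + card ?S2" by (rule card_Un_le)
      also have "card ?S1 = (\<Sum>y\<in>X \<inter> N x. card {u\<in>As. E x u \<and> E y u \<and> E x (mate Af u)})"
        by simp
      also have "\<dots> \<le> (\<Sum>y\<in>X \<inter> N x. 2)"
      proof (rule sum_mono)
        fix y assume "y \<in> X \<inter> N x"
        then show "card {u\<in>As. E x u \<and> E y u \<and> E x (mate Af u)} \<le> 2"
          unfolding As_def by (intro few_full_pairs uniq_Af) (auto simp: X_def As_def)
      qed
      also have "\<dots> \<le> 2 * card X" by (simp add: card_mono)
      also have "card ?S2 \<le> card Z + card X"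
        by (rule card_bip_link_le) (use fPZ in \<open>auto simp: X_def Z_def finV\<close>)
      finally show ?thesis by simp
    qed
    ultimately have "real (o1 x) \<le> real (card P)" "real (o2 x) \<le> real (card Z) + 3 * real (card X)"
      by linarith+
    moreover have "real (card (As \<inter> N x)) \<le> 4522/10^4 * m" using AsN sA sizeA by simp
    ultimately show ?thesis using PZ cX xAf by (simp add: share_def)
  next
    case small
    have dx: "real (d x) \<le> 11/100 * m"
    proof -
      have "N x \<subseteq> (A \<inter> N x) \<union> (B \<inter> N x) \<union> (V - A - B)" using N_sub[of x] by auto
      then have "d x \<le> card ((A \<inter> N x) \<union> (B \<inter> N x) \<union> (V - A - B))"
        using finAB finV by (intro card_mono) auto
      also have "\<dots> \<le> card (A \<inter> N x) + card (B \<inter> N x) + \<rho>"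
        unfolding \<rho>_def by (intro order_trans[OF card_Un_le] add_mono order_refl)
      finally have d: "real (d x) \<le> real (card (A \<inter> N x)) + real (card (B \<inter> N x)) + 21/10^4 * m"
        using rho by linarith
      show ?thesis
      \<comment> \<open>With two neighbours in \<open>A\<close>, x sees almost nothing of
        \<open>B\<close>; so at most a fifth of one part counts, not of both.\<close>
      proof (cases "2 \<le> card (A \<inter> N x)")
        case True
        then show ?thesis using two_nbrs[OF True] d small(2) sizeA(2) big by (simp add: field_simps)
      next
        case False
        then have "real (card (A \<inter> N x)) \<le> 1" by simp
        then show ?thesis using d small(1) sizeB' big by (simp add: field_simps)
      qed
    qed
    have "o1 x + o2 x \<le> card {(y, z). (x, y, z) \<in> T}"
    proof -
      let ?S1 = "{(y, z). (x, y, z) \<in> T \<and> y \<notin> X \<and> z \<notin> X}"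
      let ?S2 = "{(y, z). (x, y, z) \<in> T \<and> y \<in> X \<and> z \<notin> X}"
      have "o1 x + o2 x = card (?S1 \<union> ?S2)"
        unfolding o1_def o2_def by (rule card_Un_disjoint[symmetric]) (auto intro!: pairs_le[of _ x])
      also have "\<dots> \<le> card {(y, z). (x, y, z) \<in> T}"
        by (intro card_mono pairs_le[of _ x]) auto
      finally show ?thesis .
    qed
    then have "real (o1 x) + real (o2 x) \<le> 4 * real (d x)" using card_T_at[of x] by linarith
    moreover have "6 * share x * real (o2 x) \<le> 315/100 * real (o2 x)" by (simp add: share_def)
    moreover define w where "w = 6 * share x * real (o2 x)"
    moreover have "0 \<le> real (o1 x)" by simp
    ultimately show ?thesis using dx cX unfolding w_def[symmetric] by simp
  qed
qed

text \<open>\<open>Bs\<close> is independent and \<open>Af\<close> spans a matching, so such a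
  triangle is an edge of \<open>Af\<close> with a vertex of \<open>Bs\<close>. Both ends of that
  edge lie in \<open>As\<close>.\<close>

lemma card_T_outside_X: "card {(x, y, z). (x, y, z) \<in> T \<and> x \<notin> X \<and> y \<notin> X \<and> z \<notin> X} \<le> 3 * (card As * card Bs)"
proof -
  let ?Q = "{(x, y, z). (x, y, z) \<in> T \<and> x \<in> Bs \<and> y \<in> Af \<and> z \<in> Af}"
  have "card {(x, y, z). (x, y, z) \<in> T \<and> x \<notin> X \<and> y \<notin> X \<and> z \<notin> X} \<le> 3 * card ?Q"
  proof (rule card_T_perm_cover)
    show "finite ?Q" by (rule finite_subset[OF _ fin_T]) auto
    fix x y z assume "(x, y, z) \<in> {(x, y, z). (x, y, z) \<in> T \<and> x \<notin> X \<and> y \<notin> X \<and> z \<notin> X}"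
    then have t: "(x, y, z) \<in> T" "x \<notin> X" "y \<notin> X" "z \<notin> X" by auto
    have e: "E x y" "E x z" "E y z" using t by (auto simp: T_def)
    have mem: "x \<in> Af \<or> x \<in> Bs" "y \<in> Af \<or> y \<in> Bs" "z \<in> Af \<or> z \<in> Bs"
      using notX T_verts[OF t(1)] t sub_V by blast+
    have "\<not> (x \<in> Af \<and> y \<in> Af \<and> z \<in> Af)" using uniq_no_triangle[OF uniq_Af t(1)] by blast
    moreover have "(y, x, z) \<in> T" "(z, x, y) \<in> T" using e symE unfolding T_def by blast+
    moreover have "\<not> (x \<in> Bs \<and> y \<in> Bs)" "\<not> (x \<in> Bs \<and> z \<in> Bs)" "\<not> (y \<in> Bs \<and> z \<in> Bs)"
      using Bs_indep e by blast+
    ultimately show "(x, y, z) \<in> ?Q \<or> (y, x, z) \<in> ?Q \<or> (z, x, y) \<in> ?Q"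
      using mem t(1) by auto
  qed
  also have "card ?Q \<le> card (matched Af) * card Bs"
    by (rule card_pages_le) (auto simp: uniq_Af)
  finally show ?thesis by (simp add: As_def)
qed

lemma card_T_split:
  "card T \<le> 3 * (card As * card Bs) + 3 * (\<Sum>x\<in>X. o1 x) + 3 * (\<Sum>x\<in>X. o2 x) + (\<Sum>x\<in>X. 4 * card X)"
proof -
  let ?T0 = "{(x, y, z). (x, y, z) \<in> T \<and> x \<notin> X \<and> y \<notin> X \<and> z \<notin> X}"
  let ?T1 = "{(x, y, z). (x, y, z) \<in> T \<and> x \<in> X \<and> y \<notin> X \<and> z \<notin> X}"
  let ?T2 = "{(x, y, z). (x, y, z) \<in> T \<and> x \<in> X \<and> y \<in> X \<and> z \<notin> X}"
  \<comment> \<open>This is \<open>?T2\<close> with the vertex outside \<open>X\<close> moved to the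
    front, the position that \<open>card_T_perm_cover\<close> singles out.\<close>
  let ?T2' = "{(z, x, y). (x, y, z) \<in> T \<and> x \<in> X \<and> y \<in> X \<and> z \<notin> X}"
  let ?T3 = "{(x, y, z). (x, y, z) \<in> T \<and> x \<in> X \<and> y \<in> X \<and> z \<in> X}"
  let ?S1 = "{(x, y, z). (x, y, z) \<in> T \<and> (x \<in> X \<and> y \<notin> X \<and> z \<notin> X \<or> x \<notin> X \<and> y \<in> X \<and> z \<notin> X \<or> x \<notin> X \<and> y \<notin> X \<and> z \<in> X)}"
  let ?S2 = "{(x, y, z). (x, y, z) \<in> T \<and> (x \<in> X \<and> y \<in> X \<and> z \<notin> X \<or> x \<in> X \<and> y \<notin> X \<and> z \<in> X \<or> x \<notin> X \<and> y \<in> X \<and> z \<in> X)}"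
  have perm: "(y, x, z) \<in> T" "(z, x, y) \<in> T" "(y, z, x) \<in> T" "(x, z, y) \<in> T"
    if "(x, y, z) \<in> T" for x y z
    using that symE unfolding T_def by blast+
  have fin: "finite {(x, y, z). (x, y, z) \<in> T \<and> Q x y z}" for Q
    by (rule finite_subset[OF _ fin_T]) auto
  have "T \<subseteq> ?T0 \<union> ?S1 \<union> ?S2 \<union> ?T3" by auto
  then have "card T \<le> card (?T0 \<union> ?S1 \<union> ?S2 \<union> ?T3)" using fin by (intro card_mono) auto
  also have "\<dots> \<le> card ?T0 + card ?S1 + card ?S2 + card ?T3"
    by (intro order_trans[OF card_Un_le] add_mono order_refl)
  finally have "card T \<le> card ?T0 + card ?S1 + card ?S2 + card ?T3" .
  moreover have "card ?S1 \<le> 3 * card ?T1"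
  proof (rule card_T_perm_cover[OF fin])
    fix x y z assume "(x, y, z) \<in> ?S1"
    then show "(x, y, z) \<in> ?T1 \<or> (y, x, z) \<in> ?T1 \<or> (z, x, y) \<in> ?T1"
      using perm(1,2)[of x y z] by blast
  qed
  moreover have "card ?S2 \<le> 3 * card ?T2'"
  proof (rule card_T_perm_cover)
    show "finite ?T2'"
      by (rule finite_subset[OF _ fin_T]) (auto intro: perm(2))
    fix x y z assume "(x, y, z) \<in> ?S2"
    then show "(x, y, z) \<in> ?T2' \<or> (y, x, z) \<in> ?T2' \<or> (z, x, y) \<in> ?T2'"
      using perm(1,3,4)[of x y z] by auto
  qed
  moreover have "card ?T2' = card ?T2"
  proof -
    have eq: "?T2' = (\<lambda>(x, y, z). (z, x, y)) ` ?T2" by (auto simp: image_iff)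
    have inj: "inj_on (\<lambda>(x, y, z). (z, x, y)) ?T2" by (auto simp: inj_on_def)
    show ?thesis unfolding eq by (rule card_image[OF inj])
  qed
  moreover have "card ?T1 = (\<Sum>x\<in>X. o1 x)"
  proof -
    have "?T1 = Sigma X (\<lambda>x. {(y, z). (x, y, z) \<in> T \<and> y \<notin> X \<and> z \<notin> X})" by auto
    then show ?thesis unfolding o1_def by simp
  qed
  moreover have "card ?T2 = (\<Sum>x\<in>X. o2 x)"
  proof -
    have "?T2 = Sigma X (\<lambda>x. {(y, z). (x, y, z) \<in> T \<and> y \<in> X \<and> z \<notin> X})" by auto
    then show ?thesis unfolding o2_def by simp
  qed
  moreover have "card ?T3 \<le> (\<Sum>x\<in>X. 4 * card X)"
  proof -
    have "?T3 = Sigma X (\<lambda>x. {(y, z). (x, y, z) \<in> T \<and> y \<in> X \<and> z \<in> X})" by auto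
    then have "card ?T3 = (\<Sum>x\<in>X. card {(y, z). (x, y, z) \<in> T \<and> y \<in> X \<and> z \<in> X})" by simp
    also have "\<dots> = (\<Sum>x\<in>X. card {(y, z). y \<in> X \<and> z \<in> X \<and> E x y \<and> E x z \<and> E y z})"
      by (intro sum.cong refl arg_cong[of _ _ card]) (auto simp: T_def)
    also have "\<dots> \<le> (\<Sum>x\<in>X. 4 * card X)" by (intro sum_mono card_link_le) simp
    finally show ?thesis .
  qed
  ultimately show ?thesis using card_T_outside_X by linarith
qed

lemma sum_share: "(\<Sum>x\<in>X. real (o2 x)) \<le> (\<Sum>x\<in>X. 2 * share x * real (o2 x))"
proof -
  let ?S = "\<lambda>x. {(y, z). (x, y, z) \<in> T \<and> y \<in> X \<and> z \<notin> X}"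
  have fin: "finite (?S x)" for x by (rule pairs_le) auto
  have s: "(\<Sum>x\<in>X. f x * real (o2 x)) = (\<Sum>(x, y, z)\<in>Sigma X ?S. f x)" for f :: "'a \<Rightarrow> real"
  proof -
    have "(\<Sum>x\<in>X. f x * real (o2 x)) = (\<Sum>x\<in>X. \<Sum>p\<in>?S x. f x)" by (simp add: o2_def mult.commute)
    also have "\<dots> = (\<Sum>(x, p)\<in>Sigma X ?S. f x)" using fin by (subst sum.Sigma) auto
    finally show ?thesis by (simp add: case_prod_unfold)
  qed
  have "(\<Sum>x\<in>X. real (o2 x)) = (\<Sum>x\<in>X. 1 * real (o2 x))" by simp
  also have "\<dots> = (\<Sum>(x, y, z)\<in>Sigma X ?S. 1)" by (rule s)
  also have "\<dots> \<le> (\<Sum>(x, y, z)\<in>Sigma X ?S. share x + share y)"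
  proof (rule sum_mono, clarify)
    fix x y z assume t: "x \<in> X" "(x, y, z) \<in> T" "y \<in> X"
    then have "E x y" "E y x" using symE by (auto simp: T_def)
    then have "\<not> (x \<in> Af \<and> y \<in> Af)" using t by (auto simp: X_def As_def matched_def)
    then show "1 \<le> share x + share y" by (auto simp: share_def)
  qed
  also have "\<dots> = (\<Sum>(x, y, z)\<in>Sigma X ?S. share x) + (\<Sum>(x, y, z)\<in>Sigma X ?S. share y)"
    by (simp only: case_prod_unfold sum.distrib)
  also have "(\<Sum>(x, y, z)\<in>Sigma X ?S. share y) = (\<Sum>(x, y, z)\<in>Sigma X ?S. share x)"
    by (rule sum.reindex_bij_witness[of _ "\<lambda>(x, y, z). (y, x, z)" "\<lambda>(x, y, z). (y, x, z)"])
      (auto simp: T_perm(2))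
  also have "(\<Sum>(x, y, z)\<in>Sigma X ?S. share x) = (\<Sum>x\<in>X. share x * real (o2 x))"
    by (rule s[symmetric])
  finally show ?thesis by (simp add: sum_distrib_left mult.assoc)
qed

text \<open>3 a b <= 3/4 (m - s)^2 saves 3/2 s m against a charge of 146/100 s m; the difference
  exceeds 3/4 s^2 because s is at most 21/10^4 m.\<close>

lemma card_T_bound: "real (card T) \<le> 3/4 * m\<^sup>2"
proof -
  define s where "s = real (card X)"
  define a where "a = real (card As)"
  define b where "b = real (card Bs)"
  have s0: "0 \<le> s" "s \<le> 21/10^4 * m" using rest_le(1) rho unfolding s_def by linarith+
  have ab: "a + b = m - s"
  proof -
    have AB: "As \<inter> Bs = {}" using Af_Bs_disj sub_V by blast
    have "V = As \<union> Bs \<union> X" using sub_V by (auto simp: X_def)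
    then have "n = card (As \<union> Bs \<union> X)" by simp
    also have "\<dots> = card As + card Bs + card X"
      using AB finV by (subst card_Un_disjoint; (subst card_Un_disjoint)?) (auto simp: X_def)
    finally show ?thesis unfolding a_def b_def s_def by simp
  qed
  have "real (card T) \<le> real (3 * (card As * card Bs) + 3 * (\<Sum>x\<in>X. o1 x) + 3 * (\<Sum>x\<in>X. o2 x) + (\<Sum>x\<in>X. 4 * card X))"
    using card_T_split of_nat_le_iff by blast
  also have "\<dots> = 3 * (a * b) + (3 * (\<Sum>x\<in>X. real (o1 x)) + 3 * (\<Sum>x\<in>X. real (o2 x)) + (\<Sum>x\<in>X. 4 * s))"
    by (simp add: a_def b_def s_def)
  also have "\<dots> \<le> 3 * (a * b) + (3 * (\<Sum>x\<in>X. real (o1 x)) + 3 * (\<Sum>x\<in>X. 2 * share x * real (o2 x)) + (\<Sum>x\<in>X. 4 * s))"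
    using sum_share by simp
  also have "\<dots> = 3 * (a * b) + (\<Sum>x\<in>X. 3 * real (o1 x) + 6 * share x * real (o2 x) + 4 * s)"
    by (simp add: sum.distrib sum_distrib_left mult.assoc)
  also have "(\<Sum>x\<in>X. 3 * real (o1 x) + 6 * share x * real (o2 x) + 4 * s) \<le> (\<Sum>x\<in>X. 146/100 * m)"
    by (rule sum_mono) (use charge_le in \<open>simp add: s_def\<close>)
  also have "(\<Sum>x\<in>X. 146/100 * m) = 146/100 * (s * m)" by (simp add: s_def)
  finally have 1: "real (card T) \<le> 3 * (a * b) + 146/100 * (s * m)" by simp
  have "4 * (a * b) \<le> (a + b)\<^sup>2" using zero_le_power2[of "a - b"] by (simp add: power2_eq_square algebra_simps)
  then have "3 * (a * b) \<le> 3/4 * (m - s)\<^sup>2" unfolding ab by linarith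
  moreover have "(m - s)\<^sup>2 = m\<^sup>2 - 2 * (s * m) + s * s" by (simp add: power2_eq_square algebra_simps)
  moreover have "s * s \<le> s * (21/10^4 * m)" using s0 by (intro mult_left_mono) auto
  moreover have "0 \<le> s * m" using s0 by simp
  ultimately show ?thesis using 1 by (simp add: field_simps)
qed

end

section \<open>The upper bound for the number of ordered triangles\<close>

context fan_free
begin

lemma uniq_of_missing:
  assumes "finite B" "4999/10^4 * real n \<le> real (card B)" "10 ^ 6 \<le> real n"
    and "\<And>a. a \<in> A \<Longrightarrow> real (card (B - N a)) \<le> real n / 10^4"
  shows "uniq A"
  unfolding uniq_def
proof (intro ballI impI, rule ccontr)
  fix u v w assume h: "u \<in> A" "v \<in> A" "w \<in> A" "E u v" "E u w" "v \<noteq> w"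
  have "card B \<le> 2 + card (B - N u) + card (B - N v) + card (B - N w)"
    by (rule card_le_missing) (use h assms(1) in auto)
  then have "real (card B) \<le> 2 + real (card (B - N u)) + real (card (B - N v)) + real (card (B - N w))"
    by linarith
  then show False using assms(2,3) assms(4)[OF h(1)] assms(4)[OF h(2)] assms(4)[OF h(3)] by simp
qed

text \<open>Both ends of an edge inside B see almost all of A, which \<open>matched_missing\<close>
  allows only for a tiny matching in A. So at most one part carries a large matching.\<close>

lemma matched_small:
  assumes "finite A" "uniq A" "A \<inter> B = {}" "b \<in> B" "b' \<in> B" "E b b'"
    and "\<And>b. b \<in> B \<Longrightarrow> real (card (A - N b)) \<le> real n / 10^4"
  shows "real (card (matched A)) \<le> 2 + 3 * (real n / 10^4)"
proof -
  have fin: "finite (matched A)" and sub: "matched A \<subseteq> A" using assms(1) by (auto simp: matched_def)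
  have "card (matched A \<inter> N b') \<le> 2 + 2 * card (matched A - N b)"
    by (rule matched_missing) (use assms sub in auto)
  moreover have "card (matched A) = card (matched A \<inter> N b') + card (matched A - N b')"
    using fin by (simp add: card_Int_Diff)
  moreover have "card (matched A - N b) \<le> card (A - N b)" "card (matched A - N b') \<le> card (A - N b')"
    using assms(1) sub by (auto intro!: card_mono)
  ultimately have "card (matched A) \<le> 2 + 2 * card (A - N b) + card (A - N b')" by linarith
  then have "real (card (matched A)) \<le> 2 + 2 * real (card (A - N b)) + real (card (A - N b'))" by linarith
  then show ?thesis using assms(7)[OF assms(4)] assms(7)[OF assms(5)] by linarith
qed

lemma card_T_bipartite:
  assumes "A \<subseteq> V" "B \<subseteq> V" "uniq A" "uniq B"
  shows "card T \<le> 3 * (4 * n * card (V - A - B) + card (matched A) * card B + card (matched B) * card A)"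
proof -
  have fin: "finite A" "finite B" using assms finV finite_subset by blast+
  let ?R = "V - A - B"
  let ?QR = "{(x, y, z). (x, y, z) \<in> T \<and> x \<in> ?R}"
  let ?QA = "{(x, y, z). (x, y, z) \<in> T \<and> x \<in> B \<and> y \<in> A \<and> z \<in> A}"
  let ?QB = "{(x, y, z). (x, y, z) \<in> T \<and> x \<in> A \<and> y \<in> B \<and> z \<in> B}"
  have finQ: "finite {(x, y, z). (x, y, z) \<in> T \<and> P x y z}" for P
    by (rule finite_subset[OF _ fin_T]) auto
  have "card T \<le> 3 * card (?QR \<union> ?QA \<union> ?QB)"
  proof (rule card_T_perm_cover)
    show "finite (?QR \<union> ?QA \<union> ?QB)" using finQ by auto
    fix x y z assume t: "(x, y, z) \<in> T"
    have p: "(y, x, z) \<in> T" "(z, x, y) \<in> T" using t symE unfolding T_def by blast+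
    have "x \<in> V" "y \<in> V" "z \<in> V" using t T_sub by auto
    moreover have "\<not> (x \<in> A \<and> y \<in> A \<and> z \<in> A)" "\<not> (x \<in> B \<and> y \<in> B \<and> z \<in> B)"
      using uniq_no_triangle[OF assms(3) t] uniq_no_triangle[OF assms(4) t] by blast+
    ultimately show "(x, y, z) \<in> ?QR \<union> ?QA \<union> ?QB \<or> (y, x, z) \<in> ?QR \<union> ?QA \<union> ?QB \<or>
        (z, x, y) \<in> ?QR \<union> ?QA \<union> ?QB"
      using t p by blast
  qed
  also have "card (?QR \<union> ?QA \<union> ?QB) \<le> card ?QR + card ?QA + card ?QB"
    by (intro order_trans[OF card_Un_le] add_mono order_refl)
  also have "card ?QA \<le> card (matched A) * card B" using assms fin by (intro card_pages_le)
  also have "card ?QB \<le> card (matched B) * card A" using assms fin by (intro card_pages_le)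
  also have "card ?QR \<le> 4 * n * card ?R"
  proof -
    have fx: "finite {(y, z). (x, y, z) \<in> T}" for x
      by (rule finite_subset[of _ "N x \<times> N x"]) (auto simp: T_def)
    have "?QR = Sigma ?R (\<lambda>x. {(y, z). (x, y, z) \<in> T})" by auto
    then have "card ?QR = (\<Sum>x\<in>?R. card {(y, z). (x, y, z) \<in> T})" using finV fx by simp
    also have "\<dots> \<le> (\<Sum>x\<in>?R. 4 * n)"
    proof (rule sum_mono)
      fix x show "card {(y, z). (x, y, z) \<in> T} \<le> 4 * n" using card_T_at[of x] d_le[of x] by linarith
    qed
    finally show ?thesis by (simp add: mult.commute)
  qed
  finally show ?thesis by simp
qed

text \<open>By \<open>matched_small\<close> B is independent. Then 3/4 n^2 triples force nearly
  every vertex of A to be matched, and \<open>matched A\<close> can replace A in the locale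
  above.\<close>

lemma card_T_near_bipartite:
  assumes AV: "A \<subseteq> V" and BV: "B \<subseteq> V" and disj: "A \<inter> B = {}" and big: "10 ^ 6 \<le> real n"
    and sA: "4999/10^4 * real n \<le> real (card A)" and sB: "4999/10^4 * real n \<le> real (card B)"
    and missA: "\<And>a. a \<in> A \<Longrightarrow> real (card (B - N a)) \<le> real n / 10^4"
    and missB: "\<And>b. b \<in> B \<Longrightarrow> real (card (A - N b)) \<le> real n / 10^4"
    and many: "1/10 * real n \<le> real (card (matched A))" "3/4 * (real n)\<^sup>2 \<le> real (card T)"
  shows "real (card T) \<le> 3/4 * (real n)\<^sup>2"
proof -
  define m where "m = real n"
  have finAB: "finite A" "finite B" using AV BV finV finite_subset by blast+
  have uA: "uniq A" and uB: "uniq B"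
    using uniq_of_missing[of B A] uniq_of_missing[of A B] finAB sA sB big missA missB by auto
  have "\<not> E b b'" if "b \<in> B" "b' \<in> B" for b b'
  proof
    assume "E b b'"
    then have "real (card (matched A)) \<le> 2 + 3 * (real n / 10^4)"
      using matched_small[OF finAB(1) uA disj that] missB by blast
    then show False using many(1) big by simp
  qed
  then have mB: "matched B = {}" by (auto simp: matched_def)
  have AB: "real (card A) + real (card B) \<le> m" "real (card (V - A - B)) = m - real (card A) - real (card B)"
  proof -
    have c: "card (A \<union> B) = card A + card B" using finAB disj by (simp add: card_Un_disjoint)
    have "card (A \<union> B) \<le> n" using AV BV finV by (intro card_mono) auto
    moreover have "V - A - B = V - (A \<union> B)" by auto
    moreover have "card (V - (A \<union> B)) = n - card (A \<union> B)"
      using AV BV finAB by (simp add: card_Diff_subset)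
    ultimately show "real (card A) + real (card B) \<le> m"
      "real (card (V - A - B)) = m - real (card A) - real (card B)"
      using c unfolding m_def by (simp_all add: of_nat_diff flip: of_nat_add)
  qed
  have cA: "real (card A) \<le> 5001/10^4 * m" and cB: "real (card B) \<le> 5001/10^4 * m"
    using AB sA sB by (simp_all add: m_def)
  have cR: "real (card (V - A - B)) \<le> 2/10^4 * m" using AB sA sB by (simp add: m_def)
  define M where "M = real (card (matched A))"
  have m0: "10 ^ 6 \<le> m" using big by (simp add: m_def)
  have "real (card T) \<le> real (3 * (4 * n * card (V - A - B) + card (matched A) * card B + card (matched B) * card A))"
    using card_T_bipartite[OF AV BV uA uB] of_nat_le_iff by blast
  then have "3/4 * m\<^sup>2 \<le> 12 * (m * real (card (V - A - B))) + 3 * (M * real (card B))"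
    using many(2) by (simp add: mB m_def M_def mult.assoc)
  also have "m * real (card (V - A - B)) \<le> m * (2/10^4 * m)" using cR m0 by (intro mult_left_mono) auto
  also have "M * real (card B) \<le> M * (5001/10^4 * m)" using cB by (intro mult_left_mono) (auto simp: M_def)
  finally have "m * (3/4 * m) \<le> m * (24/10^4 * m + 15003/10^4 * M)"
    by (simp add: power2_eq_square algebra_simps)
  then have "3/4 * m \<le> 24/10^4 * m + 15003/10^4 * M"
    using m0 by (subst (asm) mult_le_cancel_left_pos) auto
  then have MA: "498/1000 * m \<le> M" using m0 by simp
  have sub: "matched A \<subseteq> A" by (auto simp: matched_def)
  interpret matched_bipartite V E "matched A" B
  proof
    show "matched A \<subseteq> V" "B \<subseteq> V" "matched A \<inter> B = {}" using AV BV disj sub by auto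
    show "10 ^ 6 \<le> real n" by (rule big)
    show "498/1000 * real n \<le> real (card (matched A))" using MA by (simp add: M_def m_def)
    have "card (matched A) \<le> card A" using sub finAB by (intro card_mono)
    then show "real (card (matched A)) \<le> 5001/10^4 * real n" using cA unfolding m_def by linarith
    show "4999/10^4 * real n \<le> real (card B)" by (rule sB)
    show "real (card (B - N a)) \<le> real n / 10^4" if "a \<in> matched A" for a
      using missA that sub by blast
    show "real (card (matched A - N b)) \<le> real n / 10^4" if "b \<in> B" for b
    proof -
      have "card (matched A - N b) \<le> card (A - N b)" using sub finAB by (intro card_mono) auto
      then show ?thesis using missB[OF that] by linarith
    qed
    show "uniq (matched A)" using uA sub unfolding uniq_def by blast
    show "matched (matched A) = matched A" using symE unfolding matched_def by blast
  qed
  show ?thesis by (rule card_T_bound)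
qed

theorem card_T_upper:
  assumes "10 ^ 30 \<le> real n"
  shows "real (card T) \<le> 3/4 * (real n)\<^sup>2"
proof (rule ccontr)
  assume not: "\<not> ?thesis"
  then have many: "3/4 * (real n)\<^sup>2 \<le> real (card T)" by simp
  define K :: nat where "K = 10 ^ 15"
  have K: "2 \<le> K" by (simp add: K_def)
  have big: "10 ^ 6 \<le> real n" using assms by simp
  have good: "(1/4 - 1/10^10) * (real n)\<^sup>2 \<le> real (card (good K))"
    using many_good[OF assms many] by (simp add: K_def)
  have "real (2 * card (good K)) \<le> real (card {(x, y). page_edge K x y})"
    using card_page_edge[OF K] of_nat_le_iff by blast
  then have edges: "(1/2 - 2/10^10) * (real n)\<^sup>2 \<le> real (card {(x, y). page_edge K x y})"
    using good by (simp add: field_simps)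
  have tf: "False" if "page_edge K x y" "page_edge K y z" "page_edge K x z" for x y z
    using page_edge_third[OF that(1) page_edge(1)[OF that(3)] page_edge(1)[OF that(2)]]
      page_edge(2)[OF that(2)] page_edge(2)[OF that(3)] K by linarith
  have pos: "0 < n" using big by (cases "n = 0") auto
  have PV: "x \<in> V" if "page_edge K x y" for x y using EV page_edge(1)[OF that] .
  obtain A B where AB: "A \<subseteq> V" "B \<subseteq> V" "A \<inter> B = {}"
    "(1/2 - 1/10^4) * real n \<le> real (card A)" "(1/2 - 1/10^4) * real n \<le> real (card B)"
    and mA: "\<And>a. a \<in> A \<Longrightarrow> real (card {b\<in>B. \<not> page_edge K a b}) \<le> 1/10^4 * real n"
    and mB: "\<And>b. b \<in> B \<Longrightarrow> real (card {a\<in>A. \<not> page_edge K b a}) \<le> 1/10^4 * real n"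
  proof (rule triangle_free_stability[of V "page_edge K"])
    show "x \<in> V" if "page_edge K x y" for x y by (rule PV[OF that])
    show "page_edge K y x" if "page_edge K x y" for x y by (rule page_edge(3)[OF that])
    show False if "page_edge K x y" "page_edge K y z" "page_edge K x z" for x y z by (rule tf[OF that])
  qed (use finV edges pos that in auto)
  have finAB: "finite A" "finite B" using AB finV finite_subset by blast+
  have sA: "4999/10^4 * real n \<le> real (card A)" and sB: "4999/10^4 * real n \<le> real (card B)"
    using AB by simp_all
  have missA: "real (card (B - N a)) \<le> real n / 10^4" if "a \<in> A" for a
  proof -
    have "card (B - N a) \<le> card {b\<in>B. \<not> page_edge K a b}"
      using finAB page_edge(1) by (intro card_mono) auto
    then show ?thesis using mA[OF that] by simp
  qed
  have missB: "real (card (A - N b)) \<le> real n / 10^4" if "b \<in> B" for b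
  proof -
    have "card (A - N b) \<le> card {a\<in>A. \<not> page_edge K b a}"
      using finAB page_edge(1) by (intro card_mono) auto
    then show ?thesis using mB[OF that] by simp
  qed
  have uA: "uniq A" and uB: "uniq B"
    using uniq_of_missing[of B A] uniq_of_missing[of A B] finAB sA sB big missA missB by auto
  have "\<not> (1/10 * real n \<le> real (card (matched A)))"
    using card_T_near_bipartite[OF AB(1-3) big sA sB missA missB _ many] not by blast
  moreover have "\<not> (1/10 * real n \<le> real (card (matched B)))"
    using card_T_near_bipartite[OF AB(2,1) _ big sB sA missB missA _ many] AB(3) not
    by (metis Int_commute)
  ultimately have M: "real (card (matched A)) \<le> 1/10 * real n" "real (card (matched B)) \<le> 1/10 * real n"
    by simp_all
  have c: "real (card A) + real (card B) + real (card (V - A - B)) = real n"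
  proof -
    have "card (A \<union> B) = card A + card B" using finAB AB by (simp add: card_Un_disjoint)
    moreover have "card (V - (A \<union> B)) = n - card (A \<union> B)" "card (A \<union> B) \<le> n"
      using AB finAB finV by (auto simp: card_Diff_subset intro!: card_mono)
    moreover have "V - A - B = V - (A \<union> B)" by auto
    ultimately have "card A + card B + card (V - A - B) = n" by simp
    then show ?thesis by (simp flip: of_nat_add)
  qed
  have "real (card T) \<le> real (3 * (4 * n * card (V - A - B) + card (matched A) * card B + card (matched B) * card A))"
    using card_T_bipartite[OF AB(1,2) uA uB] of_nat_le_iff by blast
  also have "\<dots> = 12 * (real n * real (card (V - A - B))) + 3 * (real (card (matched A)) * real (card B))
      + 3 * (real (card (matched B)) * real (card A))" by (simp add: algebra_simps)
  \<comment> \<open>Two small matchings carry at most about 0.37 n^2 ordered triangles; 6/10 is a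
    crude bound for the size of a part.\<close>
  also have "\<dots> \<le> 12 * (real n * (2/10^4 * real n)) + 3 * ((1/10 * real n) * (6/10 * real n))
      + 3 * ((1/10 * real n) * (6/10 * real n))"
    using M c sA sB by (intro add_mono mult_left_mono mult_mono) auto
  also have "\<dots> < 3/4 * (real n)\<^sup>2" using big by (simp add: power2_eq_square)
  finally show False using many by simp
qed

end

section \<open>Copies in graphs\<close>

lemma edge_mem:
  assumes "simple_graph G" "{x, y} \<in> edges G"
  shows "x \<in> verts G" "y \<in> verts G" "x \<noteq> y"
  using assms by (force simp: simple_graph_def)+

lemma copy_of_embedding:
  assumes H: "simple_graph H" and G: "simple_graph G" and inj: "inj_on f (verts H)"
    and V: "f ` verts H \<subseteq> verts G" and E: "\<And>e. e \<in> edges H \<Longrightarrow> f ` e \<in> edges G"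
  shows "\<lparr>verts = f ` verts H, edges = ((`) f) ` edges H\<rparr> \<in> copies H G"
proof -
  let ?F = "\<lparr>verts = f ` verts H, edges = ((`) f) ` edges H\<rparr>"
  have sub: "e \<subseteq> verts H" "card e = 2" if "e \<in> edges H" for e
    using H that by (auto simp: simple_graph_def)
  have "card (f ` e) = 2" if "e \<in> edges H" for e
    using sub[OF that] inj inj_on_subset by (metis card_image)
  then have "simple_graph ?F"
    using H sub by (auto simp: simple_graph_def)
  moreover have "{u, v} \<in> edges H \<longleftrightarrow> {f u, f v} \<in> ((`) f) ` edges H"
    if "u \<in> verts H" "v \<in> verts H" for u v
  proof
    assume "{u, v} \<in> edges H"
    then have "f ` {u, v} \<in> ((`) f) ` edges H" by (rule imageI)
    then show "{f u, f v} \<in> ((`) f) ` edges H" by simp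
  next
    assume "{f u, f v} \<in> ((`) f) ` edges H"
    then obtain e where e: "e \<in> edges H" "f ` {u, v} = f ` e" by auto
    then have "{u, v} = e"
      using inj_on_image_eq_iff[OF inj, of "{u, v}" e] sub that by auto
    then show "{u, v} \<in> edges H" using e by simp
  qed
  ultimately show ?thesis
    using G V E inj
    by (auto simp: copies_def subgraph_def isomorphic_def bij_betw_def intro!: exI[of _ f])
qed

lemma embedding_of_copy:
  assumes "F \<in> copies H G"
  obtains f where "inj_on f (verts H)" "f ` verts H = verts F"
    "\<And>u v. u \<in> verts H \<Longrightarrow> v \<in> verts H \<Longrightarrow> {u, v} \<in> edges H \<longleftrightarrow> {f u, f v} \<in> edges F"
    "edges F \<subseteq> edges G" "verts F \<subseteq> verts G" "simple_graph F"
  using assms by (auto simp: copies_def subgraph_def isomorphic_def bij_betw_def)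

lemma free_of_iff: "free_of F G \<longleftrightarrow> copies F G = {}"
  by (auto simp: free_of_def copies_def)

lemma suspension_path_edges:
  "edges (suspension (path_graph 5)) =
    {{Some 0, Some 1}, {Some 1, Some 2}, {Some 2, Some 3}, {Some 3, Some 4},
     {None, Some 0}, {None, Some 1}, {None, Some 2}, {None, Some 3}, {None, Some 4}}"
proof -
  have "{{i, Suc i} | i. Suc i < 5} = {{0, 1}, {1, 2}, {2, 3}, {3, 4 :: nat}}"
  proof -
    have "{{i, Suc i} | i. Suc i < 5} = (\<lambda>i. {i, Suc i}) ` {..<4}" by auto
    also have "{..<4 :: nat} = {0, 1, 2, 3}" by auto
    finally show ?thesis by (simp add: eval_nat_numeral)
  qed
  moreover have "{{None, Some v} | v. v < (5 :: nat)} = (\<lambda>v. {None, Some v}) ` {0, 1, 2, 3, 4}"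
  proof -
    have "{{None, Some v} | v. v < (5 :: nat)} = (\<lambda>v. {None, Some v}) ` {..<5}" by auto
    also have "{..<5 :: nat} = {0, 1, 2, 3, 4}" by auto
    finally show ?thesis .
  qed
  ultimately show ?thesis by (simp add: suspension_def path_graph_def insert_commute)
qed

lemma suspension_path_verts:
  "verts (suspension (path_graph 5)) = {None, Some 0, Some 1, Some 2, Some 3, Some (4 :: nat)}"
proof -
  have "{..<5 :: nat} = {0, 1, 2, 3, 4}" by auto
  then show ?thesis by (simp add: suspension_def path_graph_def)
qed

lemma fan_free_of_free:
  fixes G :: "'a graph"
  assumes G: "simple_graph G" and free: "free_of (suspension (path_graph 5)) G"
  shows "fan_free (verts G) (\<lambda>x y. {x, y} \<in> edges G)"
proof
  show "finite (verts G)" using G by (simp add: simple_graph_def)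
  show "x \<in> verts G" if "{x, y} \<in> edges G" for x y using edge_mem[OF G that] by blast
  show "{y, x} \<in> edges G" if "{x, y} \<in> edges G" for x y using that by (simp add: insert_commute)
  show "{x, x} \<notin> edges G" for x using edge_mem(3)[OF G, of x x] by blast
  fix x a b c d e
  assume h: "{x, a} \<in> edges G" "{x, b} \<in> edges G" "{x, c} \<in> edges G" "{x, d} \<in> edges G" "{x, e} \<in> edges G"
    "{a, b} \<in> edges G" "{b, c} \<in> edges G" "{c, d} \<in> edges G" "{d, e} \<in> edges G" "distinct [a, b, c, d, e]"
  define f where "f p = (case p of None \<Rightarrow> x | Some i \<Rightarrow> [a, b, c, d, e] ! i)" for p
  have f: "f None = x" "f (Some 0) = a" "f (Some 1) = b" "f (Some 2) = c" "f (Some 3) = d" "f (Some 4) = e"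
    by (simp_all add: f_def eval_nat_numeral)
  have ne: "x \<noteq> a" "x \<noteq> b" "x \<noteq> c" "x \<noteq> d" "x \<noteq> e" and V: "x \<in> verts G" "a \<in> verts G" "b \<in> verts G"
    "c \<in> verts G" "d \<in> verts G" "e \<in> verts G"
    using edge_mem[OF G h(1)] edge_mem[OF G h(2)] edge_mem[OF G h(3)] edge_mem[OF G h(4)] edge_mem[OF G h(5)]
    by auto
  have "\<lparr>verts = f ` verts (suspension (path_graph 5)), edges = ((`) f) ` edges (suspension (path_graph 5))\<rparr>
      \<in> copies (suspension (path_graph 5)) G"
  proof (rule copy_of_embedding)
    show "simple_graph (suspension (path_graph 5))" by (intro simple_graph_suspension simple_graph_path)
    show "inj_on f (verts (suspension (path_graph 5)))"
      unfolding suspension_path_verts using ne ne[symmetric] h(10) by (simp add: f[simplified])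
    show "f ` verts (suspension (path_graph 5)) \<subseteq> verts G"
      unfolding suspension_path_verts using V by (simp add: f[simplified])
    show "f ` p \<in> edges G" if "p \<in> edges (suspension (path_graph 5))" for p
      using that h unfolding suspension_path_edges by (auto simp: f[simplified])
  qed (rule G)
  then show False using free unfolding free_of_iff by blast
qed

definition triangle_graph :: "'a \<times> 'a \<times> 'a \<Rightarrow> 'a graph" where
  "triangle_graph p = (case p of (a, b, c) \<Rightarrow> \<lparr>verts = {a, b, c}, edges = {{a, b}, {a, c}, {b, c}}\<rparr>)"

lemma triangle_graph_swap:
  "triangle_graph (a, c, b) = triangle_graph (a, b, c)" "triangle_graph (b, a, c) = triangle_graph (a, b, c)"
proof -
  have "{a, c} = {c, a}" "{b, c} = {c, b}" "{a, b} = {b, a}" by blast+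
  then show "triangle_graph (a, c, b) = triangle_graph (a, b, c)"
    "triangle_graph (b, a, c) = triangle_graph (a, b, c)"
    unfolding triangle_graph_def by (auto simp: insert_commute)
qed

lemma complete_graph_3:
  "verts (complete_graph 3) = {0, 1, 2}" "edges (complete_graph 3) = {{0, 1}, {0, 2}, {1, 2}}"
proof -
  have 3: "i < 3 \<longleftrightarrow> i = 0 \<or> i = 1 \<or> i = 2" for i :: nat by auto
  show "verts (complete_graph 3) = {0, 1, 2}" by (auto simp: complete_graph_def)
  show "edges (complete_graph 3) = {{0, 1}, {0, 2}, {1, 2}}"
  proof
    have "{i, j} \<in> edges (complete_graph 3)" if "i < 3" "j < 3" "i \<noteq> j" for i j :: nat
      using that unfolding complete_graph_def by auto
    from this[of 0 1] this[of 0 2] this[of 1 2]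
    show "{{0, 1}, {0, 2}, {1, 2}} \<subseteq> edges (complete_graph 3)" by simp
    show "edges (complete_graph 3) \<subseteq> {{0, 1}, {0, 2}, {1, 2}}"
      unfolding complete_graph_def 3 by (auto simp: insert_commute)
  qed
qed

lemma copies_K3:
  assumes G: "simple_graph G"
  shows "copies (complete_graph 3) G =
    triangle_graph ` {(a, b, c). {a, b} \<in> edges G \<and> {b, c} \<in> edges G \<and> {a, c} \<in> edges G}"
proof (intro equalityI subsetI)
  fix F assume "F \<in> copies (complete_graph 3) G"
  then obtain f where f: "inj_on f {0, 1, 2 :: nat}" "f ` {0, 1, 2} = verts F"
    "\<And>u v. u \<in> {0, 1, 2} \<Longrightarrow> v \<in> {0, 1, 2} \<Longrightarrow> {u, v} \<in> edges (complete_graph 3) \<longleftrightarrow> {f u, f v} \<in> edges F"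
    "edges F \<subseteq> edges G" "verts F \<subseteq> verts G" "simple_graph F"
    by (rule embedding_of_copy) (unfold complete_graph_3(1), blast)
  have e: "{f 0, f 1} \<in> edges F" "{f 0, f 2} \<in> edges F" "{f 1, f 2} \<in> edges F"
    using f(3)[of 0 1] f(3)[of 0 2] f(3)[of 1 2] by (simp_all add: complete_graph_3)
  have V: "verts F = {f 0, f 1, f 2}" using f(2) by auto
  have "edges F \<subseteq> {{f 0, f 1}, {f 0, f 2}, {f 1, f 2}}"
  proof
    fix p assume "p \<in> edges F"
    then have "p \<subseteq> {f 0, f 1, f 2}" "card p = 2" using f(6) V by (auto simp: simple_graph_def)
    then show "p \<in> {{f 0, f 1}, {f 0, f 2}, {f 1, f 2}}" by (auto simp: card_2_iff)
  qed
  then have "edges F = {{f 0, f 1}, {f 0, f 2}, {f 1, f 2}}" using e by blast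
  then have "F = triangle_graph (f 0, f 1, f 2)"
    using V by (intro graph.equality) (simp_all add: triangle_graph_def)
  moreover have "(f 0, f 1, f 2) \<in> {(a, b, c). {a, b} \<in> edges G \<and> {b, c} \<in> edges G \<and> {a, c} \<in> edges G}"
    using e f(4) by auto
  ultimately show "F \<in> triangle_graph ` {(a, b, c). {a, b} \<in> edges G \<and> {b, c} \<in> edges G \<and> {a, c} \<in> edges G}"
    by (rule image_eqI)
next
  fix F assume "F \<in> triangle_graph ` {(a, b, c). {a, b} \<in> edges G \<and> {b, c} \<in> edges G \<and> {a, c} \<in> edges G}"
  then obtain a b c where F: "F = triangle_graph (a, b, c)"
    and e: "{a, b} \<in> edges G" "{b, c} \<in> edges G" "{a, c} \<in> edges G" by auto
  define f where "f i = [a, b, c] ! i" for i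
  have f: "f 0 = a" "f 1 = b" "f 2 = c" by (simp_all add: f_def eval_nat_numeral)
  have ne: "a \<noteq> b" "b \<noteq> c" "a \<noteq> c" and V: "a \<in> verts G" "b \<in> verts G" "c \<in> verts G"
    using edge_mem[OF G e(1)] edge_mem[OF G e(2)] edge_mem[OF G e(3)] by auto
  have "\<lparr>verts = f ` verts (complete_graph 3), edges = ((`) f) ` edges (complete_graph 3)\<rparr> \<in> copies (complete_graph 3) G"
  proof (rule copy_of_embedding)
    show "inj_on f (verts (complete_graph 3))"
      unfolding complete_graph_3 using ne ne[symmetric] by (simp add: f[simplified])
    show "f ` verts (complete_graph 3) \<subseteq> verts G"
      unfolding complete_graph_3 using V by (simp add: f[simplified])
    show "f ` p \<in> edges G" if "p \<in> edges (complete_graph 3)" for p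
      using that e unfolding complete_graph_3 by (auto simp: f[simplified])
  qed (rule simple_graph_complete G)+
  moreover have "\<lparr>verts = f ` verts (complete_graph 3), edges = ((`) f) ` edges (complete_graph 3)\<rparr> = F"
    unfolding F complete_graph_3 triangle_graph_def by (simp add: f[simplified])
  ultimately show "F \<in> copies (complete_graph 3) G" by simp
qed

lemma num_triangles_upper:
  fixes G :: "'a graph"
  assumes G: "simple_graph G" and free: "free_of (suspension (path_graph 5)) G"
    and n: "card (verts G) = n" "10 ^ 30 \<le> n"
  shows "real (num_copies (complete_graph 3) G) \<le> (real n)\<^sup>2 / 8"
proof -
  interpret fan_free "verts G" "\<lambda>x y. {x, y} \<in> edges G" by (rule fan_free_of_free[OF G free])
  have T: "T = {(a, b, c). {a, b} \<in> edges G \<and> {b, c} \<in> edges G \<and> {a, c} \<in> edges G}"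
    unfolding T_def ..
  have "card T = (\<Sum>F\<in>triangle_graph ` T. card {p\<in>T. triangle_graph p = F})"
    using sum.image_gen[OF fin_T, of "\<lambda>_. 1 :: nat" triangle_graph] by simp
  also have "\<dots> \<ge> (\<Sum>F\<in>triangle_graph ` T. 6)"
  proof (rule sum_mono)
    fix F assume "F \<in> triangle_graph ` T"
    then obtain a b c where F: "F = triangle_graph (a, b, c)" and t: "(a, b, c) \<in> T" by auto
    have e: "{a, b} \<in> edges G" "{b, c} \<in> edges G" "{a, c} \<in> edges G" using t by (auto simp: T_def)
    have ne: "a \<noteq> b" "b \<noteq> c" "a \<noteq> c"
      using edge_mem[OF G e(1)] edge_mem[OF G e(2)] edge_mem[OF G e(3)] by auto
    let ?S = "{(a, b, c), (a, c, b), (b, a, c), (b, c, a), (c, a, b), (c, b, a)}"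
    have sub: "?S \<subseteq> {p\<in>T. triangle_graph p = F}"
    proof -
      have "triangle_graph (a, c, b) = F" "triangle_graph (b, a, c) = F" "triangle_graph (b, c, a) = F"
        "triangle_graph (c, a, b) = F" "triangle_graph (c, b, a) = F"
        unfolding F by (metis triangle_graph_swap)+
      moreover have "{b, a} \<in> edges G" "{c, b} \<in> edges G" "{c, a} \<in> edges G"
        using e by (simp_all add: insert_commute)
      ultimately show ?thesis using e F by (simp add: T_def)
    qed
    have "6 = card ?S" using ne by (simp add: card_insert_if)
    also have "card ?S \<le> card {p\<in>T. triangle_graph p = F}" by (rule card_mono[OF _ sub]) simp
    finally show "6 \<le> card {p\<in>T. triangle_graph p = F}" .
  qed
  finally have "6 * num_copies (complete_graph 3) G \<le> card T"
    unfolding num_copies_def copies_K3[OF G] T[symmetric] by simp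
  then have "6 * real (num_copies (complete_graph 3) G) \<le> real (card T)"
    by linarith
  moreover have "real (card T) \<le> 3/4 * (real n)\<^sup>2"
  proof -
    have "real (10 ^ 30) \<le> real n" using n(2) of_nat_le_iff by blast
    then have "10 ^ 30 \<le> real n" by simp
    then show ?thesis using card_T_upper unfolding n by blast
  qed
  ultimately show ?thesis by simp
qed

text \<open>The extremal graph: a complete bipartite graph with a perfect matching added to the part
  \<open>{..<2 * k}\<close>.\<close>

definition extremal_adj :: "nat \<Rightarrow> nat \<Rightarrow> nat \<Rightarrow> nat \<Rightarrow> bool" where
  "extremal_adj k n i j \<longleftrightarrow> i < n \<and> j < n \<and> i \<noteq> j \<and>
     ((i < 2 * k) \<noteq> (j < 2 * k) \<or> i < 2 * k \<and> j < 2 * k \<and> i div 2 = j div 2)"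

definition extremal_graph :: "nat \<Rightarrow> nat \<Rightarrow> nat graph" where
  "extremal_graph k n = \<lparr>verts = {..<n}, edges = {{i, j} | i j. extremal_adj k n i j}\<rparr>"

lemma extremal_adj_sym: "extremal_adj k n i j \<longleftrightarrow> extremal_adj k n j i"
  unfolding extremal_adj_def by metis

lemma extremal_edge: "{i, j} \<in> edges (extremal_graph k n) \<longleftrightarrow> extremal_adj k n i j"
  unfolding extremal_graph_def using extremal_adj_sym by (auto simp: doubleton_eq_iff)

lemma simple_extremal: "simple_graph (extremal_graph k n)"
  by (auto simp: simple_graph_def extremal_graph_def extremal_adj_def)

text \<open>If the centre x lies in the matched part, each of the path edges \<open>a b\<close> and
  \<open>c d\<close> has an end in that part, and both ends would be the mate of x. If x lies
  outside, \<open>a b c\<close> would be a path inside a matching.\<close>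

lemma free_extremal: "free_of (suspension (path_graph 5)) (extremal_graph k n)"
proof (rule ccontr)
  assume "\<not> ?thesis"
  then obtain F where "F \<in> copies (suspension (path_graph 5)) (extremal_graph k n)"
    unfolding free_of_iff by blast
  then obtain f where inj: "inj_on f (verts (suspension (path_graph 5)))"
    and iso: "\<And>u v. u \<in> verts (suspension (path_graph 5)) \<Longrightarrow> v \<in> verts (suspension (path_graph 5)) \<Longrightarrow>
      {u, v} \<in> edges (suspension (path_graph 5)) \<longleftrightarrow> {f u, f v} \<in> edges F"
    and sub: "edges F \<subseteq> edges (extremal_graph k n)"
    by (rule embedding_of_copy) blast
  have adj: "extremal_adj k n (f u) (f v)" if "{u, v} \<in> edges (suspension (path_graph 5))"
    "u \<in> verts (suspension (path_graph 5))" "v \<in> verts (suspension (path_graph 5))" for u v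
    using iso[OF that(2,3)] that(1) sub extremal_edge by blast
  define x a b c d where "x = f None" and "a = f (Some 0)" and "b = f (Some 1)" and "c = f (Some 2)"
    and "d = f (Some 3)"
  have e: "extremal_adj k n x a" "extremal_adj k n x b" "extremal_adj k n x c" "extremal_adj k n x d"
    "extremal_adj k n a b" "extremal_adj k n b c" "extremal_adj k n c d"
    unfolding x_def a_def b_def c_def d_def
    by (rule adj; simp add: suspension_path_edges suspension_path_verts)+
  have ne: "a \<noteq> b" "a \<noteq> c" "a \<noteq> d" "b \<noteq> c" "b \<noteq> d" "c \<noteq> d"
    unfolding a_def b_def c_def d_def
    using inj by (auto simp: suspension_path_verts inj_on_def)
  have half: False if "p div 2 = q div 2" "q div 2 = r div 2" "p \<noteq> q" "p \<noteq> r" "q \<noteq> r" for p q r :: nat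
  proof -
    have two: "s = 2 * (s div 2) \<or> s = 2 * (s div 2) + 1" for s :: nat by presburger
    show False using two[of p] two[of q] two[of r] that by linarith
  qed
  show False
  proof (cases "x < 2 * k")
    case True
    have mate: "v div 2 = x div 2 \<and> v \<noteq> x" if "extremal_adj k n x v" "v < 2 * k" for v
      using that True unfolding extremal_adj_def by auto
    have "a < 2 * k \<or> b < 2 * k" "c < 2 * k \<or> d < 2 * k"
      using e(5,7) unfolding extremal_adj_def by auto
    then obtain v w where v: "v = a \<or> v = b" "v < 2 * k" and w: "w = c \<or> w = d" "w < 2 * k" by blast
    have "v \<noteq> w" using v(1) w(1) ne by blast
    moreover have "v div 2 = x div 2 \<and> v \<noteq> x" "w div 2 = x div 2 \<and> w \<noteq> x"
      using v w e(1-4) by (blast intro!: mate)+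
    ultimately show False using half[of v x w] by metis
  next
    case False
    then have "a < 2 * k" "b < 2 * k" "c < 2 * k" using e(1-3) unfolding extremal_adj_def by auto
    then have "a div 2 = b div 2" "b div 2 = c div 2" using e(5,6) unfolding extremal_adj_def by auto
    then show False using half[of a b c] ne by blast
  qed
qed

lemma num_triangles_extremal:
  assumes "2 * k \<le> n"
  shows "k * (n - 2 * k) \<le> num_copies (complete_graph 3) (extremal_graph k n)"
proof -
  let ?G = "extremal_graph k n"
  let ?f = "\<lambda>(i, b). triangle_graph (2 * i, 2 * i + 1, b)"
  let ?D = "{..<k} \<times> {2 * k..<n}"
  have "inj_on ?f ?D"
  proof (rule inj_onI, clarify)
    fix i b i' b' assume h: "i < k" "b \<in> {2 * k..<n}" "i' < k" "b' \<in> {2 * k..<n}"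
      "triangle_graph (2 * i, 2 * i + 1, b) = triangle_graph (2 * i', 2 * i' + 1, b')"
    then have eq: "{2 * i, 2 * i + 1, b} = {2 * i', 2 * i' + 1, b'}" by (simp add: triangle_graph_def)
    have "b \<in> {2 * i', 2 * i' + 1, b'}" "2 * i \<in> {2 * i', 2 * i' + 1, b'}" using eq by auto
    then have "b = b'" "2 * i = 2 * i' \<or> 2 * i = 2 * i' + 1" using h by auto
    then show "i = i' \<and> b = b'" by presburger
  qed
  then have "k * (n - 2 * k) = card (?f ` ?D)" by (simp add: card_image)
  also have "\<dots> \<le> card (copies (complete_graph 3) ?G)"
  proof (rule card_mono)
    have "copies (complete_graph 3) ?G \<subseteq> triangle_graph ` ({..<n} \<times> {..<n} \<times> {..<n})"
      unfolding copies_K3[OF simple_extremal] extremal_edge by (auto simp: extremal_adj_def)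
    then show "finite (copies (complete_graph 3) ?G)" by (rule finite_subset) auto
    show "?f ` ?D \<subseteq> copies (complete_graph 3) ?G"
      unfolding copies_K3[OF simple_extremal] extremal_edge
    proof clarify
      fix i b assume "i < k" "b \<in> {2 * k..<n}"
      then have "extremal_adj k n (2 * i) (2 * i + 1)" "extremal_adj k n (2 * i + 1) b" "extremal_adj k n (2 * i) b"
        using assms unfolding extremal_adj_def by auto
      then show "triangle_graph (2 * i, 2 * i + 1, b) \<in> triangle_graph `
          {(a, b, c). extremal_adj k n a b \<and> extremal_adj k n b c \<and> extremal_adj k n a c}"
        by (intro imageI) simp
    qed
  qed
  finally show ?thesis by (simp add: num_copies_def)
qed

text \<open>k (n - 2 k) = n^2/8 - 2 (k - n/4)^2. Taking for k an integer nearest to n/4 costs at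
  most 1/2, and integrality gives the floor.\<close>

lemma floor_le_extremal:
  assumes "0 < n"
  shows "\<exists>k. 2 * k \<le> n \<and> \<lfloor>(real n)\<^sup>2 / 8\<rfloor> \<le> int (k * (n - 2 * k))"
proof -
  define q where "q = n div 4"
  have "n = 4 * q \<or> n = 4 * q + 1 \<or> n = 4 * q + 2 \<or> n = 4 * q + 3" unfolding q_def by presburger
  then consider "n = 4 * q" | "n = 4 * q + 1" | "n = 4 * q + 2" | "n = 4 * q + 3" by blast
  then show ?thesis
  proof cases
    case 1
    have "(real n)\<^sup>2 / 8 = real (q * (n - 2 * q))" unfolding 1 by (simp add: power2_eq_square)
    then show ?thesis using 1 by (intro exI[of _ q]) (simp add: floor_le_iff)
  next
    case 2
    have "(real n)\<^sup>2 / 8 = real (q * (n - 2 * q)) + 1/8" unfolding 2 by (simp add: power2_eq_square algebra_simps)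
    then show ?thesis using 2 by (intro exI[of _ q]) (simp add: floor_le_iff del: of_nat_mult)
  next
    case 3
    have "(real n)\<^sup>2 / 8 = real (q * (n - 2 * q)) + 1/2" unfolding 3 by (simp add: power2_eq_square algebra_simps)
    then show ?thesis using 3 by (intro exI[of _ q]) (simp add: floor_le_iff del: of_nat_mult)
  next
    case 4
    have "n - 2 * (q + 1) = 2 * q + 1" using 4 by simp
    then have "(real n)\<^sup>2 / 8 = real ((q + 1) * (n - 2 * (q + 1))) + 1/8"
      by (simp add: 4 power2_eq_square algebra_simps)
    then show ?thesis using 4 by (intro exI[of _ "q + 1"]) (simp add: floor_le_iff del: of_nat_mult)
  qed
qed

theorem theorem1p4:
  "\<exists>n0 :: nat. \<forall>n \<ge> n0.
     int (gen_turan n (complete_graph 3) (suspension (path_graph 5))) = \<lfloor>(real n)\<^sup>2 / 8\<rfloor>"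
proof (intro exI allI impI)
  \<comment> \<open>This assumption instantiates \<open>n0\<close>; the value is the one that
    \<open>many_good\<close> requires.\<close>
  fix n :: nat assume n: "10 ^ 30 \<le> n"
  let ?C = "copy_counts n (complete_graph 3) (suspension (path_graph 5))"
  have fin: "finite ?C" by (rule finite_copy_counts)
  have "0 < n" using n by (cases "n = 0") auto
  then obtain k where k: "2 * k \<le> n" "\<lfloor>(real n)\<^sup>2 / 8\<rfloor> \<le> int (k * (n - 2 * k))"
    using floor_le_extremal by blast
  have mem: "num_copies (complete_graph 3) (extremal_graph k n) \<in> ?C"
    unfolding copy_counts_def using simple_extremal free_extremal
    by (auto simp: extremal_graph_def intro!: exI[of _ "extremal_graph k n"])
  have "\<lfloor>(real n)\<^sup>2 / 8\<rfloor> \<le> int (num_copies (complete_graph 3) (extremal_graph k n))"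
    using k(2) num_triangles_extremal[OF k(1)] by linarith
  also have "\<dots> \<le> int (Max ?C)" using Max_ge[OF fin mem] by simp
  finally have "\<lfloor>(real n)\<^sup>2 / 8\<rfloor> \<le> int (Max ?C)" .
  moreover have "int (Max ?C) \<le> \<lfloor>(real n)\<^sup>2 / 8\<rfloor>"
  proof -
    have "Max ?C \<in> ?C" using fin mem by (intro Max_in) auto
    then obtain G :: "nat graph" where "Max ?C = num_copies (complete_graph 3) G" "simple_graph G"
      "card (verts G) = n" "free_of (suspension (path_graph 5)) G"
      unfolding copy_counts_def by auto
    then have "real (Max ?C) \<le> (real n)\<^sup>2 / 8" using num_triangles_upper n by metis
    then show ?thesis by (simp add: le_floor_iff)
  qed
  ultimately show "int (gen_turan n (complete_graph 3) (suspension (path_graph 5))) = \<lfloor>(real n)\<^sup>2 / 8\<rfloor>"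
    by (simp add: gen_turan_def)
qed

end
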